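(* A graph $G$ is a hereditary unigraph if and only if for each canonical component $G'$ of $G$, the degree sequence $d'=(d'_1,\dots,d'_p)$ of $G'$ satisfies the following: (i) if $G'$ is split then $p=1$, or $d'_1=\dots=d'_{m'} \in \{m', p-2\}$, or $d'_{m'+1}=\dots=d'_p \in \{1, m'-1\}$, where $m' = \max\{i: d'_i\ge i-1\}$; (ii) if $G'$ is not split then $d'$ is one of the sequences \[(2^5), \quad (1^{2r}), \quad (r,1^{2s+r}), \quad ((2r-2)^{2r}), \quad ((2s+r-1)^{2s+r},2s)\] for some $r \geq 2$ and $s \geq 1$.
   Context: All graphs are finite, with no loops or multiple edges. Degree sequences are listed in descending order, and $k^{\alpha}$ in a sequence denotes $\alpha$ copies of the term $k$. A unigraph is a graph that is, up to isomorphism, the unique graph having its degree sequence. A hereditary unigraph is a graph all of whose induced subgraphs (including itself) are unigraphs. Canonical decomposition: A graph is split if its vertex set can be partitioned into an independent set and a clique (either may be empty). A splitted graph is a triple $(G,A,B)$ where $G$ is a split graph and $A,B$ is a partition of $V(G)$ into an independent set $A$ and a clique $B$. Isomorphism of splitted graphs $(G,A,B)\cong(G',A',B')$ means a graph isomorphism $V(G)\to V(G')$ carrying $A$ to $A'$. For a splitted graph $(G,A,B)$ and a graph $H$ on disjoint vertex sets, the composition $(G,A,B)\circ H$ is the graph formed by adding to the disjoint union $G+H$ all edges $uv$ with $u\in B$ and $v\in V(H)$. The composition of two splitted graphs is a splitted graph (take unions of the independent sets and of the cliques), and $\circ$ is associative. A graph is decomposable if it can be written as $(G,A,B)\circ H$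 with $G$ and $H$ both having at least one vertex; otherwise it is indecomposable. By a theorem of Tyshkevich every graph $G$ has an expression $G=(G_k,A_k,B_k)\circ\dots\circ(G_1,A_1,B_1)\circ G_0$ with all $G_i$ indecomposable (and $k=0$ if $G$ is indecomposable), unique up to isomorphism of the splitted graphs $(G_i,A_i,B_i)$, $i\ge1$, and of $G_0$; this is the canonical decomposition, and $G_0,\dots,G_k$ are the canonical components of $G$. *)

theory Defs
  imports "Graph_Theory.Graph_Theory" "HOL-Library.Multiset"
begin

text \<open>
  Finite graphs without loops or multiple edges are the structures satisfying \<^locale>\<open>pair_graph\<close>
  (an edge \<open>uv\<close> is the pair of arcs \<open>(u, v)\<close>, \<open>(v, u)\<close>, so that the degree is the out-degree).
\<close>

definition degree_sequence :: "'a pair_pre_digraph \<Rightarrow> nat list" where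
  "degree_sequence G =
     rev (sorted_list_of_multiset (image_mset (out_degree (with_proj G)) (mset_set (pverts G))))"

text \<open>
  The graphs \<open>H\<close> range over the vertex type of \<open>G\<close>. This is no restriction: a graph with the same
  degree sequence as \<open>G\<close> has as many vertices as \<open>G\<close>, so it is isomorphic to a graph on \<open>pverts G\<close>.
\<close>
definition unigraph :: "'a pair_pre_digraph \<Rightarrow> bool" where
  "unigraph G \<longleftrightarrow> pair_graph G \<and>
     (\<forall>H :: 'a pair_pre_digraph. pair_graph H \<longrightarrow> degree_sequence H = degree_sequence G \<longrightarrow>
        digraph_iso (with_proj H) (with_proj G))"

definition hereditary_unigraph :: "'a pair_pre_digraph \<Rightarrow> bool" where
  "hereditary_unigraph G \<longleftrightarrow> pair_graph G \<and>
     (\<forall>H. induced_subgraph (with_proj H) (with_proj G) \<longrightarrow> unigraph H)"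

definition independent_set :: "'a pair_pre_digraph \<Rightarrow> 'a set \<Rightarrow> bool" where
  "independent_set G A \<longleftrightarrow> A \<subseteq> pverts G \<and> (\<forall>u\<in>A. \<forall>v\<in>A. (u, v) \<notin> parcs G)"

definition clique :: "'a pair_pre_digraph \<Rightarrow> 'a set \<Rightarrow> bool" where
  "clique G B \<longleftrightarrow> B \<subseteq> pverts G \<and> (\<forall>u\<in>B. \<forall>v\<in>B. u \<noteq> v \<longrightarrow> (u, v) \<in> parcs G)"

type_synonym 'a graph_triple = "'a pair_pre_digraph \<times> 'a set \<times> 'a set"

fun splitted_graph :: "'a graph_triple \<Rightarrow> bool" where
  "splitted_graph (G, A, B) \<longleftrightarrow> pair_graph G \<and> A \<union> B = pverts G \<and> A \<inter> B = {} \<and>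
     independent_set G A \<and> clique G B"

definition split_graph :: "'a pair_pre_digraph \<Rightarrow> bool" where
  "split_graph G \<longleftrightarrow> (\<exists>A B. splitted_graph (G, A, B))"

text \<open>Only meaningful if \<open>G\<close> and \<open>H\<close> have disjoint vertex sets.\<close>
fun composition :: "'a graph_triple \<Rightarrow> 'a pair_pre_digraph \<Rightarrow> 'a pair_pre_digraph" where
  "composition (G, A, B) H =
     \<lparr> pverts = pverts G \<union> pverts H,
       parcs = parcs G \<union> parcs H \<union> B \<times> pverts H \<union> pverts H \<times> B \<rparr>"

definition decomposable :: "'a pair_pre_digraph \<Rightarrow> bool" where
  "decomposable F \<longleftrightarrow> (\<exists>G A B H. splitted_graph (G, A, B) \<and> pair_graph H \<and>
     pverts G \<inter> pverts H = {} \<and> pverts G \<noteq> {} \<and> pverts H \<noteq> {} \<and>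
     F = composition (G, A, B) H)"

abbreviation indecomposable :: "'a pair_pre_digraph \<Rightarrow> bool" where
  "indecomposable G \<equiv> \<not> decomposable G"

text \<open>
  \<open>canonical_decomposition G [(G\<^sub>k, A\<^sub>k, B\<^sub>k), \<dots>, (G\<^sub>1, A\<^sub>1, B\<^sub>1)] G\<^sub>0\<close> expresses
  that \<open>G = (G\<^sub>k, A\<^sub>k, B\<^sub>k) \<circ> \<dots> \<circ> (G\<^sub>1, A\<^sub>1, B\<^sub>1) \<circ> G\<^sub>0\<close>, associated to the right,
  with indecomposable factors. Factors without vertices are excluded: they are vacuously
  indecomposable and are units for \<open>\<circ>\<close>, so admitting them would destroy uniqueness.
  Consequently the null graph has no canonical components.
\<close>
inductive canonical_decomposition ::
  "'a pair_pre_digraph \<Rightarrow> 'a graph_triple list \<Rightarrow> 'a pair_pre_digraph \<Rightarrow> bool" where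
  base: "pair_graph G\<^sub>0 \<Longrightarrow> pverts G\<^sub>0 \<noteq> {} \<Longrightarrow> indecomposable G\<^sub>0 \<Longrightarrow>
    canonical_decomposition G\<^sub>0 [] G\<^sub>0"
| step: "splitted_graph (G, A, B) \<Longrightarrow> pverts G \<noteq> {} \<Longrightarrow> indecomposable G \<Longrightarrow>
    canonical_decomposition H Ts G\<^sub>0 \<Longrightarrow> pverts G \<inter> pverts H = {} \<Longrightarrow>
    canonical_decomposition (composition (G, A, B) H) ((G, A, B) # Ts) G\<^sub>0"

definition canonical_component :: "'a pair_pre_digraph \<Rightarrow> 'a pair_pre_digraph \<Rightarrow> bool" where
  "canonical_component G G' \<longleftrightarrow>
     (\<exists>Ts G\<^sub>0. canonical_decomposition G Ts G\<^sub>0 \<and> (G' = G\<^sub>0 \<or> G' \<in> fst ` set Ts))"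

text \<open>The term \<open>d\<^sub>i\<close> of a sequence indexed from 1, for \<open>1 \<le> i \<le> length d\<close>.\<close>
definition term_at :: "nat list \<Rightarrow> nat \<Rightarrow> nat" where
  "term_at d i = d ! (i - 1)"

text \<open>The set is nonempty for every nonempty \<open>d\<close>, as it contains 1.\<close>
definition durfee_index :: "nat list \<Rightarrow> nat" where
  "durfee_index d = Max {i \<in> {1..length d}. term_at d i \<ge> i - 1}"

end

theory Submission
  imports Defs "HOL-Combinatorics.Permutations"
begin

text \<open>
  Suppose that \<open>G\<close> is a hereditary unigraph. If \<open>xy\<close>, \<open>zw\<close> are edges and \<open>yz\<close>, \<open>wx\<close> are not, exchanging them
  preserves all degrees $d$ but changes the sum of $d(u)d(v)$ over the edges by $(d(x) - d(z))(d(y) - d(w))$ up to sign. So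
  one of the factors is zero (\<open>unigraph_no_unbalanced_switch\<close>). As this applies to every induced subgraph with the
  degrees taken in it, \<open>G\<close> is \<open>balanced\<close>, and so are its canonical components. Balance and indecomposability
  determine the components, by growing an induced subgraph of the desired shape until it is everything. A
  component that is not split contains $2K_2$, $C_4$ or $C_5$ (\<open>nonsplit_contains_core\<close>), and one may pass to larger and
  larger graphs $K_{1,r} + sK_2$, complements of such graphs, or $C_5$ (\<open>core_grow\<close>): the new vertices come from a vertex
  that is adjacent to some but not all vertices of the subgraph, or, if there is none, from the fact that the
  remaining vertices do not split off. A split component with several vertices is given by a bipartite graph between its independent set
  and its clique. Read as an orientation of the complete bipartite graph, it is strongly connected exactly if the
  component is indecomposable, and growing a directed 4-cycle yields a disjoint union of stars with all centres on one
  side, or the bipartite complement of such a graph (\<open>star_forest_grow\<close>, \<open>strong_stable_imp_star_like\<close>). The degrees of these graphs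
  are those of the theorem.
  
  Conversely, if all components have such degrees, then \<open>G\<close> belongs to the class \<open>assembled\<close>, which is closed under
  induced subgraphs. Its members are unigraphs: in a composition with independent set \<open>A\<close>, clique \<open>B\<close> and inner vertex set
  $C$, the sum of the degrees over \<open>B\<close> minus the sum over \<open>A\<close> has the largest value that is possible for any graph on these
  vertices, which forces every graph with the same degrees to be composed along the same sets
  (\<open>splits_off_same_degrees\<close>). It remains to identify the factors, which
  are matchings, stars and disjoint unions of these up to complementation, apart from $C_5$.
\<close>

section \<open>Degrees and switches\<close>

definition deg :: "('a \<Rightarrow> 'a \<Rightarrow> bool) \<Rightarrow> 'a set \<Rightarrow> 'a \<Rightarrow> nat" where
  "deg E W v = card {u \<in> W. E v u}"

lemma deg_empty [simp]: "deg E {} v = 0"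
  unfolding deg_def by simp

lemma deg_insert [simp]:
  assumes "finite W" "x \<notin> W"
  shows "deg E (insert x W) v = of_bool (E v x) + deg E W v"
proof -
  have "{u \<in> insert x W. E v u} = (if E v x then insert x {u \<in> W. E v u} else {u \<in> W. E v u})" by auto
  then show ?thesis using assms unfolding deg_def by simp
qed

definition co :: "('a \<Rightarrow> 'a \<Rightarrow> bool) \<Rightarrow> 'a \<Rightarrow> 'a \<Rightarrow> bool" where
  "co E u v \<longleftrightarrow> u \<noteq> v \<and> \<not> E u v"

locale simple_adjacency =
  fixes E :: "'a \<Rightarrow> 'a \<Rightarrow> bool"
  assumes sym: "E u v \<Longrightarrow> E v u" and irrefl: "\<not> E u u"
begin

lemma comm: "E u v \<longleftrightarrow> E v u"
  using sym by blast

lemma simple_adjacency_co: "simple_adjacency (co E)"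
  by standard (auto simp: co_def comm)

lemma co_co: "co (co E) = E"
  unfolding co_def by (auto simp: fun_eq_iff irrefl)

lemma deg_co:
  assumes "finite W" "v \<in> W"
  shows "deg (co E) W v + deg E W v + 1 = card W"
proof -
  let ?N = "{u \<in> W. E v u}"
  have N: "?N \<subseteq> W - {v}" using irrefl by auto
  have "{u \<in> W. co E v u} = (W - {v}) - ?N" unfolding co_def by auto
  then have "card {u \<in> W. co E v u} = card (W - {v}) - card ?N"
    using N assms(1) by (simp add: card_Diff_subset)
  moreover have "card ?N \<le> card (W - {v})" using N assms(1) by (intro card_mono) auto
  moreover have "Suc (card (W - {v})) = card W" using assms by (rule card_Suc_Diff1)
  ultimately show ?thesis unfolding deg_def by linarith
qed

end

text \<open>
  What remains of the unigraph property. Exchanging the edges \<open>xy\<close>, \<open>zw\<close> for the nonedges \<open>yz\<close>, \<open>wx\<close>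
  changes no degree, so in a graph that is determined by its degrees the result must be an isomorphic
  graph; the stated equality of degrees is a necessary condition for this
  (\<open>unigraph_no_unbalanced_switch\<close> below). It is imposed on all induced subgraphs at once.
\<close>
definition balanced :: "('a \<Rightarrow> 'a \<Rightarrow> bool) \<Rightarrow> 'a set \<Rightarrow> bool" where
  "balanced E V \<longleftrightarrow> (\<forall>W\<subseteq>V. \<forall>x\<in>W. \<forall>y\<in>W. \<forall>z\<in>W. \<forall>w\<in>W.
     E x y \<and> co E y z \<and> E z w \<and> co E w x \<longrightarrow> deg E W x = deg E W z \<or> deg E W y = deg E W w)"

lemma balanced_subset:
  assumes "balanced E V" "W \<subseteq> V" shows "balanced E W"
  unfolding balanced_def
proof (intro allI impI)
  fix X assume "X \<subseteq> W"
  then have "X \<subseteq> V" using assms(2) by (rule subset_trans)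
  then show "\<forall>x\<in>X. \<forall>y\<in>X. \<forall>z\<in>X. \<forall>w\<in>X.
     E x y \<and> co E y z \<and> E z w \<and> co E w x \<longrightarrow> deg E X x = deg E X z \<or> deg E X y = deg E X w"
    by (rule assms(1)[unfolded balanced_def, THEN spec, THEN mp])
qed

lemma balancedD:
  assumes "balanced E V" "W \<subseteq> V" "{x, y, z, w} \<subseteq> W" "E x y" "co E y z" "E z w" "co E w x"
    "deg E W x \<noteq> deg E W z" "deg E W y \<noteq> deg E W w"
  shows False
  using assms(1)[unfolded balanced_def, rule_format, of W x y z w] assms(2-) by simp

section \<open>Indecomposable graphs that are not split\<close>

text \<open>
  The graph induced on \<open>S\<close> is $K_{1,r} + sK_2$ with $r, s \ge 1$, and \<open>c\<close> is the centre of the star. For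
  $r = 1$ this is a matching, and any of its vertices can play the role of \<open>c\<close>.
\<close>
definition star_matching :: "('a \<Rightarrow> 'a \<Rightarrow> bool) \<Rightarrow> 'a \<Rightarrow> 'a set \<Rightarrow> bool" where
  "star_matching E c S \<longleftrightarrow> c \<in> S \<and> (\<forall>v\<in>S - {c}. \<exists>!u. u \<in> S \<and> E v u) \<and>
     (\<exists>l\<in>S. E c l) \<and> (\<exists>q\<in>S - {c}. \<not> E c q)"

definition five_cycle :: "('a \<Rightarrow> 'a \<Rightarrow> bool) \<Rightarrow> 'a \<Rightarrow> 'a \<Rightarrow> 'a \<Rightarrow> 'a \<Rightarrow> 'a \<Rightarrow> bool" where
  "five_cycle E a b c d e \<longleftrightarrow> distinct [a, b, c, d, e] \<and>
     E a b \<and> E b c \<and> E c d \<and> E d e \<and> E e a \<and> \<not> E a c \<and> \<not> E b d \<and> \<not> E c e \<and> \<not> E d a \<and> \<not> E e b"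

text \<open>
  These turn out to be the shapes of the indecomposable hereditary unigraphs that are not split.
\<close>
definition core :: "('a \<Rightarrow> 'a \<Rightarrow> bool) \<Rightarrow> 'a set \<Rightarrow> bool" where
  "core E S \<longleftrightarrow> (\<exists>c. star_matching E c S) \<or> (\<exists>c. star_matching (co E) c S) \<or>
     (\<exists>a b c d e. five_cycle E a b c d e \<and> S = {a, b, c, d, e})"

text \<open>
  The graph on \<open>V\<close> is a composition whose outer factor has the independent set \<open>A\<close> and the clique \<open>B\<close>, and
  whose inner factor has the vertex set \<open>V - A - B\<close>. Either factor may be empty here.
\<close>
definition splits_off :: "('a \<Rightarrow> 'a \<Rightarrow> bool) \<Rightarrow> 'a set \<Rightarrow> 'a set \<Rightarrow> 'a set \<Rightarrow> bool" where
  "splits_off E V A B \<longleftrightarrow> A \<subseteq> V \<and> B \<subseteq> V \<and> A \<inter> B = {} \<and> (\<forall>a\<in>A. \<forall>a'\<in>A. \<not> E a a') \<and>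
     (\<forall>b\<in>B. \<forall>b'\<in>B. b \<noteq> b' \<longrightarrow> E b b') \<and>
     (\<forall>c\<in>V - A - B. (\<forall>b\<in>B. E b c) \<and> (\<forall>a\<in>A. \<not> E a c))"

definition indecomposable_on :: "('a \<Rightarrow> 'a \<Rightarrow> bool) \<Rightarrow> 'a set \<Rightarrow> bool" where
  "indecomposable_on E V \<longleftrightarrow> (\<forall>A B. splits_off E V A B \<longrightarrow> A \<union> B = {} \<or> A \<union> B = V)"

context simple_adjacency
begin

text \<open>
  In the complement the same four vertices alternate again, read from \<open>y\<close> instead of \<open>x\<close>, and
  complementation preserves equality of degrees.
\<close>
lemma balanced_co:
  assumes "balanced E V" "finite V" shows "balanced (co E) V"
  unfolding balanced_def co_co
proof (intro allI impI ballI, elim conjE)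
  fix W x y z w
  assume W: "W \<subseteq> V" and i: "x \<in> W" "y \<in> W" "z \<in> W" "w \<in> W"
    and e: "co E x y" "E y z" "co E z w" "E w x"
  have f: "finite W" using W assms(2) finite_subset by blast
  have "deg E W w = deg E W y \<or> deg E W x = deg E W z"
    using assms(1)[unfolded balanced_def, rule_format, of W y z w x] W i e by (auto simp: co_def comm)
  then show "deg (co E) W x = deg (co E) W z \<or> deg (co E) W y = deg (co E) W w"
    using deg_co[OF f i(1)] deg_co[OF f i(2)] deg_co[OF f i(3)] deg_co[OF f i(4)] by linarith
qed

lemma five_cycle_co: "five_cycle E a b c d e \<Longrightarrow> five_cycle (co E) a c e b d"
  unfolding five_cycle_def co_def by (auto simp: comm)

lemma five_cycle_facts:
  assumes "five_cycle E a b c d e"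
  shows "distinct [a, b, c, d, e]" "E a b" "E b c" "E c d" "E d e" "E e a" "E b a" "E c b" "E d c" "E e d" "E a e"
    "\<not> E a c" "\<not> E b d" "\<not> E c e" "\<not> E d a" "\<not> E e b" "\<not> E c a" "\<not> E d b" "\<not> E e c" "\<not> E a d" "\<not> E b e"
    "\<not> E a a" "\<not> E b b" "\<not> E c c" "\<not> E d d" "\<not> E e e"
  using assms irrefl comm unfolding five_cycle_def by blast+

lemma five_cycle_rotate: "five_cycle E a b c d e \<Longrightarrow> five_cycle E b c d e a"
  unfolding five_cycle_def by auto

lemma core_coI: "core E S \<Longrightarrow> core (co E) S"
  unfolding core_def co_co using five_cycle_co by (fastforce simp: insert_commute)

text \<open>
  If \<open>v\<close> has no neighbour among \<open>c\<close>, \<open>d\<close>, then the five vertices induce $K_3 + K_2$; if it has one, they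
  induce a triangle with a pendant path of two edges. Both graphs admit an unbalanced switch.
\<close>
lemma two_edges_triangle:
  assumes bal: "balanced E V" and V: "{v, a, b, c, d} \<subseteq> V" and dist: "distinct [v, a, b, c, d]"
    and e: "E a b" "E c d" "\<not> E a c" "\<not> E a d" "\<not> E b c" "\<not> E b d"
    and v: "E v a" "E v b"
  shows "E v c \<and> E v d"
proof (rule ccontr)
  assume n: "\<not> (E v c \<and> E v d)"
  have e': "E b a" "E d c" "\<not> E c a" "\<not> E d a" "\<not> E c b" "\<not> E d b" using e comm by blast+
  have v': "E a v" "E b v" "E c v \<longleftrightarrow> E v c" "E d v \<longleftrightarrow> E v d" using v comm by blast+
  note [simp] = e e' irrefl co_def v v'
  consider "\<not> E v c" "\<not> E v d" | "E v c" "\<not> E v d" | "\<not> E v c" "E v d" using n by blast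
  then show False
  proof cases
    case 1
    show ?thesis by (rule balancedD[OF bal V, of a b c d]) (use 1 dist in auto)
  next
    case 2
    show ?thesis by (rule balancedD[OF bal V, of v a c d]) (use 2 dist in auto)
  next
    case 3
    show ?thesis by (rule balancedD[OF bal V, of v a d c]) (use 3 dist in auto)
  qed
qed

text \<open>
  By \<open>two_edges_triangle\<close> the only alternative is that the five vertices induce a path, and its two end
  edges admit an unbalanced switch.
\<close>
lemma two_edges_path:
  assumes bal: "balanced E V" and V: "{v, a, b, c, d} \<subseteq> V" and dist: "distinct [v, a, b, c, d]"
    and e: "E a b" "E c d" "\<not> E a c" "\<not> E a d" "\<not> E b c" "\<not> E b d"
    and v: "E v a" "E v c"
  shows "E v b \<and> E v d"
proof -
  have e': "E b a" "E d c" "\<not> E c a" "\<not> E d a" "\<not> E c b" "\<not> E d b" using e comm by blast+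
  have v': "E a v" "E c v" "E b v \<longleftrightarrow> E v b" "E d v \<longleftrightarrow> E v d" using v comm by blast+
  have V': "{v, c, d, a, b} \<subseteq> V" and dist': "distinct [v, c, d, a, b]" using V dist by auto
  have "E v b \<longleftrightarrow> E v d"
    using two_edges_triangle[OF bal V dist e v(1)] two_edges_triangle[OF bal V' dist' e(2,1) e'(3,5,4,6) v(2)] by blast
  moreover have "E v b \<or> E v d"
  proof (rule ccontr)
    assume n: "\<not> (E v b \<or> E v d)"
    show False by (rule balancedD[OF bal V, of b a c d]) (use n dist e e' irrefl v v' in \<open>auto simp: co_def\<close>)
  qed
  ultimately show ?thesis by blast
qed

text \<open>
  In other words, a vertex outside an induced $2K_2$ is adjacent to at most one or to all of its vertices.
\<close>
lemma two_edges_dichotomy: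
  assumes bal: "balanced E V" and V: "{v, a, b, c, d} \<subseteq> V" and dist: "distinct [v, a, b, c, d]"
    and e: "E a b" "E c d" "\<not> E a c" "\<not> E a d" "\<not> E b c" "\<not> E b d"
    and two: "E v a \<and> E v b \<or> E v a \<and> E v c \<or> E v a \<and> E v d \<or> E v b \<and> E v c \<or> E v b \<and> E v d \<or> E v c \<and> E v d"
  shows "E v a \<and> E v b \<and> E v c \<and> E v d"
proof -
  have e': "E b a" "E d c" "\<not> E c a" "\<not> E d a" "\<not> E c b" "\<not> E d b" using e comm by blast+
  have V': "{v, c, d, a, b} \<subseteq> V" "{v, a, b, d, c} \<subseteq> V" "{v, b, a, c, d} \<subseteq> V" "{v, b, a, d, c} \<subseteq> V" using V by auto
  have dist': "distinct [v, c, d, a, b]" "distinct [v, a, b, d, c]" "distinct [v, b, a, c, d]" "distinct [v, b, a, d, c]"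
    using dist by auto
  from two consider "E v a" "E v b" | "E v c" "E v d" | "E v a" "E v c" | "E v a" "E v d" | "E v b" "E v c" | "E v b" "E v d"
    by blast
  then show ?thesis
  proof cases
    case 1 then show ?thesis using two_edges_triangle[OF bal V dist e] by blast
  next
    case 2 then show ?thesis using two_edges_triangle[OF bal V'(1) dist'(1) e(2,1) e'(3,5,4,6)] by blast
  next
    case 3 then show ?thesis using two_edges_path[OF bal V dist e] by blast
  next
    case 4 then show ?thesis using two_edges_path[OF bal V'(2) dist'(2) e(1) e'(2) e(4,3,6,5)] by blast
  next
    case 5 then show ?thesis using two_edges_path[OF bal V'(3) dist'(3) e'(1) e(2) e(5,6,3,4)] by blast
  next
    case 6 then show ?thesis using two_edges_path[OF bal V'(4) dist'(4) e'(1,2) e(6,5,4,3)] by blast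
  qed
qed

lemma star_matching_partner:
  assumes "star_matching E c S" "v \<in> S" "v \<noteq> c"
  shows "\<exists>u\<in>S. u \<noteq> v \<and> (\<forall>w\<in>S. E v w \<longleftrightarrow> w = u)"
  using assms irrefl unfolding star_matching_def by (metis Diff_iff singletonD)

lemma star_matching_add_leaf:
  assumes "star_matching E c S" "v \<notin> S" "\<And>u. u \<in> S \<Longrightarrow> E v u \<longleftrightarrow> u = c"
  shows "star_matching E c (insert v S)"
proof -
  have cS: "c \<in> S" using assms(1) unfolding star_matching_def by blast
  have "\<exists>!u. u \<in> insert v S \<and> E w u" if w: "w \<in> insert v S - {c}" for w
  proof (cases "w = v")
    case True
    then show ?thesis using assms(3) irrefl cS by (intro ex1I[of _ c]) auto
  next
    case False
    then have w': "\<exists>!u. u \<in> S \<and> E w u" "\<not> E w v" using assms w comm[of w v] unfolding star_matching_def by auto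
    obtain x where x: "x \<in> S" "E w x" "\<And>y. y \<in> S \<Longrightarrow> E w y \<Longrightarrow> y = x" using w'(1) by blast
    have "y = x" if "y \<in> insert v S" "E w y" for y using that w'(2) x(3)[of y] by auto
    then show ?thesis using x(1,2) by (intro ex1I[of _ x]) auto
  qed
  then have "\<forall>w\<in>insert v S - {c}. \<exists>!u. u \<in> insert v S \<and> E w u" by (rule ballI)
  moreover have "\<exists>l\<in>insert v S. E c l" "\<exists>q\<in>insert v S - {c}. \<not> E c q"
    using assms(1) unfolding star_matching_def by auto
  ultimately show ?thesis using cS unfolding star_matching_def by simp
qed

text \<open>
  When the star is a single edge, the graph is a perfect matching and has no distinguished vertex.
\<close>
lemma star_matching_recenter:
  assumes sm: "star_matching E c S" and u: "u \<in> S" and c: "\<And>w w'. w \<in> S \<Longrightarrow> E c w \<Longrightarrow> w' \<in> S \<Longrightarrow> E c w' \<Longrightarrow> w = w'"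
  shows "star_matching E u S"
proof -
  obtain l where l: "l \<in> S" "E c l" using sm unfolding star_matching_def by blast
  obtain q where q: "q \<in> S" "q \<noteq> c" "\<not> E c q" using sm unfolding star_matching_def by blast
  have one: "\<exists>!w. w \<in> S \<and> E x w" if x: "x \<in> S" for x
  proof (cases "x = c")
    case True
    then show ?thesis using l c by (intro ex1I[of _ l]) auto
  next
    case False
    then show ?thesis using sm x unfolding star_matching_def by blast
  qed
  have cS: "c \<in> S" using sm unfolding star_matching_def by blast
  have "\<exists>x\<in>S - {u}. \<not> E u x"
  proof (cases "E u c")
    case True
    then have "\<not> E u q" using one[OF u] q cS by blast
    moreover have "q \<noteq> u" using True q(3) comm by blast
    ultimately show ?thesis using q by blast
  next
    case False
    show ?thesis
    proof (cases "u = c")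
      case True
      then show ?thesis using q by blast
    qed (use False cS in blast)
  qed
  moreover have "\<exists>l\<in>S. E u l" using one[OF u] by blast
  ultimately show ?thesis using one u unfolding star_matching_def by blast
qed

lemma star_matching_add_edge:
  assumes "star_matching E c S" "E y y'" "y \<notin> S" "y' \<notin> S" "\<And>s. s \<in> S \<Longrightarrow> \<not> E y s \<and> \<not> E y' s"
  shows "star_matching E c (S \<union> {y, y'})"
proof -
  have n: "\<not> E s y" "\<not> E s y'" if "s \<in> S" for s using assms(5)[OF that] comm by blast+
  have "\<exists>!u. u \<in> S \<union> {y, y'} \<and> E w u" if w: "w \<in> S \<union> {y, y'} - {c}" for w
  proof -
    consider "w = y" | "w = y'" | "w \<in> S - {c}" using w by blast
    then show ?thesis
    proof cases
      case 1
      then show ?thesis using assms(2,5) irrefl by (intro ex1I[of _ y']) auto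
    next
      case 2
      then show ?thesis using assms(2,5) irrefl comm[of y y'] by (intro ex1I[of _ y]) auto
    next
      case 3
      then have "\<exists>!u. u \<in> S \<and> E w u" using assms(1) unfolding star_matching_def by blast
      then obtain x where x: "x \<in> S" "E w x" "\<And>y. y \<in> S \<Longrightarrow> E w y \<Longrightarrow> y = x" by blast
      have "z = x" if "z \<in> S \<union> {y, y'}" "E w z" for z using that n[of w] 3 x(3)[of z] by auto
      then show ?thesis using x(1,2) by (intro ex1I[of _ x]) auto
    qed
  qed
  then have "\<forall>w\<in>S \<union> {y, y'} - {c}. \<exists>!u. u \<in> S \<union> {y, y'} \<and> E w u" by (rule ballI)
  moreover have "\<exists>l\<in>S \<union> {y, y'}. E c l" "\<exists>q\<in>S \<union> {y, y'} - {c}. \<not> E c q" "c \<in> S \<union> {y, y'}"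
    using assms(1) unfolding star_matching_def by auto
  ultimately show ?thesis unfolding star_matching_def by blast
qed

text \<open>
  Each edge of the matching forms an induced $2K_2$ with each other edge. By \<open>two_edges_dichotomy\<close>, two neighbours of \<open>v\<close>
  in \<open>S\<close> that are not both leaves would therefore make \<open>v\<close> adjacent to all of \<open>S\<close>. If \<open>v\<close> is adjacent to \<open>c\<close>, it is a new
  leaf. Otherwise a neighbour \<open>u\<close> of \<open>v\<close> becomes the new centre: the star has no second leaf, as this would create an
  unbalanced switch, inside $P_4 + K_2$ or $C_4 + K_2$ if \<open>u\<close> is a leaf and inside $2P_3$ if \<open>u\<close> belongs to the matching.
\<close>
lemma star_matching_grow_mixed:
  assumes bal: "balanced E V" and sm: "star_matching E c S" and S: "S \<subseteq> V" and v: "v \<in> V - S"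
    and mixed: "\<exists>u\<in>S. E v u" "\<exists>u\<in>S. \<not> E v u"
  shows "\<exists>c. star_matching E c (insert v S)"
proof -
  have cS: "c \<in> S" using sm unfolding star_matching_def by blast
  obtain l where l: "l \<in> S" "E c l" using sm unfolding star_matching_def by blast
  obtain q where q: "q \<in> S" "q \<noteq> c" "\<not> E c q" using sm unfolding star_matching_def by blast
  \<comment> \<open>The neighbour of \<open>w\<close> in \<open>S\<close>, which is \<open>c\<close> for a leaf and the partner in the matching otherwise.\<close>
  define p where "p w = (THE u. u \<in> S \<and> E w u)" for w
  have p: "p w \<in> S" "E w (p w)" and p_eq: "\<And>u. u \<in> S \<Longrightarrow> E w u \<longleftrightarrow> u = p w" if "w \<in> S" "w \<noteq> c" for w
  proof -
    have u: "\<exists>!u. u \<in> S \<and> E w u" using sm that unfolding star_matching_def by blast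
    have "p w \<in> S \<and> E w (p w)" unfolding p_def by (rule theI'[OF u])
    then show "p w \<in> S" "E w (p w)" "\<And>u. u \<in> S \<Longrightarrow> E w u \<longleftrightarrow> u = p w" using u by blast+
  qed
  have leaf: "p w = c" if "w \<in> S" "E c w" for w
    using p_eq[of w c] that cS irrefl comm by blast
  have far: "p w \<noteq> c" "p (p w) = w" "\<not> E c (p w)" "p w \<noteq> w" if "w \<in> S" "w \<noteq> c" "\<not> E c w" for w
  proof -
    show 1: "p w \<noteq> c" using p[OF that(1,2)] that(3) comm by metis
    show 2: "p (p w) = w" using p_eq[OF p(1)[OF that(1,2)] 1 that(1)] p(2)[OF that(1,2)] comm[of w "p w"] by simp
    show "\<not> E c (p w)" using leaf[OF p(1)[OF that(1,2)]] 2 that(2) by auto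
    show "p w \<noteq> w" using p(2)[OF that(1,2)] irrefl by metis
  qed
  have apart: "\<not> E a w" "\<not> E a (p w)" "a \<noteq> w" "a \<noteq> p w"
    if w: "w \<in> S" "w \<noteq> c" "\<not> E c w" and a: "a \<in> S" "a \<noteq> w" "a \<noteq> p w" for w a
    using far[OF w] p_eq[OF w(1,2) a(1)] p_eq[OF p(1)[OF w(1,2)] far(1)[OF w] a(1)] a comm by auto
  have vS: "v \<notin> S" "\<And>w. w \<in> S \<Longrightarrow> w \<noteq> v" using v by auto
  have quad: "E v a \<and> E v b \<and> E v w \<and> E v (p w)"
    if w: "w \<in> S" "w \<noteq> c" "\<not> E c w" and a: "a \<in> S" "b \<in> S" "E a b" "a \<noteq> w" "a \<noteq> p w" "b \<noteq> w" "b \<noteq> p w"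
      and two: "E v a \<and> E v b \<or> E v a \<and> E v w \<or> E v a \<and> E v (p w) \<or> E v b \<and> E v w \<or> E v b \<and> E v (p w) \<or> E v w \<and> E v (p w)"
    for w a b
  proof -
    have pw: "p w \<in> S" "E w (p w)" using p w by auto
    have "a \<noteq> b" using a irrefl by metis
    then have "distinct [v, a, b, w, p w]" using a far(4)[OF w] vS(1) w(1) pw(1) by auto
    moreover have "{v, a, b, w, p w} \<subseteq> V" using a w pw S v by auto
    ultimately show ?thesis
      using two_edges_dichotomy[OF bal _ _ a(3) pw(2) apart(1,2)[OF w a(1,4,5)] apart(1,2)[OF w a(2,6,7)] two] by blast
  qed
  have leaf_far: "a \<noteq> w" "a \<noteq> p w" "c \<noteq> w" "c \<noteq> p w"
    if "a \<in> S" "E c a" "w \<in> S" "w \<noteq> c" "\<not> E c w" for a w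
    using that far[OF that(3-5)] by auto
  show ?thesis
  proof (cases "E v c")
    case True
    have "u = c" if u: "u \<in> S" "E v u" for u
    proof (rule ccontr)
      assume n: "u \<noteq> c"
      have "\<exists>w. w \<in> S \<and> w \<noteq> c \<and> \<not> E c w \<and> E v w"
      proof (cases "E c u")
        case True
        then show ?thesis using quad[OF q cS u(1) True] leaf_far[OF u(1) True q] u \<open>E v c\<close> q by blast
      qed (use n u in blast)
      then obtain w where w: "w \<in> S" "w \<noteq> c" "\<not> E c w" "E v w" by blast
      have leaves: "E v a" if "a \<in> S" "E c a" for a
        using quad[OF w(1-3) cS that] leaf_far[OF that w(1-3)] w(4) True by blast
      have "E v x" if x: "x \<in> S" for x
      proof (cases "x \<noteq> c \<and> \<not> E c x")
        case f: True
        then show ?thesis using quad[of x c l] leaf_far[OF l x] x cS l True leaves[OF l] by blast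
      next
        case False
        then show ?thesis using True leaves[OF x] by blast
      qed
      then show False using mixed(2) by blast
    qed
    then have "star_matching E c (insert v S)" using star_matching_add_leaf[OF sm vS(1)] True by blast
    then show ?thesis by blast
  next
    case nvc: False
    obtain u where u: "u \<in> S" "E v u" using mixed(1) by blast
    have uc: "u \<noteq> c" using u nvc by blast
    have pu: "p u \<in> S" "E u (p u)" using p[OF u(1) uc] by auto
    have uniq: "w = u" if w: "w \<in> S" "E v w" and both_leaves: "\<not> (E c u \<and> E c w)" for w
    proof (rule ccontr)
      assume n: "w \<noteq> u"
      have wc: "w \<noteq> c" using w nvc by blast
      have pw: "p w \<in> S" "E w (p w)" using p[OF w(1) wc] by auto
      consider "E c u" "\<not> E c w" | "\<not> E c u" "E c w" | "\<not> E c u" "\<not> E c w" "w = p u" | "\<not> E c u" "\<not> E c w" "w \<noteq> p u"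
        using both_leaves by blast
      then show False
      proof cases
        case 1
        then show ?thesis using quad[OF w(1) wc 1(2) cS u(1) 1(1)] leaf_far[OF u(1) 1(1) w(1) wc 1(2)] u w nvc by blast
      next
        case 2
        then show ?thesis using quad[OF u(1) uc 2(1) cS w(1) 2(2)] leaf_far[OF w(1) 2(2) u(1) uc 2(1)] u w nvc by blast
      next
        case 3
        then show ?thesis using quad[OF u(1) uc 3(1) cS l] leaf_far[OF l u(1) uc 3(1)] u w nvc by blast
      next
        case 4
        have "p w \<noteq> u" "p w \<noteq> p u" using 4 n far(2)[OF u(1) uc 4(1)] far(2)[OF w(1) wc 4(2)] by auto
        then have "E v (p u)" using quad[OF u(1) uc 4(1) w(1) pw n 4(3)] u w by blast
        then show ?thesis using quad[OF u(1) uc 4(1) cS l] leaf_far[OF l u(1) uc 4(1)] u nvc by blast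
      qed
    qed
    have cu_leaf: "l2 = u" if cu: "E c u" and l2: "l2 \<in> S" "E c l2" for l2
    proof (rule ccontr)
      assume n: "l2 \<noteq> u"
      have pq: "p q \<in> S" "E q (p q)" using p q by auto
      have d: "distinct [v, u, c, l2, q, p q]" using leaf_far[OF u(1) cu q] leaf_far[OF l2 q] n uc q far(4)[OF q] vS u l2 pq cS irrefl[of c] by auto
      have V: "{v, u, c, l2, q, p q} \<subseteq> V" using v S u cS l2 q pq by auto
      have "\<not> E v q" "\<not> E v (p q)" using uniq[OF q(1)] uniq[OF pq(1)] far(3)[OF q] q cu by blast+
      moreover have "\<not> E u l2" using p_eq[OF u(1) uc l2(1)] leaf[OF u(1) cu] l2(2) irrefl by auto
      ultimately have e: "\<not> E v q" "\<not> E v (p q)" "\<not> E q v" "\<not> E (p q) v" "\<not> E u l2" "\<not> E l2 u"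
        "E v u" "E u v" "E c u" "E u c" "E c l2" "E l2 c" "E q (p q)" "E (p q) q" "\<not> E c v" "\<not> E v c"
        "\<not> E c q" "\<not> E q c" "\<not> E c (p q)" "\<not> E (p q) c" "\<not> E u q" "\<not> E q u" "\<not> E u (p q)" "\<not> E (p q) u"
        "\<not> E l2 q" "\<not> E q l2" "\<not> E l2 (p q)" "\<not> E (p q) l2"
        using u cu l2 pq nvc q far(3)[OF q] apart(1,2)[OF q u(1) leaf_far(1,2)[OF u(1) cu q]]
          apart(1,2)[OF q l2(1) leaf_far(1,2)[OF l2 q]] comm by blast+
      show False
        by (rule balancedD[OF bal V, of u c q "p q"]) (use e irrefl d in \<open>auto simp: co_def\<close>)
    qed
    have c_leaf: "l1 = l2" if l1: "l1 \<in> S" "E c l1" and l2: "l2 \<in> S" "E c l2" for l1 l2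
    proof (cases "E c u")
      case True
      then show ?thesis using cu_leaf l1 l2 by blast
    next
      case cu: False
      note f = far[OF u(1) uc cu]
      show ?thesis
      proof (rule ccontr)
        assume n: "l1 \<noteq> l2"
        have d: "distinct [l1, c, l2, p u, u, v]"
          using leaf_far[OF l1 u(1) uc cu] leaf_far[OF l2 u(1) uc cu] n f vS u l1 l2 pu cS irrefl by auto
        have V: "{l1, c, l2, p u, u, v} \<subseteq> V" using v S u cS l1 l2 pu by auto
        have "\<not> E v l1" "\<not> E v l2" "\<not> E v (p u)" using uniq[OF l1(1)] uniq[OF l2(1)] uniq[OF pu(1)] cu d by auto
        moreover have "\<not> E l1 l2"
        proof -
          have "l1 \<noteq> c" using d by auto
          then show ?thesis using p_eq[OF l1(1) _ l2(1)] leaf[OF l1] l2(2) irrefl by auto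
        qed
        ultimately have e: "\<not> E v l1" "\<not> E v l2" "\<not> E v (p u)" "\<not> E l1 v" "\<not> E l2 v" "\<not> E (p u) v" "\<not> E l1 l2" "\<not> E l2 l1"
          "E c l1" "E l1 c" "E c l2" "E l2 c" "E u (p u)" "E (p u) u" "E v u" "E u v" "\<not> E v c" "\<not> E c v"
          "\<not> E c u" "\<not> E u c" "\<not> E c (p u)" "\<not> E (p u) c" "\<not> E l1 u" "\<not> E u l1" "\<not> E l1 (p u)" "\<not> E (p u) l1"
          "\<not> E l2 u" "\<not> E u l2" "\<not> E l2 (p u)" "\<not> E (p u) l2"
          using u cu l1 l2 pu nvc f(3) apart(1,2)[OF u(1) uc cu l1(1) leaf_far(1,2)[OF l1 u(1) uc cu]]
            apart(1,2)[OF u(1) uc cu l2(1) leaf_far(1,2)[OF l2 u(1) uc cu]] comm by blast+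
        show False
          by (rule balancedD[OF bal V, of c l1 "p u" u]) (use e irrefl d in \<open>auto simp: co_def\<close>)
      qed
    qed
    have nb: "E v w \<longleftrightarrow> w = u" if w: "w \<in> S" for w
      using uniq[OF w] u c_leaf[OF u(1) _ w] by blast
    show ?thesis using star_matching_add_leaf[OF star_matching_recenter[OF sm u(1) c_leaf] vS(1) nb] by blast
  qed
qed

text \<open>
  Together with two edges of different components, \<open>x\<close> and \<open>x'\<close> would induce the complement of $C_4 + K_2$.
\<close>
lemma star_matching_no_nonadjacent_dominators:
  assumes bal: "balanced E V" and sm: "star_matching E c S" and S: "S \<subseteq> V" and x: "x \<in> V - S" "x' \<in> V - S"
    "x \<noteq> x'" "\<not> E x x'" and dom: "\<And>s. s \<in> S \<Longrightarrow> E x s \<and> E x' s"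
  shows False
proof -
  obtain l where l: "l \<in> S" "E c l" using sm unfolding star_matching_def by blast
  obtain q where q: "q \<in> S" "q \<noteq> c" "\<not> E c q" using sm unfolding star_matching_def by blast
  have cS: "c \<in> S" using sm unfolding star_matching_def by blast
  obtain r where r: "r \<in> S" "r \<noteq> q" "\<And>w. w \<in> S \<Longrightarrow> E q w \<longleftrightarrow> w = r" using star_matching_partner[OF sm q(1,2)] by blast
  have lc: "l \<noteq> c" using l irrefl by blast
  obtain k where k: "\<And>w. w \<in> S \<Longrightarrow> E l w \<longleftrightarrow> w = k" using star_matching_partner[OF sm l(1) lc] by blast
  have kc: "k = c" using k cS l comm by blast
  have rc: "r \<noteq> c" using r(3) cS q(3) comm by blast
  obtain k' where k': "\<And>w. w \<in> S \<Longrightarrow> E r w \<longleftrightarrow> w = k'" using star_matching_partner[OF sm r(1) rc] by blast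
  have k'q: "k' = q" using k' r q comm by blast
  have lq: "l \<noteq> q" "l \<noteq> r" using l q k' k'q cS comm by blast+
  have e: "E c l" "E l c" "E q r" "E r q" "\<not> E c q" "\<not> E q c" "\<not> E c r" "\<not> E r c" "\<not> E l q" "\<not> E q l" "\<not> E l r" "\<not> E r l"
    using l q r k k' kc k'q cS lq rc comm by blast+
  have d: "E x c" "E x l" "E x q" "E x r" "E x' c" "E x' l" "E x' q" "E x' r"
    "E c x" "E l x" "E q x" "E r x" "E c x'" "E l x'" "E q x'" "E r x'" "\<not> E x' x"
    using dom cS l(1) q(1) r(1) x(4) comm by blast+
  have dist: "distinct [x, x', c, l, q, r]" using x S cS l q r lc rc lq by auto
  have V: "{x, x', c, l, q, r} \<subseteq> V" using x S cS l q r by auto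
  show False
    by (rule balancedD[OF bal V, of x c q x']) (use e d x(4) irrefl dist in \<open>auto simp: co_def\<close>)
qed

text \<open>
  Every set of vertices of the cycle other than the empty and the full set can be rotated so that it
  contains \<open>c1\<close> and not \<open>c2\<close>. For each of the eight possible neighbourhoods an unbalanced switch is found on
  five or six of the vertices.
\<close>
lemma five_cycle_no_mixed:
  assumes bal: "balanced E V" and C: "five_cycle E c1 c2 c3 c4 c5" and V: "{v, c1, c2, c3, c4, c5} \<subseteq> V"
    and v: "v \<notin> {c1, c2, c3, c4, c5}" "E v c1" "\<not> E v c2"
  shows False
proof -
  note c = five_cycle_facts[OF C]
  have dist: "distinct [v, c1, c2, c3, c4, c5]" using c(1) v(1) by auto
  have v': "E c1 v" "\<not> E c2 v" "E c3 v \<longleftrightarrow> E v c3" "E c4 v \<longleftrightarrow> E v c4" "E c5 v \<longleftrightarrow> E v c5" "\<not> E v v"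
    using v comm irrefl by blast+
  note * = c(2-) v(2,3) v' co_def
  have V1: "{v, c1, c2, c3, c4} \<subseteq> V" "{v, c1, c5, c4, c3} \<subseteq> V" "{v, c3, c4, c5, c1} \<subseteq> V" "{v, c1, c2, c3, c5} \<subseteq> V" using V by auto
  consider "\<not> E v c3" "\<not> E v c4" "\<not> E v c5" | "E v c3" "\<not> E v c4" "\<not> E v c5"
    | "\<not> E v c3" "E v c4" "\<not> E v c5" | "\<not> E v c3" "\<not> E v c4" "E v c5"
    | "E v c3" "E v c4" "\<not> E v c5" | "E v c3" "\<not> E v c4" "E v c5"
    | "\<not> E v c3" "E v c4" "E v c5" | "E v c3" "E v c4" "E v c5" by blast
  then show False
  proof cases
    case 1
    show ?thesis by (rule balancedD[OF bal V, of c1 v c3 c4]) (use 1 dist in \<open>auto simp: *\<close>)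
  next
    case 2
    show ?thesis by (rule balancedD[OF bal V1(1), of c3 c4 v c1]) (use 2 dist in \<open>auto simp: *\<close>)
  next
    case 3
    show ?thesis by (rule balancedD[OF bal V1(2), of c4 c3 v c1]) (use 3 dist in \<open>auto simp: *\<close>)
  next
    case 4
    show ?thesis by (rule balancedD[OF bal V1(1), of v c1 c3 c4]) (use 4 dist in \<open>auto simp: *\<close>)
  next
    case 5
    show ?thesis by (rule balancedD[OF bal V1(1), of c2 c1 c3 v]) (use 5 dist in \<open>auto simp: *\<close>)
  next
    case 6
    show ?thesis by (rule balancedD[OF bal V1(3), of c4 c3 c5 v]) (use 6 dist in \<open>auto simp: *\<close>)
  next
    case 7
    show ?thesis by (rule balancedD[OF bal V1(4), of c1 v c2 c3]) (use 7 dist in \<open>auto simp: *\<close>)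
  next
    case 8
    show ?thesis by (rule balancedD[OF bal V, of v c3 c1 c2]) (use 8 dist in \<open>auto simp: *\<close>)
  qed
qed

lemma five_cycle_no_nonadjacent_dominators:
  assumes bal: "balanced E V" and C: "five_cycle E c1 c2 c3 c4 c5" and V: "{x, x', c1, c2, c3, c4, c5} \<subseteq> V"
    and x: "x \<notin> {c1, c2, c3, c4, c5}" "x' \<notin> {c1, c2, c3, c4, c5}" "x \<noteq> x'" "\<not> E x x'"
    and dom: "\<And>s. s \<in> {c1, c2, c3, c4, c5} \<Longrightarrow> E x s \<and> E x' s"
  shows False
proof -
  note c = five_cycle_facts[OF C]
  have dist: "distinct [x, x', c1, c2, c3, c4, c5]" using c(1) x by auto
  have d: "E x c1" "E x c3" "E x c2" "E x c4" "E x c5" "E x' c1" "E x' c2" "E x' c3" "E x' c4" "E x' c5" "\<not> E x' x"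
    "E c1 x" "E c2 x" "E c3 x" "E c4 x" "E c5 x" "E c1 x'" "E c2 x'" "E c3 x'" "E c4 x'" "E c5 x'"
    using dom x comm by blast+
  show False
    by (rule balancedD[OF bal V, of x c1 c3 x']) (use c(2-) d x(4) irrefl dist in \<open>auto simp: co_def\<close>)
qed

lemma core_nonempty: "core E S \<Longrightarrow> S \<noteq> {}"
  unfolding core_def star_matching_def by auto

lemma core_grow_mixed:
  assumes bal: "balanced E V" and fin: "finite V" and core: "core E S" and S: "S \<subseteq> V" and v: "v \<in> V - S"
    and mixed: "\<exists>u\<in>S. E v u" "\<exists>u\<in>S. \<not> E v u"
  shows "core E (insert v S)"
proof -
  interpret C: simple_adjacency "co E" by (rule simple_adjacency_co)
  consider c where "star_matching E c S" | c where "star_matching (co E) c S"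
    | a b c d e where "five_cycle E a b c d e" "S = {a, b, c, d, e}"
    using core unfolding core_def by blast
  then show ?thesis
  proof cases
    case 1
    then show ?thesis using star_matching_grow_mixed[OF bal _ S v mixed] unfolding core_def by blast
  next
    case 2
    have "\<exists>u\<in>S. co E v u" "\<exists>u\<in>S. \<not> co E v u" using mixed v unfolding co_def by auto
    then show ?thesis using C.star_matching_grow_mixed[OF balanced_co[OF bal fin] 2 S v] unfolding core_def by blast
  next
    case 3
    note r1 = five_cycle_rotate[OF 3(1)]
    note r2 = five_cycle_rotate[OF r1]
    note r3 = five_cycle_rotate[OF r2]
    note r4 = five_cycle_rotate[OF r3]
    have V: "{v, a, b, c, d, e} \<subseteq> V" "{v, b, c, d, e, a} \<subseteq> V" "{v, c, d, e, a, b} \<subseteq> V"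
      "{v, d, e, a, b, c} \<subseteq> V" "{v, e, a, b, c, d} \<subseteq> V" using S v 3(2) by auto
    have n: "v \<notin> {a, b, c, d, e}" "v \<notin> {b, c, d, e, a}" "v \<notin> {c, d, e, a, b}" "v \<notin> {d, e, a, b, c}" "v \<notin> {e, a, b, c, d}"
      using v 3(2) by auto
    have "E v a \<longrightarrow> E v b" "E v b \<longrightarrow> E v c" "E v c \<longrightarrow> E v d" "E v d \<longrightarrow> E v e" "E v e \<longrightarrow> E v a"
      using five_cycle_no_mixed[OF bal 3(1) V(1) n(1)] five_cycle_no_mixed[OF bal r1 V(2) n(2)]
       five_cycle_no_mixed[OF bal r2 V(3) n(3)] five_cycle_no_mixed[OF bal r3 V(4) n(4)]
       five_cycle_no_mixed[OF bal r4 V(5) n(5)] by blast+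
    then have False using mixed 3(2) by blast
    then show ?thesis ..
  qed
qed

lemma core_grow_dominators:
  assumes bal: "balanced E V" and fin: "finite V" and core: "core E S" and S: "S \<subseteq> V"
    and x: "x \<in> V - S" "x' \<in> V - S" "x \<noteq> x'" "\<not> E x x'" and dom: "\<And>s. s \<in> S \<Longrightarrow> E x s \<and> E x' s"
  shows "core E (S \<union> {x, x'})"
proof -
  interpret C: simple_adjacency "co E" by (rule simple_adjacency_co)
  consider c where "star_matching E c S" | c where "star_matching (co E) c S"
    | a b c d e where "five_cycle E a b c d e" "S = {a, b, c, d, e}"
    using core unfolding core_def by blast
  then show ?thesis
  proof cases
    case 1
    then show ?thesis using star_matching_no_nonadjacent_dominators[OF bal _ S x dom] by blast
  next
    case 2
    have "star_matching (co E) c (S \<union> {x, x'})"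
      by (rule C.star_matching_add_edge[OF 2]) (use x dom in \<open>auto simp: co_def\<close>)
    then show ?thesis unfolding core_def by blast
  next
    case 3
    have "{x, x', a, b, c, d, e} \<subseteq> V" "x \<notin> {a, b, c, d, e}" "x' \<notin> {a, b, c, d, e}" using x S 3(2) by auto
    then show ?thesis using five_cycle_no_nonadjacent_dominators[OF bal 3(1) _ _ _ x(3,4)] dom 3(2) by blast
  qed
qed

text \<open>
  If no outside vertex has both a neighbour and a nonneighbour in \<open>S\<close>, then the outside vertices fall into a
  set \<open>X\<close> complete to \<open>S\<close> and a set \<open>Y\<close> anticomplete to \<open>S\<close>. If \<open>X\<close> were a clique and \<open>Y\<close> independent, then
  \<open>Y \<union> X\<close> would split off. So two vertices of \<open>X\<close> are nonadjacent or two vertices of \<open>Y\<close> are adjacent, and these two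
  cases are complementary.
\<close>
lemma core_grow:
  assumes bal: "balanced E V" and fin: "finite V" and conn: "indecomposable_on E V"
    and core: "core E S" and S: "S \<subset> V"
  shows "\<exists>S'. S \<subset> S' \<and> S' \<subseteq> V \<and> core E S'"
proof (rule ccontr)
  interpret C: simple_adjacency "co E" by (rule simple_adjacency_co)
  assume no: "\<not> ?thesis"
  have S': "S \<subseteq> V" using S by blast
  have maximal: False if "core E S'" "S \<subset> S'" "S' \<subseteq> V" for S' using no that by blast
  obtain s0 where s0: "s0 \<in> S" using core_nonempty[OF core] by blast
  define X where "X = {v \<in> V - S. \<forall>s\<in>S. E v s}"
  define Y where "Y = {v \<in> V - S. \<forall>s\<in>S. \<not> E v s}"
  have pure: "v \<in> X \<or> v \<in> Y" if v: "v \<in> V - S" for v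
  proof (rule ccontr)
    assume "\<not> ?thesis"
    then have "core E (insert v S)"
      using core_grow_mixed[OF bal fin core S' v] v unfolding X_def Y_def by blast
    then show False by (rule maximal) (use v S' in auto)
  qed
  have clique: "E x x'" if "x \<in> X" "x' \<in> X" "x \<noteq> x'" for x x'
  proof (rule ccontr)
    assume "\<not> ?thesis"
    then have "core E (S \<union> {x, x'})"
      using that unfolding X_def by (intro core_grow_dominators[OF bal fin core S']) auto
    then show False by (rule maximal) (use that S' X_def in auto)
  qed
  have indep: "\<not> E y y'" if "y \<in> Y" "y' \<in> Y" for y y'
  proof
    assume e: "E y y'"
    then have "y \<noteq> y'" using irrefl by blast
    then have "core (co E) (S \<union> {y, y'})"
      using that e unfolding Y_def
      by (intro C.core_grow_dominators[OF balanced_co[OF bal fin] fin core_coI[OF core] S']) (auto simp: co_def)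
    then have "core E (S \<union> {y, y'})" using C.core_coI co_co by metis
    then show False by (rule maximal) (use that S' Y_def in auto)
  qed
  have sub: "Y \<subseteq> V" "X \<subseteq> V" "Y \<inter> X = {}" using s0 unfolding X_def Y_def by blast+
  have rest: "(\<forall>b\<in>X. E b c) \<and> (\<forall>a\<in>Y. \<not> E a c)" if "c \<in> V - Y - X" for c
  proof -
    have "c \<in> S" using pure that by blast
    then show ?thesis unfolding X_def Y_def by blast
  qed
  have "splits_off E V Y X"
    unfolding splits_off_def using sub rest clique indep by simp
  moreover have "Y \<union> X \<noteq> {}" using pure S by blast
  moreover have "Y \<union> X \<noteq> V" using s0 S' unfolding X_def Y_def by blast
  ultimately show False using conn unfolding indecomposable_on_def by blast
qed

lemma core_extends_to_all:
  assumes bal: "balanced E V" and fin: "finite V" and conn: "indecomposable_on E V"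
    and core: "core E S" and S: "S \<subseteq> V"
  shows "core E V"
  using core S
proof (induction "card (V - S)" arbitrary: S rule: less_induct)
  case less
  show ?case
  proof (cases "S = V")
    case False
    then obtain S' where S': "S \<subset> S'" "S' \<subseteq> V" "core E S'" using core_grow[OF bal fin conn less(2)] less(3) by blast
    have "card (V - S') < card (V - S)" using S' fin by (intro psubset_card_mono) auto
    then show ?thesis using less(1) S' by blast
  qed (use less in simp)
qed

lemma two_edges_core:
  assumes "E a b" "E c d" "\<not> E a c" "\<not> E a d" "\<not> E b c" "\<not> E b d" "a \<noteq> c"
  shows "core E {a, b, c, d}"
proof -
  have "star_matching E a {a, b, c, d}"
    using assms irrefl comm unfolding star_matching_def by auto
  then show ?thesis unfolding core_def by blast
qed

lemma four_cycle_core: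
  assumes "E a b" "E b c" "E c d" "E d a" "\<not> E a c" "\<not> E b d" "a \<noteq> c" "b \<noteq> d"
  shows "core E {a, b, c, d}"
proof -
  interpret C: simple_adjacency "co E" by (rule simple_adjacency_co)
  have "core (co E) {a, c, b, d}"
    using assms comm irrefl by (intro C.two_edges_core) (auto simp: co_def)
  then show ?thesis using C.core_coI co_co by (metis insert_commute)
qed

text \<open>
  This is the theorem of Foldes and Hammer that a graph without induced $2K_2$, $C_4$ and $C_5$ is split. Take
  a maximum clique \<open>K\<close> with the largest possible degree sum, and an edge \<open>uv\<close> outside it. Unless $2K_2$ or $C_4$ is
  visible at once, \<open>u\<close> misses a single vertex \<open>k\<close> of \<open>K\<close>, and \<open>v\<close> misses \<open>k\<close> and another vertex \<open>k'\<close>. As replacing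
  \<open>k\<close> by \<open>u\<close> does not increase the degree sum, \<open>k\<close> has a neighbour \<open>w\<close> that \<open>u\<close> lacks. Then \<open>u\<close>, \<open>v\<close>, \<open>w\<close>, \<open>k\<close>, \<open>k'\<close>
  contain one of the three graphs.
\<close>
lemma nonsplit_contains_core:
  assumes fin: "finite V"
    and nonsplit: "\<And>B. B \<subseteq> V \<Longrightarrow> \<forall>b\<in>B. \<forall>b'\<in>B. b \<noteq> b' \<longrightarrow> E b b' \<Longrightarrow> \<exists>u\<in>V - B. \<exists>v\<in>V - B. E u v"
  shows "\<exists>S\<subseteq>V. core E S"
proof -
  define Q where "Q B \<longleftrightarrow> B \<subseteq> V \<and> (\<forall>b\<in>B. \<forall>b'\<in>B. b \<noteq> b' \<longrightarrow> E b b')" for B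
  have "Q {}" unfolding Q_def by blast
  moreover have "\<forall>B. Q B \<longrightarrow> card B < Suc (card V)" using fin unfolding Q_def by (simp add: card_mono less_Suc_eq_le)
  ultimately have "\<exists>B. Q B \<and> (\<forall>B'. Q B' \<longrightarrow> card B' \<le> card B)" by (rule ex_has_greatest_nat)
  then obtain B0 where B0: "Q B0" "\<And>B'. Q B' \<Longrightarrow> card B' \<le> card B0" by blast
  define Q' where "Q' B \<longleftrightarrow> Q B \<and> card B = card B0" for B
  \<comment> \<open>Among the cliques of maximum size one with the largest degree sum is chosen.\<close>
  define D where "D B = (\<Sum>b\<in>B. deg E V b)" for B
  have "Q' B0" using B0(1) unfolding Q'_def by blast
  moreover have "\<forall>B. Q' B \<longrightarrow> D B < Suc (D V)"
    using fin unfolding Q'_def Q_def D_def by (auto simp: less_Suc_eq_le intro: sum_mono2)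
  ultimately have "\<exists>B. Q' B \<and> (\<forall>B'. Q' B' \<longrightarrow> D B' \<le> D B)" by (rule ex_has_greatest_nat)
  then obtain K where K: "Q' K" "\<And>B'. Q' B' \<Longrightarrow> D B' \<le> D K" by blast
  have QK: "Q K" and KV: "K \<subseteq> V" and cl: "\<And>b b'. b \<in> K \<Longrightarrow> b' \<in> K \<Longrightarrow> b \<noteq> b' \<Longrightarrow> E b b'"
    and max: "\<And>B'. Q B' \<Longrightarrow> card B' \<le> card K" and finK: "finite K"
    using K(1) B0(2) fin finite_subset unfolding Q'_def Q_def by auto
  define nn where "nn x = {k \<in> K. \<not> E x k}" for x
  have nn_ne: "nn x \<noteq> {}" if "x \<in> V - K" for x
  proof
    assume "nn x = {}"
    then have "\<And>k. k \<in> K \<Longrightarrow> E x k \<and> E k x" using comm unfolding nn_def by blast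
    then have "Q (insert x K)" using QK that unfolding Q_def by blast
    then show False using max[of "insert x K"] that finK by simp
  qed
  have nested: ?thesis if uv: "u \<in> V - K" "v \<in> V - K" "E u v" and sub: "nn u \<subseteq> nn v" for u v
  proof (cases "\<exists>k k'. k \<in> nn u \<and> k' \<in> nn u \<and> k \<noteq> k'")
    case True
    then obtain k k' where k: "k \<in> nn u" "k' \<in> nn u" "k \<noteq> k'" by blast
    then have "core E {u, v, k, k'}"
      using uv sub cl[of k k'] unfolding nn_def by (intro two_edges_core) auto
    moreover have "{u, v, k, k'} \<subseteq> V" using uv k KV unfolding nn_def by auto
    ultimately show ?thesis by blast
  next
    case False
    then obtain k where k: "nn u = {k}" using nn_ne[OF uv(1)] by blast
    have kK: "k \<in> K" and uk: "\<not> E u k" and vk: "\<not> E v k" using k sub unfolding nn_def by blast+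
    have u_adj: "E u b" if "b \<in> K" "b \<noteq> k" for b using k that unfolding nn_def by blast
    have "nn v \<noteq> {k}"
    proof
      assume nv: "nn v = {k}"
      have v_adj: "E v b" if "b \<in> K" "b \<noteq> k" for b using nv that unfolding nn_def by blast
      have "Q (insert u (insert v (K - {k})))"
        using QK uv u_adj v_adj comm unfolding Q_def by (auto; metis)
      moreover have "card (insert u (insert v (K - {k}))) = Suc (card K)"
        using uv kK finK irrefl card_Suc_Diff1[OF finK kK] by (auto simp: card_insert_if)
      ultimately show False using max by fastforce
    qed
    then obtain k' where k': "k' \<in> K" "\<not> E v k'" "k' \<noteq> k" using sub k unfolding nn_def by blast
    have "Q (insert u (K - {k}))" using QK uv u_adj comm unfolding Q_def by (auto; metis)
    moreover have c: "card (insert u (K - {k})) = card K"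
      using uv kK finK card_Suc_Diff1[OF finK kK] by (auto simp: card_insert_if)
    ultimately have "D (insert u (K - {k})) \<le> D K" using K unfolding Q'_def by simp
    moreover have "D (insert u (K - {k})) = deg E V u + D (K - {k})" unfolding D_def using finK uv by simp
    moreover have "D K = deg E V k + D (K - {k})" unfolding D_def using finK kK by (simp add: sum.remove)
    ultimately have dle: "deg E V u \<le> deg E V k" by linarith
    have "\<not> {w\<in>V. E k w} \<subset> {w\<in>V. E u w}"
      using psubset_card_mono[of "{w\<in>V. E u w}" "{w\<in>V. E k w}"] fin dle unfolding deg_def by auto
    moreover have "v \<in> {w\<in>V. E u w}" "v \<notin> {w\<in>V. E k w}" using uv vk comm by blast+
    ultimately obtain w where w: "w \<in> V" "E k w" "\<not> E u w" by blast
    have "w \<notin> K" using w u_adj irrefl by metis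
    have k'_e: "E u k'" "E k k'" "E k' k" "E k' u" using u_adj[OF k'(1,3)] cl kK k' comm by blast+
    have ne: "w \<noteq> u" "w \<noteq> v" "w \<noteq> k" "w \<noteq> k'" "u \<noteq> v" "u \<noteq> k" "u \<noteq> k'" "v \<noteq> k" "v \<noteq> k'"
      using w uk vk uv kK k' \<open>w \<notin> K\<close> comm irrefl by auto
    have inV: "{u, v, k, w} \<subseteq> V" "{u, v, w, k'} \<subseteq> V" "{u, v, w, k, k'} \<subseteq> V" using uv w kK k' KV by auto
    consider "\<not> E v w" | "E v w" "E k' w" | "E v w" "\<not> E k' w" by blast
    then show ?thesis
    proof cases
      case 1
      then have "core E {u, v, k, w}" using uv uk vk w by (intro two_edges_core) (use ne in auto)
      then show ?thesis using inV by blast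
    next
      case 2
      then have "core E {u, v, w, k'}" using uv k'(2) k'_e w comm by (intro four_cycle_core) (use ne in blast)+
      then show ?thesis using inV by blast
    next
      case 3
      have "five_cycle E u v w k k'"
        using 3 uv uk vk k' k'_e w ne comm unfolding five_cycle_def by auto
      then have "core E {u, v, w, k, k'}" unfolding core_def by blast
      then show ?thesis using inV by blast
    qed
  qed
  obtain u v where uv: "u \<in> V - K" "v \<in> V - K" "E u v" using nonsplit[of K] QK unfolding Q_def by blast
  show ?thesis
  proof (cases "nn u \<subseteq> nn v \<or> nn v \<subseteq> nn u")
    case True
    then show ?thesis using nested uv comm by blast
  next
    case False
    then obtain k1 k2 where k: "k1 \<in> K" "\<not> E u k1" "E v k1" "k2 \<in> K" "\<not> E v k2" "E u k2"
      unfolding nn_def by blast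
    then have "k1 \<noteq> k2" by blast
    then have "core E {u, v, k1, k2}"
      using k uv cl[OF k(1,4)] comm by (intro four_cycle_core) auto
    moreover have "{u, v, k1, k2} \<subseteq> V" using uv k KV by blast
    ultimately show ?thesis by blast
  qed
qed

end

section \<open>The bipartite graph of an indecomposable split graph\<close>

text \<open>
  Two bipartite graphs with three vertices on each side satisfy this: $P_4 + K_2$, and $2P_3$ with the two centres on
  different sides. They have the same degrees, and exchanging \<open>a1 b1\<close>, \<open>a3 b3\<close> with \<open>a1 b3\<close>, \<open>a3 b1\<close> turns one into the
  other.
\<close>
definition unstable :: "('a \<Rightarrow> 'b \<Rightarrow> bool) \<Rightarrow> 'a \<Rightarrow> 'a \<Rightarrow> 'a \<Rightarrow> 'b \<Rightarrow> 'b \<Rightarrow> 'b \<Rightarrow> bool" where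
  "unstable R a1 a2 a3 b1 b2 b3 \<longleftrightarrow> R a1 b2 \<and> R a2 b1 \<and> \<not> R a2 b2 \<and> \<not> R a2 b3 \<and> \<not> R a3 b2 \<and>
     (R a1 b1 \<longleftrightarrow> \<not> R a1 b3) \<and> (R a3 b3 \<longleftrightarrow> R a1 b1) \<and> (R a3 b1 \<longleftrightarrow> R a1 b3)"

definition stable_between :: "('a \<Rightarrow> 'b \<Rightarrow> bool) \<Rightarrow> 'a set \<Rightarrow> 'b set \<Rightarrow> bool" where
  "stable_between R A B \<longleftrightarrow> (\<forall>a1\<in>A. \<forall>a2\<in>A. \<forall>a3\<in>A. \<forall>b1\<in>B. \<forall>b2\<in>B. \<forall>b3\<in>B.
     distinct [a1, a2, a3] \<longrightarrow> distinct [b1, b2, b3] \<longrightarrow>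
     \<not> unstable R a1 a2 a3 b1 b2 b3 \<and> \<not> unstable (\<lambda>a b. \<not> R a b) a1 a2 a3 b1 b2 b3)"

lemma stable_betweenD:
  assumes "stable_between R A B" "distinct [a1, a2, a3]" "distinct [b1, b2, b3]"
    "{a1, a2, a3} \<subseteq> A" "{b1, b2, b3} \<subseteq> B"
  shows "\<not> unstable R a1 a2 a3 b1 b2 b3" "\<not> unstable (\<lambda>a b. \<not> R a b) a1 a2 a3 b1 b2 b3"
  using assms unfolding stable_between_def by auto

lemma stable_between_subset: "stable_between R A B \<Longrightarrow> A' \<subseteq> A \<Longrightarrow> B' \<subseteq> B \<Longrightarrow> stable_between R A' B'"
  unfolding stable_between_def by blast

lemma stable_between_complement: "stable_between R A B \<Longrightarrow> stable_between (\<lambda>a b. \<not> R a b) A B"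
  unfolding stable_between_def by simp

lemma stable_between_converse: "stable_between R A B \<Longrightarrow> stable_between (\<lambda>b a. R a b) B A"
proof -
  have "unstable (\<lambda>b a. R a b) b1 b2 b3 a1 a2 a3 \<Longrightarrow> unstable R a1 a2 a3 b1 b2 b3"
    for R :: "'a \<Rightarrow> 'b \<Rightarrow> bool" and a1 a2 a3 b1 b2 b3
    unfolding unstable_def by blast
  then show "stable_between R A B \<Longrightarrow> stable_between (\<lambda>b a. R a b) B A"
    unfolding stable_between_def by meson
qed

text \<open>
  Orient a pair \<open>a\<close>, \<open>b\<close> from \<open>a\<close> to \<open>b\<close> if \<open>R a b\<close>, and from \<open>b\<close> to \<open>a\<close> otherwise. The condition says that no proper
  nonempty part \<open>A1 \<union> B1\<close> absorbs all arcs between it and the rest, that is, the bipartite tournament is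
  strongly connected. Complementing \<open>R\<close> reverses all arcs.
\<close>
definition bipartite_strong :: "('a \<Rightarrow> 'b \<Rightarrow> bool) \<Rightarrow> 'a set \<Rightarrow> 'b set \<Rightarrow> bool" where
  "bipartite_strong R A B \<longleftrightarrow> (\<forall>A1 B1. A1 \<subseteq> A \<longrightarrow> B1 \<subseteq> B \<longrightarrow> (A1, B1) \<noteq> ({}, {}) \<longrightarrow> (A1, B1) \<noteq> (A, B) \<longrightarrow>
     \<not> ((\<forall>a\<in>A - A1. \<forall>b\<in>B1. R a b) \<and> (\<forall>a\<in>A1. \<forall>b\<in>B - B1. \<not> R a b)))"

lemma bipartite_strongD:
  assumes "bipartite_strong R A B" "A1 \<subseteq> A" "B1 \<subseteq> B" "(A1, B1) \<noteq> ({}, {})" "(A1, B1) \<noteq> (A, B)"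
    "\<forall>a\<in>A - A1. \<forall>b\<in>B1. R a b" "\<forall>a\<in>A1. \<forall>b\<in>B - B1. \<not> R a b"
  shows False
  using assms unfolding bipartite_strong_def by metis

lemma bipartite_strong_complement:
  assumes "bipartite_strong R A B" shows "bipartite_strong (\<lambda>a b. \<not> R a b) A B"
  unfolding bipartite_strong_def
proof (intro allI impI notI, elim conjE)
  fix A1 B1
  assume s: "A1 \<subseteq> A" "B1 \<subseteq> B" "(A1, B1) \<noteq> ({}, {})" "(A1, B1) \<noteq> (A, B)"
    and h: "\<forall>a\<in>A - A1. \<forall>b\<in>B1. \<not> R a b" "\<forall>a\<in>A1. \<forall>b\<in>B - B1. \<not> \<not> R a b"
  have d: "A - (A - A1) = A1" "B - (B - B1) = B1" using s by auto
  have "(A - A1, B - B1) \<noteq> ({}, {})" "(A - A1, B - B1) \<noteq> (A, B)" using s by auto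
  then have "\<not> ((\<forall>a\<in>A1. \<forall>b\<in>B - B1. R a b) \<and> (\<forall>a\<in>A - A1. \<forall>b\<in>B1. \<not> R a b))"
    using assms[unfolded bipartite_strong_def, rule_format, of "A - A1" "B - B1"] d by auto
  then show False using h by auto
qed

lemma bipartite_strong_converse:
  assumes "bipartite_strong R A B" shows "bipartite_strong (\<lambda>b a. R a b) B A"
  unfolding bipartite_strong_def
proof (intro allI impI notI, elim conjE)
  fix B1 A1
  assume "B1 \<subseteq> B" "A1 \<subseteq> A" "(B1, A1) \<noteq> ({}, {})" "(B1, A1) \<noteq> (B, A)"
    and "\<forall>b\<in>B - B1. \<forall>a\<in>A1. R a b" "\<forall>b\<in>B1. \<forall>a\<in>A - A1. \<not> R a b"
  then show False
    using bipartite_strong_complement[OF assms, unfolded bipartite_strong_def, rule_format, of A1 B1] by auto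
qed

text \<open>
  A disjoint union of at least two stars, where \<open>A\<close> consists of the centres and \<open>B\<close> of the leaves.
\<close>
definition star_forest :: "('a \<Rightarrow> 'b \<Rightarrow> bool) \<Rightarrow> 'a set \<Rightarrow> 'b set \<Rightarrow> bool" where
  "star_forest R A B \<longleftrightarrow> (\<forall>b\<in>B. \<exists>!a. a \<in> A \<and> R a b) \<and> (\<forall>a\<in>A. \<exists>b\<in>B. R a b) \<and> (\<exists>a\<in>A. \<exists>a'\<in>A. a \<noteq> a')"

text \<open>
  Both bipartite complementation and exchanging the sides preserve stability and strong connectedness, so
  the four variants of a star forest have to be treated alike.
\<close>
definition star_like :: "('a \<Rightarrow> 'b \<Rightarrow> bool) \<Rightarrow> 'a set \<Rightarrow> 'b set \<Rightarrow> bool" where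
  "star_like R A B \<longleftrightarrow> star_forest R A B \<or> star_forest (\<lambda>a b. \<not> R a b) A B \<or>
     star_forest (\<lambda>b a. R a b) B A \<or> star_forest (\<lambda>b a. \<not> R a b) B A"

lemma star_like_complement: "star_like (\<lambda>a b. \<not> R a b) A B \<longleftrightarrow> star_like R A B"
  unfolding star_like_def by auto

lemma star_like_converse: "star_like (\<lambda>b a. R a b) B A \<longleftrightarrow> star_like R A B"
  unfolding star_like_def by auto

lemma star_forest_center_map:
  assumes "star_forest R A B"
  shows "\<exists>f. (\<forall>b\<in>B. f b \<in> A) \<and> (\<forall>b\<in>B. \<forall>a\<in>A. R a b \<longleftrightarrow> a = f b) \<and> (\<forall>a\<in>A. \<exists>b\<in>B. f b = a)"
proof -
  define f where "f b = (THE a. a \<in> A \<and> R a b)" for b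
  have u: "\<exists>!a. a \<in> A \<and> R a b" if "b \<in> B" for b using assms that unfolding star_forest_def by blast
  have f: "f b \<in> A \<and> R (f b) b" if "b \<in> B" for b using theI'[OF u[OF that]] unfolding f_def .
  have g: "R a b \<longleftrightarrow> a = f b" if "b \<in> B" "a \<in> A" for a b using f u that by blast
  have "\<exists>b\<in>B. f b = a" if a: "a \<in> A" for a
  proof -
    obtain b where "b \<in> B" "R a b" using assms a unfolding star_forest_def by blast
    then show ?thesis using g a by blast
  qed
  then show ?thesis using f g by blast
qed

text \<open>
  Stability forces every star that has a leaf joined to \<open>v\<close>, and every star that has a leaf not joined to
  \<open>v\<close>, to be a single edge, and it allows \<open>v\<close> only one neighbour. So the edges form a matching to which \<open>v\<close>
  is attached, and this is a star forest with its centres on the other side.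
\<close>
lemma star_forest_add_mixed_center:
  assumes sf: "star_forest R A B" and st: "stable_between R (insert v A) B" and v: "v \<notin> A"
    and p: "p \<in> B" "R v p" and q: "q \<in> B" "\<not> R v q"
  shows "star_forest (\<lambda>b a. R a b) B (insert v A)"
proof -
  obtain f where f: "\<And>b. b \<in> B \<Longrightarrow> f b \<in> A" "\<And>b a. b \<in> B \<Longrightarrow> a \<in> A \<Longrightarrow> R a b \<longleftrightarrow> a = f b"
    "\<And>a. a \<in> A \<Longrightarrow> \<exists>b\<in>B. f b = a"
    using star_forest_center_map[OF sf] by blast
  have fv: "f b \<noteq> v" if "b \<in> B" for b using f(1) v that by metis
  have u1: False if "distinct [a1, a2, a3]" "distinct [b1, b2, b3]" "{a1, a2, a3} \<subseteq> insert v A"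
    "{b1, b2, b3} \<subseteq> B" "unstable R a1 a2 a3 b1 b2 b3" for a1 a2 a3 b1 b2 b3
    using stable_betweenD(1)[OF st] that by blast
  have u2: False if "distinct [a1, a2, a3]" "distinct [b1, b2, b3]" "{a1, a2, a3} \<subseteq> insert v A"
    "{b1, b2, b3} \<subseteq> B" "unstable (\<lambda>a b. \<not> R a b) a1 a2 a3 b1 b2 b3" for a1 a2 a3 b1 b2 b3
    using stable_betweenD(2)[OF st] that by blast
  note [simp] = unstable_def f(1,2)
  \<comment> \<open>A second leaf of the star of \<open>b\<close> completes $P_4 + K_2$ if it is not joined to \<open>v\<close>, and $C_4 + K_2$ if it is.\<close>
  have P_single: "c = b"
    if "b \<in> B" "R v b" "d \<in> B" "\<not> R v d" "f b \<noteq> f d" "c \<in> B" "f c = f b" for b c d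
  proof (rule ccontr)
    assume n: "c \<noteq> b"
    have "R v c"
    proof (rule ccontr)
      assume "\<not> R v c"
      then show False
        by (intro u1[of "f b" v "f d" b c d]) (use that n fv in auto)
    qed
    then show False
      by (intro u2[of "f d" "f b" v d b c]) (use that n fv in auto)
  qed
  \<comment> \<open>A second leaf of the star of \<open>d\<close> completes $P_6$ if it is joined to \<open>v\<close>, and $2P_3$ if it is not.\<close>
  have Q_single: "c = d"
    if "b \<in> B" "R v b" "d \<in> B" "\<not> R v d" "f b \<noteq> f d" "c \<in> B" "f c = f d" for b c d
  proof (rule ccontr)
    assume n: "c \<noteq> d"
    have "\<not> R v c"
    proof
      assume "R v c"
      then show False
        by (intro u2[of "f b" v "f d" d c b]) (use that n fv in auto)
    qed
    then show False
      by (intro u1[of "f d" v "f b" b d c]) (use that n fv in auto)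
  qed
  obtain b d where bd: "b \<in> B" "R v b" "d \<in> B" "\<not> R v d" "f b \<noteq> f d"
  proof (cases "f p = f q")
    case True
    obtain a where "a \<in> A" "a \<noteq> f p" using sf f(1)[OF p(1)] unfolding star_forest_def by metis
    then obtain e where "e \<in> B" "f e \<noteq> f p" using f(3) by metis
    then show thesis using that[of e q] that[of p e] p q True by metis
  qed (use that p q in blast)
  have P: "R v c \<longleftrightarrow> c = b" if c: "c \<in> B" for c
  proof (rule ccontr)
    assume "\<not> ?thesis"
    then have n: "R v c" "c \<noteq> b" using bd by auto
    then have "f c \<noteq> f b" "f c \<noteq> f d" using P_single[OF bd c] Q_single[OF bd c] bd(4) by auto
    then show False
      by (intro u1[of v "f b" "f d" b c d]) (use bd c n fv in auto)
  qed
  have inj: "c = c'" if "c \<in> B" "c' \<in> B" "f c = f c'" for c c'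
  proof (cases "f c = f b")
    case True
    then show ?thesis using P_single[OF bd] that by metis
  next
    case False
    then have "\<not> R v c" using P[OF that(1)] by auto
    then show ?thesis using Q_single[OF bd(1,2) that(1)] False that by metis
  qed
  have "\<exists>!b. b \<in> B \<and> R a b" if "a \<in> insert v A" for a
  proof (cases "a = v")
    case True
    then show ?thesis using P bd(1) by auto
  next
    case False
    then have a: "a \<in> A" using that by auto
    then obtain b where "b \<in> B" "f b = a" using f(3) by auto
    then show ?thesis using a inj by auto
  qed
  moreover have "\<exists>a\<in>insert v A. R a b" if "b \<in> B" for b using f that by auto
  moreover have "b \<noteq> d" using bd by auto
  ultimately show ?thesis unfolding star_forest_def using bd(1,3) by blast
qed

text \<open>
  If the new vertex had two neighbours, it would join two stars to a path, and an edge of a star that it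
  misses would complete $P_4 + K_2$.
\<close>
lemma star_forest_add_mixed_leaf:
  assumes sf: "star_forest R A B" and st: "stable_between R A (insert v B)" and v: "v \<notin> B"
    and p: "p \<in> A" "R p v" and q: "q \<in> A" "\<not> R q v"
  shows "star_forest R A (insert v B)"
proof -
  obtain f where f: "\<And>b. b \<in> B \<Longrightarrow> f b \<in> A" "\<And>b a. b \<in> B \<Longrightarrow> a \<in> A \<Longrightarrow> R a b \<longleftrightarrow> a = f b"
    "\<And>a. a \<in> A \<Longrightarrow> \<exists>b\<in>B. f b = a"
    using star_forest_center_map[OF sf] by blast
  have "a = p" if a: "a \<in> A" "R a v" for a
  proof (rule ccontr)
    assume n: "a \<noteq> p"
    obtain x y where x: "x \<in> B" "f x = p" and y: "y \<in> B" "f y = q" using f(3) p q by metis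
    have "unstable R p a q v x y" using x y f(2) p q a n unfolding unstable_def by auto
    moreover have "distinct [p, a, q]" "distinct [v, x, y]" using x y f(2) p q a n v by auto
    ultimately show False using stable_betweenD(1)[OF st] x y p q a by auto
  qed
  then have "\<exists>!a. a \<in> A \<and> R a v" using p by auto
  then show ?thesis using sf unfolding star_forest_def by auto
qed

lemma star_forest_add_edge:
  assumes "star_forest R A B" "v \<notin> A" "u \<notin> B" "R v u" "\<And>b. b \<in> B \<Longrightarrow> \<not> R v b" "\<And>a. a \<in> A \<Longrightarrow> \<not> R a u"
  shows "star_forest R (insert v A) (insert u B)"
  unfolding star_forest_def
proof (intro conjI ballI)
  fix b assume b: "b \<in> insert u B"
  show "\<exists>!a. a \<in> insert v A \<and> R a b"
  proof (cases "b = u")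
    case True
    then show ?thesis using assms by blast
  next
    case False
    then have "b \<in> B" using b by auto
    then have "\<exists>!a. a \<in> A \<and> R a b" "\<not> R v b" using assms unfolding star_forest_def by auto
    then show ?thesis by blast
  qed
qed (use assms in \<open>unfold star_forest_def; blast\<close>)+

text \<open>
  With three stars, \<open>u\<close>, \<open>v\<close>, two centres and two leaves would form $P_6$, the bipartite complement of $P_4 + K_2$. With
  exactly two stars each leaf has a single nonneighbour among the centres, so that the bipartite complement is a star forest
  as well, to which the pair \<open>v\<close>, \<open>u\<close> is added.
\<close>
lemma star_forest_add_nonedge:
  assumes sf: "star_forest R A B" and st: "stable_between R (insert v A) (insert u B)"
    and new: "v \<notin> A" "u \<notin> B"
    and R: "\<not> R v u" "\<And>b. b \<in> B \<Longrightarrow> R v b" "\<And>a. a \<in> A \<Longrightarrow> R a u"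
  shows "star_forest (\<lambda>a b. \<not> R a b) (insert v A) (insert u B)"
proof -
  obtain f where f: "\<And>b. b \<in> B \<Longrightarrow> f b \<in> A" "\<And>b a. b \<in> B \<Longrightarrow> a \<in> A \<Longrightarrow> R a b \<longleftrightarrow> a = f b"
    "\<And>a. a \<in> A \<Longrightarrow> \<exists>b\<in>B. f b = a"
    using star_forest_center_map[OF sf] by blast
  have two: False if a: "a1 \<in> A" "a2 \<in> A" "a3 \<in> A" and d: "distinct [a1, a2, a3]" for a1 a2 a3
  proof -
    obtain b1 where b1: "b1 \<in> B" "f b1 = a1" using f(3) a by blast
    obtain b3 where b3: "b3 \<in> B" "f b3 = a3" using f(3) a by blast
    have "unstable (\<lambda>a b. \<not> R a b) a2 a1 v b3 b1 u"
      using b1 b3 a d f(2) R unfolding unstable_def by auto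
    moreover have "distinct [a2, a1, v]" "distinct [b3, b1, u]" using a d b1 b3 new by auto
    ultimately show False using stable_betweenD(2)[OF st] a b1 b3 by auto
  qed
  obtain a1 a2 where a: "a1 \<in> A" "a2 \<in> A" "a1 \<noteq> a2" using sf unfolding star_forest_def by blast
  have A: "A = {a1, a2}"
  proof
    show "A \<subseteq> {a1, a2}"
    proof
      fix x assume "x \<in> A"
      then show "x \<in> {a1, a2}" using two[of a1 a2 x] a by auto
    qed
  qed (use a in auto)
  obtain b1 where b1: "b1 \<in> B" "f b1 = a1" using f(3) a by blast
  obtain b2 where b2: "b2 \<in> B" "f b2 = a2" using f(3) a by blast
  have "\<exists>!a. a \<in> insert v A \<and> \<not> R a b" if "b \<in> insert u B" for b
  proof (cases "b = u")
    case True
    then show ?thesis using R by blast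
  next
    case False
    then have b: "b \<in> B" using that by auto
    show ?thesis
    proof (cases "f b = a1")
      case True
      then show ?thesis using b R f(2) a unfolding A by (intro ex1I[of _ a2]) auto
    next
      case False
      then have "f b = a2" using f(1)[of b] b A by auto
      then show ?thesis using b R f(2) a unfolding A by (intro ex1I[of _ a1]) auto
    qed
  qed
  moreover have "\<not> R a1 b2" "\<not> R a2 b1" using f(2) a b1 b2 by auto
  ultimately show ?thesis
    unfolding star_forest_def using R(1) a b1(1) b2(1) A by blast
qed

text \<open>
  In the tournament, a vertex with arcs from and to the given part can be added on its own. If there is no such
  vertex, the remaining vertices either send all their arcs to the part or receive all arcs from it; by
  strong connectedness some arc leads from a vertex of the second kind to one of the first, and both are added.
\<close>
lemma star_forest_grow:
  assumes sf: "star_forest R A' B'" and sub: "A' \<subseteq> A" "B' \<subseteq> B" and ne: "(A', B') \<noteq> (A, B)"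
    and st: "stable_between R A B" and strong: "bipartite_strong R A B"
  shows "\<exists>A'' B''. A' \<subseteq> A'' \<and> A'' \<subseteq> A \<and> B' \<subseteq> B'' \<and> B'' \<subseteq> B \<and> (A', B') \<noteq> (A'', B'') \<and> star_like R A'' B''"
proof -
  have ext: ?thesis if "v \<in> A - A' \<or> u \<in> B - B'" "v \<in> A" "u \<in> B" "star_like R (insert v A') (insert u B')" for v u
    using that sub by (intro exI[of _ "insert v A'"] exI[of _ "insert u B'"]) auto
  have stab: "stable_between R (insert v A') (insert u B')" if "v \<in> A" "u \<in> B" for v u
    using stable_between_subset[OF st] that sub by auto
  obtain a0 b0 where ab: "a0 \<in> A'" "b0 \<in> B'" using sf unfolding star_forest_def by blast
  then have insA: "insert a0 A' = A'" and insB: "insert b0 B' = B'" by auto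
  consider
    (center) v where "v \<in> A - A'" "\<exists>b\<in>B'. R v b" "\<exists>b\<in>B'. \<not> R v b" |
    (leaf) u where "u \<in> B - B'" "\<exists>a\<in>A'. R a u" "\<exists>a\<in>A'. \<not> R a u" |
    (pure) "\<And>v. v \<in> A - A' \<Longrightarrow> (\<forall>b\<in>B'. R v b) \<or> (\<forall>b\<in>B'. \<not> R v b)"
      "\<And>u. u \<in> B - B' \<Longrightarrow> (\<forall>a\<in>A'. R a u) \<or> (\<forall>a\<in>A'. \<not> R a u)"
    by blast
  then show ?thesis
  proof cases
    case center
    then have "star_forest (\<lambda>b a. R a b) B' (insert v A')"
      using star_forest_add_mixed_center[OF sf] stab[of v b0] insB ab sub by auto
    then have "star_like R (insert v A') (insert b0 B')" using insB unfolding star_like_def by simp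
    then show ?thesis using ext[of v b0] center(1) ab sub by blast
  next
    case leaf
    then have "star_forest R A' (insert u B')"
      using star_forest_add_mixed_leaf[OF sf] stab[of a0 u] insA ab sub by auto
    then have "star_like R (insert a0 A') (insert u B')" using insA unfolding star_like_def by simp
    then show ?thesis using ext[of a0 u] leaf(1) ab sub by blast
  next
    case pure
    \<comment> \<open>The parts \<open>YA\<close>, \<open>YB\<close> receive all arcs from \<open>A' \<union> B'\<close>; the other outside vertices send all their arcs there.\<close>
    define YA where "YA = {v \<in> A - A'. \<forall>b\<in>B'. \<not> R v b}"
    define YB where "YB = {u \<in> B - B'. \<forall>a\<in>A'. R a u}"
    have XA: "\<And>b. b \<in> B' \<Longrightarrow> R v b" if "v \<in> A - A'" "v \<notin> YA" for v
      using pure(1)[OF that(1)] that unfolding YA_def by auto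
    have XB: "\<And>a. a \<in> A' \<Longrightarrow> \<not> R a u" if "u \<in> B - B'" "u \<notin> YB" for u
      using pure(2)[OF that(1)] that unfolding YB_def by auto
    consider
      (edge) v u where "v \<in> YA" "u \<in> B - B'" "u \<notin> YB" "R v u" |
      (nonedge) v u where "v \<in> A - A'" "v \<notin> YA" "u \<in> YB" "\<not> R v u" |
      (none) "\<And>v u. v \<in> YA \<Longrightarrow> u \<in> B - B' \<Longrightarrow> u \<notin> YB \<Longrightarrow> \<not> R v u"
         "\<And>v u. v \<in> A - A' \<Longrightarrow> v \<notin> YA \<Longrightarrow> u \<in> YB \<Longrightarrow> R v u"
      by blast
    then show ?thesis
    proof cases
      case edge
      then have "star_forest R (insert v A') (insert u B')"
        using star_forest_add_edge[OF sf, of v u] XB[of u] unfolding YA_def by blast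
      then have "star_like R (insert v A') (insert u B')" unfolding star_like_def by blast
      then show ?thesis using ext[of v u] edge unfolding YA_def by blast
    next
      case nonedge
      then have "star_forest (\<lambda>a b. \<not> R a b) (insert v A') (insert u B')"
        using star_forest_add_nonedge[OF sf stab, of v u] XA[of v] unfolding YB_def by blast
      then have "star_like R (insert v A') (insert u B')" unfolding star_like_def by blast
      then show ?thesis using ext[of v u] nonedge unfolding YB_def by blast
    next
      case none
      have s: "YA \<subseteq> A" "YB \<subseteq> B" "A' \<union> YA \<subseteq> A" "B' \<union> YB \<subseteq> B" using sub unfolding YA_def YB_def by auto
      show ?thesis
      proof (cases "(A' \<union> YA, B' \<union> YB) = (A, B)")
        case True
        have "(YA, YB) \<noteq> ({}, {})" using True ne by auto
        moreover have "(YA, YB) \<noteq> (A, B)" using ab sub unfolding YA_def by auto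
        moreover have "\<forall>a\<in>A - YA. \<forall>b\<in>YB. R a b" "\<forall>a\<in>YA. \<forall>b\<in>B - YB. \<not> R a b"
          using True unfolding YA_def YB_def by auto
        ultimately show ?thesis using bipartite_strongD[OF strong s(1,2)] by argo
      next
        case False
        moreover have "(A' \<union> YA, B' \<union> YB) \<noteq> ({}, {})" using ab by auto
        moreover have "\<forall>a\<in>A - (A' \<union> YA). \<forall>b\<in>B' \<union> YB. R a b" using XA none(2) by auto
        moreover have "\<forall>a\<in>A' \<union> YA. \<forall>b\<in>B - (B' \<union> YB). \<not> R a b" using XB none(1) by auto
        ultimately show ?thesis using bipartite_strongD[OF strong s(3,4)] by argo
      qed
    qed
  qed
qed

lemma star_like_grow:
  assumes sl: "star_like R A' B'" and sub: "A' \<subseteq> A" "B' \<subseteq> B" and ne: "(A', B') \<noteq> (A, B)"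
    and st: "stable_between R A B" and strong: "bipartite_strong R A B"
  shows "\<exists>A'' B''. A' \<subseteq> A'' \<and> A'' \<subseteq> A \<and> B' \<subseteq> B'' \<and> B'' \<subseteq> B \<and> (A', B') \<noteq> (A'', B'') \<and> star_like R A'' B''"
  using sl[unfolded star_like_def]
proof (elim disjE)
  assume "star_forest R A' B'"
  then show ?thesis using star_forest_grow[OF _ sub ne st strong] by blast
next
  assume "star_forest (\<lambda>a b. \<not> R a b) A' B'"
  from star_forest_grow[OF this sub ne stable_between_complement[OF st] bipartite_strong_complement[OF strong]]
  show ?thesis unfolding star_like_complement .
next
  assume sf: "star_forest (\<lambda>b a. R a b) B' A'"
  have "(B', A') \<noteq> (B, A)" using ne by auto
  from star_forest_grow[OF sf sub(2,1) this stable_between_converse[OF st] bipartite_strong_converse[OF strong]]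
  obtain A'' B'' where "A' \<subseteq> A''" "A'' \<subseteq> A" "B' \<subseteq> B''" "B'' \<subseteq> B" "(B', A') \<noteq> (B'', A'')" "star_like R A'' B''"
    unfolding star_like_converse[of R] by blast
  then show ?thesis by (intro exI[of _ A''] exI[of _ B'']) auto
next
  assume sf: "star_forest (\<lambda>b a. \<not> R a b) B' A'"
  have "(B', A') \<noteq> (B, A)" using ne by auto
  from star_forest_grow[OF sf sub(2,1) this stable_between_complement[OF stable_between_converse[OF st]]
      bipartite_strong_complement[OF bipartite_strong_converse[OF strong]]]
  obtain A'' B'' where "A' \<subseteq> A''" "A'' \<subseteq> A" "B' \<subseteq> B''" "B'' \<subseteq> B" "(B', A') \<noteq> (B'', A'')" "star_like R A'' B''"
    unfolding star_like_complement star_like_converse[of R] by blast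
  then show ?thesis by (intro exI[of _ A''] exI[of _ B'']) auto
qed

text \<open>
  Take a vertex \<open>a\<close> of least degree, a neighbour \<open>b\<close> of \<open>a\<close>, and a nonneighbour \<open>a'\<close> of \<open>b\<close>: as \<open>a'\<close> has at least as many
  neighbours as \<open>a\<close>, it has a neighbour \<open>b'\<close> that \<open>a\<close> lacks.
\<close>
lemma bipartite_strong_imp_four_cycle:
  assumes strong: "bipartite_strong R A B" and fin: "finite A" "finite B" and two: "card A + card B \<ge> 2"
  shows "\<exists>a\<in>A. \<exists>a'\<in>A. \<exists>b\<in>B. \<exists>b'\<in>B. R a b \<and> R a' b' \<and> \<not> R a b' \<and> \<not> R a' b"
proof -
  note s = strong[unfolded bipartite_strong_def, rule_format]
  have "A \<noteq> {}"
  proof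
    assume A: "A = {}"
    then obtain b where b: "b \<in> B" using two fin by fastforce
    then have "{b} \<noteq> B" using two A by auto
    then show False using s[of "{}" "{b}"] b A by auto
  qed
  then obtain a where a: "a \<in> A" "\<And>a'. a' \<in> A \<Longrightarrow> card {b\<in>B. R a b} \<le> card {b\<in>B. R a' b}"
    using ex_has_least_nat[of "\<lambda>a. a \<in> A" _ "\<lambda>a. card {b\<in>B. R a b}"] by blast
  have "({a}, {}) \<noteq> (A, B)" using two by auto
  then obtain b where b: "b \<in> B" "R a b" using s[of "{a}" "{}"] a by auto
  have "({}, {b}) \<noteq> (A, B)" using a by auto
  then obtain a' where a': "a' \<in> A" "\<not> R a' b" using s[of "{}" "{b}"] b by auto
  have "\<not> {b\<in>B. R a' b} \<subset> {b\<in>B. R a b}"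
    using a(2)[OF a'(1)] psubset_card_mono[of "{b\<in>B. R a b}" "{b\<in>B. R a' b}"] fin by auto
  then obtain b' where "b' \<in> B" "R a' b'" "\<not> R a b'" using a' b by blast
  then show ?thesis using a(1) a' b by blast
qed

lemma strong_stable_imp_star_like:
  assumes strong: "bipartite_strong R A B" and st: "stable_between R A B"
    and fin: "finite A" "finite B" and two: "card A + card B \<ge> 2"
  shows "star_like R A B"
proof -
  define S where "S = {(A', B'). A' \<subseteq> A \<and> B' \<subseteq> B \<and> star_like R A' B'}"
  obtain a a' b b' where c: "a \<in> A" "a' \<in> A" "b \<in> B" "b' \<in> B" "R a b" "R a' b'" "\<not> R a b'" "\<not> R a' b"
    using bipartite_strong_imp_four_cycle[OF strong fin two] by blast
  then have "star_forest R {a, a'} {b, b'}" unfolding star_forest_def by auto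
  then have inS: "({a, a'}, {b, b'}) \<in> S" using c unfolding S_def star_like_def by auto
  have bound: "\<forall>x. x \<in> S \<longrightarrow> card (fst x) + card (snd x) < Suc (card A + card B)"
    using fin unfolding S_def by (auto simp: less_Suc_eq_le intro!: add_mono card_mono)
  have "\<exists>m. m \<in> S \<and> (\<forall>x. x \<in> S \<longrightarrow> card (fst x) + card (snd x) \<le> card (fst m) + card (snd m))"
    using ex_has_greatest_nat[of "\<lambda>x. x \<in> S" _ "\<lambda>x. card (fst x) + card (snd x)", OF inS bound] .
  then obtain m where m: "m \<in> S" "\<And>x. x \<in> S \<Longrightarrow> card (fst x) + card (snd x) \<le> card (fst m) + card (snd m)" by blast
  obtain A' B' where AB: "m = (A', B')" by (cases m)
  have sub: "A' \<subseteq> A" "B' \<subseteq> B" and sl: "star_like R A' B'" using m(1) AB unfolding S_def by auto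
  show ?thesis
  proof (cases "(A', B') = (A, B)")
    case False
    from star_like_grow[OF sl sub this st strong] obtain A'' B''
      where g: "A' \<subseteq> A''" "A'' \<subseteq> A" "B' \<subseteq> B''" "B'' \<subseteq> B" "(A', B') \<noteq> (A'', B'')" "star_like R A'' B''"
      by blast
    then have "card A'' + card B'' \<le> card A' + card B'" using m(2)[of "(A'', B'')"] AB unfolding S_def by auto
    moreover have f: "finite A''" "finite B''" using g fin finite_subset by blast+
    ultimately have "card A'' = card A'" "card B'' = card B'"
      using card_mono[OF f(1) g(1)] card_mono[OF f(2) g(3)] by auto
    then have "A'' = A'" "B'' = B'" using card_subset_eq[OF f(1) g(1)] card_subset_eq[OF f(2) g(3)] by auto
    then show ?thesis using g(5) by blast
  qed (use sl in auto)
qed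

section \<open>Isomorphism of graphs with the same degrees\<close>

lemma count_image_mset_set: "finite B \<Longrightarrow> count (image_mset f (mset_set B)) X = card {b \<in> B. f b = X}"
proof -
  assume B: "finite B"
  have "f -` {X} \<inter> B = {b \<in> B. f b = X}" by blast
  then have "count (image_mset f (mset_set B)) X = (\<Sum>b | b \<in> B \<and> f b = X. count (mset_set B) b)"
    using B by (simp add: count_image_mset)
  also have "\<dots> = (\<Sum>b | b \<in> B \<and> f b = X. 1)" by (rule sum.cong) (use B in auto)
  finally show ?thesis by simp
qed

text \<open>
  The graph is determined up to a permutation of \<open>B\<close> by the number of vertices of \<open>B\<close> with each given
  neighbourhood. As neighbourhoods have at most one element, these numbers can be read off from the degrees.
\<close>
lemma bipartite_functional_iso:
  fixes R R' :: "'a \<Rightarrow> 'b \<Rightarrow> bool"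
  assumes fin: "finite A" "finite B"
    and cols: "\<And>b. b \<in> B \<Longrightarrow> card {a \<in> A. R a b} = card {a \<in> A. R' a b}"
    and rows: "\<And>a. a \<in> A \<Longrightarrow> card {b \<in> B. R a b} = card {b \<in> B. R' a b}"
    and thin: "\<And>b. b \<in> B \<Longrightarrow> card {a \<in> A. R a b} \<le> 1"
  shows "\<exists>g. bij_betw g B B \<and> (\<forall>a\<in>A. \<forall>b\<in>B. R a b \<longleftrightarrow> R' a (g b))"
proof -
  have "card {b \<in> B. {a \<in> A. R a b} = X} = card {b \<in> B. {a \<in> A. R' a b} = X}" for X
  proof -
    have single: "{a \<in> A. S a b} = {x} \<longleftrightarrow> S x b"
      if "card {a \<in> A. S a b} \<le> 1" "x \<in> A" for S :: "'a \<Rightarrow> 'b \<Rightarrow> bool" and x b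
    proof
      assume "S x b"
      then have "{x} \<subseteq> {a \<in> A. S a b}" using that by blast
      then show "{a \<in> A. S a b} = {x}" using that fin by (intro card_seteq[symmetric]) auto
    qed blast
    consider "X = {}" | x where "X = {x}" "x \<in> A" | "\<nexists>x. X = {x} \<and> x \<in> A" "X \<noteq> {}" by blast
    then show ?thesis
    proof cases
      case 1
      have "{b \<in> B. {a \<in> A. R a b} = X} = {b \<in> B. {a \<in> A. R' a b} = X}"
      proof (rule Collect_cong)
        fix b
        have "{a \<in> A. S a b} = X \<longleftrightarrow> card {a \<in> A. S a b} = 0" for S :: "'a \<Rightarrow> 'b \<Rightarrow> bool"
          using 1 fin by auto
        then show "(b \<in> B \<and> {a \<in> A. R a b} = X) = (b \<in> B \<and> {a \<in> A. R' a b} = X)"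
          using cols[of b] by metis
      qed
      then show ?thesis by simp
    next
      case 2
      have e1: "{a \<in> A. R a b} = X \<longleftrightarrow> R x b" and e2: "{a \<in> A. R' a b} = X \<longleftrightarrow> R' x b" if "b \<in> B" for b
        unfolding 2(1) using single[OF _ 2(2), of R b] single[OF _ 2(2), of R' b] thin[OF that] cols[OF that] by simp_all
      have "{b \<in> B. {a \<in> A. R a b} = X} = {b \<in> B. R x b}" "{b \<in> B. {a \<in> A. R' a b} = X} = {b \<in> B. R' x b}"
        by (intro Collect_cong conj_cong refl e1 e2; assumption)+
      then show ?thesis using rows[OF 2(2)] by simp
    next
      case 3
      have ne: "{a \<in> A. S a b} \<noteq> X" if "card {a \<in> A. S a b} \<le> 1" for S :: "'a \<Rightarrow> 'b \<Rightarrow> bool" and b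
      proof
        assume X: "{a \<in> A. S a b} = X"
        have "finite {a \<in> A. S a b}" using fin by simp
        then have finX: "finite X" and cX: "card X \<le> 1" using that X by auto
        obtain x where "x \<in> X" using 3(2) by blast
        then have "X = {x}" using card_seteq[OF finX, of "{x}"] cX by auto
        then show False using 3(1) X by blast
      qed
      have "{a \<in> A. R a b} \<noteq> X" "{a \<in> A. R' a b} \<noteq> X" if "b \<in> B" for b
        using ne[of R b] ne[of R' b] thin[OF that] cols[OF that] by auto
      then have "{b \<in> B. {a \<in> A. R a b} = X} = {b \<in> B. {a \<in> A. R' a b} = X}" by blast
      then show ?thesis by simp
    qed
  qed
  then have "image_mset (\<lambda>b. {a \<in> A. R a b}) (mset_set B) = image_mset (\<lambda>b. {a \<in> A. R' a b}) (mset_set B)"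
    by (intro multiset_eqI) (simp only: count_image_mset_set[OF fin(2)])
  then obtain p where p: "p permutes B" "\<forall>b\<in>B. {a \<in> A. R a b} = {a \<in> A. R' a (p b)}"
    using image_mset_eq_implies_permutes[OF fin(2)] by blast
  then show ?thesis using permutes_imp_bij[OF p(1)] by blast
qed

definition thin_between :: "('a \<Rightarrow> 'b \<Rightarrow> bool) \<Rightarrow> 'a set \<Rightarrow> 'b set \<Rightarrow> bool" where
  "thin_between R A B \<longleftrightarrow>
     (\<forall>b\<in>B. card {a \<in> A. R a b} \<le> 1) \<or> (\<forall>b\<in>B. card {a \<in> A. \<not> R a b} \<le> 1) \<or>
     (\<forall>a\<in>A. card {b \<in> B. R a b} \<le> 1) \<or> (\<forall>a\<in>A. card {b \<in> B. \<not> R a b} \<le> 1)"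

lemma thin_between_subset:
  assumes "thin_between R A B" "A' \<subseteq> A" "B' \<subseteq> B" "finite A" "finite B"
  shows "thin_between R A' B'"
proof -
  have "card {a \<in> A'. P a} \<le> card {a \<in> A. P a}" for P using assms by (intro card_mono) auto
  moreover have "card {b \<in> B'. P b} \<le> card {b \<in> B. P b}" for P using assms by (intro card_mono) auto
  ultimately show ?thesis using assms(1-3) unfolding thin_between_def by (meson le_trans subsetD)
qed

lemma card_complement_in:
  "finite X \<Longrightarrow> card {x \<in> X. \<not> P x} = card X - card {x \<in> X. P x}"
proof -
  assume "finite X"
  moreover have "{x \<in> X. \<not> P x} = X - {x \<in> X. P x}" by blast
  ultimately show ?thesis by (simp add: card_Diff_subset)
qed

lemma thin_between_iso:
  fixes R R' :: "'a \<Rightarrow> 'b \<Rightarrow> bool"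
  assumes fin: "finite A" "finite B"
    and cols: "\<And>b. b \<in> B \<Longrightarrow> card {a \<in> A. R a b} = card {a \<in> A. R' a b}"
    and rows: "\<And>a. a \<in> A \<Longrightarrow> card {b \<in> B. R a b} = card {b \<in> B. R' a b}"
    and thin: "thin_between R A B"
  shows "\<exists>g h. bij_betw g A A \<and> bij_betw h B B \<and> (\<forall>a\<in>A. \<forall>b\<in>B. R a b \<longleftrightarrow> R' (g a) (h b))"
proof -
  have cols': "card {a \<in> A. \<not> R a b} = card {a \<in> A. \<not> R' a b}" if "b \<in> B" for b
    using cols[OF that] card_complement_in[OF fin(1)] by metis
  have rows': "card {b \<in> B. \<not> R a b} = card {b \<in> B. \<not> R' a b}" if "a \<in> A" for a
    using rows[OF that] card_complement_in[OF fin(2)] by metis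
  have id: "bij_betw id A A" "bij_betw id B B" by auto
  from thin consider
    "\<forall>b\<in>B. card {a \<in> A. R a b} \<le> 1" | "\<forall>b\<in>B. card {a \<in> A. \<not> R a b} \<le> 1" |
    "\<forall>a\<in>A. card {b \<in> B. R a b} \<le> 1" | "\<forall>a\<in>A. card {b \<in> B. \<not> R a b} \<le> 1"
    unfolding thin_between_def by blast
  then show ?thesis
  proof cases
    case 1
    then obtain h where "bij_betw h B B" "\<forall>a\<in>A. \<forall>b\<in>B. R a b \<longleftrightarrow> R' a (h b)"
      using bipartite_functional_iso[of A B R R', OF fin cols rows] by blast
    then show ?thesis using id(1) by (intro exI[of _ id] exI[of _ h]) simp
  next
    case 2
    then obtain h where "bij_betw h B B" "\<forall>a\<in>A. \<forall>b\<in>B. \<not> R a b \<longleftrightarrow> \<not> R' a (h b)"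
      using bipartite_functional_iso[of A B "\<lambda>a b. \<not> R a b" "\<lambda>a b. \<not> R' a b", OF fin cols' rows'] by blast
    then show ?thesis using id(1) by (intro exI[of _ id] exI[of _ h]) simp
  next
    case 3
    then obtain g where "bij_betw g A A" "\<forall>b\<in>B. \<forall>a\<in>A. R a b \<longleftrightarrow> R' (g a) b"
      using bipartite_functional_iso[of B A "\<lambda>b a. R a b" "\<lambda>b a. R' a b", OF fin(2,1) rows cols] by blast
    then show ?thesis using id(2) by (intro exI[of _ g] exI[of _ id]) simp
  next
    case 4
    then obtain g where "bij_betw g A A" "\<forall>b\<in>B. \<forall>a\<in>A. \<not> R a b \<longleftrightarrow> \<not> R' (g a) b"
      using bipartite_functional_iso[of B A "\<lambda>b a. \<not> R a b" "\<lambda>b a. \<not> R' a b", OF fin(2,1) rows' cols'] by blast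
    then show ?thesis using id(2) by (intro exI[of _ g] exI[of _ id]) simp
  qed
qed

text \<open>
  A perfect matching is the same as a fixed-point free involution, so this says that perfect matchings on sets
  of the same size are isomorphic.
\<close>
lemma involutions_equivariant_bij:
  assumes "finite M" "finite N" "card M = card N"
    and "\<And>x. x \<in> M \<Longrightarrow> f x \<in> M \<and> f (f x) = x \<and> f x \<noteq> x"
    and "\<And>x. x \<in> N \<Longrightarrow> g x \<in> N \<and> g (g x) = x \<and> g x \<noteq> x"
  shows "\<exists>h. bij_betw h M N \<and> (\<forall>x\<in>M. h (f x) = g (h x))"
  using assms
proof (induction "card M" arbitrary: M N rule: less_induct)
  case less
  note f = less.prems(4) and g = less.prems(5)
  show ?case
  proof (cases "M = {}")
    case True
    then show ?thesis using less.prems by (auto simp: bij_betw_def)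
  next
    case False
    then obtain x where x: "x \<in> M" by blast
    then have "N \<noteq> {}" using less.prems by auto
    then obtain y where y: "y \<in> N" by blast
    define M' N' where "M' = M - {x, f x}" and "N' = N - {y, g y}"
    have c: "card M' = card M - 2" "card N' = card N - 2"
      unfolding M'_def N'_def using x y f[OF x] g[OF y] less.prems(1,2) by (auto simp: card_Diff_subset)
    have "card M > 0" using x less.prems(1) by (auto simp: card_gt_0_iff)
    then have lt: "card M' < card M" using c by linarith
    have f': "f z \<in> M' \<and> f (f z) = z \<and> f z \<noteq> z" if "z \<in> M'" for z
      using that f[of z] f[OF x] unfolding M'_def by auto
    have g': "g z \<in> N' \<and> g (g z) = z \<and> g z \<noteq> z" if "z \<in> N'" for z
      using that g[of z] g[OF y] unfolding N'_def by auto
    obtain h where h: "bij_betw h M' N'" "\<forall>z\<in>M'. h (f z) = g (h z)"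
      using less.hyps[OF lt _ _ _ f' g'] c less.prems(1-3) unfolding M'_def N'_def by auto
    define h' where "h' z = (if z = x then y else if z = f x then g y else h z)" for z
    have "bij_betw h' M' N'" using h(1) by (rule bij_betw_cong[THEN iffD1, rotated]) (auto simp: M'_def h'_def)
    moreover have "bij_betw h' {x, f x} {y, g y}"
      using f[OF x] g[OF y] unfolding h'_def bij_betw_def by auto
    moreover have "N' \<inter> {y, g y} = {}" unfolding N'_def by blast
    ultimately have "bij_betw h' (M' \<union> {x, f x}) (N' \<union> {y, g y})" by (rule bij_betw_combine)
    moreover have "M' \<union> {x, f x} = M" "N' \<union> {y, g y} = N" using x y f[OF x] g[OF y] unfolding M'_def N'_def by auto
    moreover have "h' (f z) = g (h' z)" if z: "z \<in> M" for z
    proof -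
      consider "z = x" | "z = f x" | "z \<in> M'" using z unfolding M'_def by blast
      then show ?thesis
      proof cases
        case 3
        then show ?thesis using f'[OF 3] h(2) unfolding h'_def M'_def by auto
      qed (use f[OF x] g[OF y] in \<open>auto simp: h'_def\<close>)
    qed
    ultimately show ?thesis by auto
  qed
qed

lemma even_card_involution:
  assumes "finite M" "\<And>x. x \<in> M \<Longrightarrow> f x \<in> M \<and> f (f x) = x \<and> f x \<noteq> x"
  shows "even (card M)"
  using assms
proof (induction "card M" arbitrary: M rule: less_induct)
  case less
  note f = less.prems(2)
  show ?case
  proof (cases "M = {}")
    case False
    then obtain x where x: "x \<in> M" by blast
    define M' where "M' = M - {x, f x}"
    have "card {x, f x} \<le> card M" using x f[OF x] less.prems(1) by (intro card_mono) auto
    then have c: "card M = card M' + 2"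
      unfolding M'_def using x f[OF x] less.prems(1) by (auto simp: card_Diff_subset)
    have f': "f z \<in> M' \<and> f (f z) = z \<and> f z \<noteq> z" if "z \<in> M'" for z
      using that f[of z] f[OF x] unfolding M'_def by auto
    have "even (card M')" by (rule less.hyps) (use c f' less.prems(1) M'_def in auto)
    then show ?thesis using c by simp
  qed simp
qed

section \<open>Graphs that are determined by their degrees\<close>

definition same_degrees :: "'a set \<Rightarrow> ('a \<Rightarrow> 'a \<Rightarrow> bool) \<Rightarrow> ('a \<Rightarrow> 'a \<Rightarrow> bool) \<Rightarrow> bool" where
  "same_degrees V E F \<longleftrightarrow> (\<forall>v\<in>V. deg E V v = deg F V v)"

definition iso_on :: "'a set \<Rightarrow> ('a \<Rightarrow> 'a \<Rightarrow> bool) \<Rightarrow> ('a \<Rightarrow> 'a \<Rightarrow> bool) \<Rightarrow> bool" where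
  "iso_on V E F \<longleftrightarrow> (\<exists>f. bij_betw f V V \<and> (\<forall>u\<in>V. \<forall>v\<in>V. E u v \<longleftrightarrow> F (f u) (f v)))"

text \<open>
  The unigraph property for labelled graphs: a graph with the same degree sequence can be relabelled so that
  each single vertex keeps its degree (\<open>unigraph_if_degree_determined\<close> below).
\<close>
definition degree_determined :: "('a \<Rightarrow> 'a \<Rightarrow> bool) \<Rightarrow> 'a set \<Rightarrow> bool" where
  "degree_determined E V \<longleftrightarrow> (\<forall>F. simple_adjacency F \<longrightarrow> same_degrees V E F \<longrightarrow> iso_on V E F)"

context simple_adjacency
begin

lemma degree_determined_co:
  assumes fin: "finite V" and det: "degree_determined (co E) V"
  shows "degree_determined E V"
  unfolding degree_determined_def
proof (intro allI impI)
  fix F assume F: "simple_adjacency F" and s: "same_degrees V E F"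
  interpret F: simple_adjacency F by (rule F)
  have "deg (co E) V v = deg (co F) V v" if "v \<in> V" for v
    using deg_co[OF fin that] F.deg_co[OF fin that] s that unfolding same_degrees_def by simp
  then have "iso_on V (co E) (co F)"
    using det F.simple_adjacency_co unfolding degree_determined_def same_degrees_def by blast
  then obtain f where f: "bij_betw f V V" "\<And>u v. u \<in> V \<Longrightarrow> v \<in> V \<Longrightarrow> co E u v \<longleftrightarrow> co F (f u) (f v)"
    unfolding iso_on_def by blast
  have "E u v \<longleftrightarrow> F (f u) (f v)" if "u \<in> V" "v \<in> V" for u v
  proof (cases "u = v")
    case False
    then have "f u \<noteq> f v" using f(1) that unfolding bij_betw_def inj_on_def by blast
    then show ?thesis using f(2)[OF that] False unfolding co_def by blast
  qed (simp add: irrefl F.irrefl)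
  then show "iso_on V E F" using f(1) unfolding iso_on_def by blast
qed

text \<open>
  All edges that do not meet \<open>c\<close> form a matching \<open>p\<close> of the vertices of degree one that are not adjacent to \<open>c\<close>.
\<close>
lemma sparse_structure:
  assumes fin: "finite V" and c: "c \<in> V" and sparse: "\<forall>v\<in>V - {c}. deg E V v \<le> 1"
  defines "N \<equiv> {u \<in> V. E c u}" and "M \<equiv> {v \<in> V - {c}. deg E V v = 1} - {u \<in> V. E c u}"
  shows "N \<subseteq> {v \<in> V - {c}. deg E V v = 1}"
    and "\<exists>p. (\<forall>x\<in>M. p x \<in> M \<and> p (p x) = x \<and> p x \<noteq> x) \<and>
      (\<forall>u\<in>V. \<forall>v\<in>V. E u v \<longleftrightarrow> u = c \<and> v \<in> N \<or> v = c \<and> u \<in> N \<or> u \<in> M \<and> v = p u)"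
proof -
  define p where "p v = (SOME u. u \<in> V \<and> E v u)" for v
  have one: "deg E V v = 1 \<and> p v = u" if "v \<in> V" "v \<noteq> c" "u \<in> V" "E v u" for u v
  proof -
    have f: "finite {w \<in> V. E v w}" using fin by simp
    have u: "u \<in> {w \<in> V. E v w}" using that by blast
    then have "deg E V v > 0" unfolding deg_def using f by (auto simp: card_gt_0_iff)
    then have d: "deg E V v = 1" using bspec[OF sparse, of v] that(1,2) by simp
    then obtain x where x: "{w \<in> V. E v w} = {x}" unfolding deg_def using card_1_singletonE by blast
    have "p v \<in> V \<and> E v (p v)" unfolding p_def by (rule someI[of _ u]) (use that in blast)
    then have "p v \<in> {w \<in> V. E v w}" by blast
    then show ?thesis using x u d by simp
  qed
  have p: "p v \<in> V \<and> E v (p v)" if "v \<in> V" "deg E V v = 1" for v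
  proof -
    have "{w \<in> V. E v w} \<noteq> {}" using that(2) unfolding deg_def by (metis card.empty zero_neq_one)
    then have "\<exists>u. u \<in> V \<and> E v u" by blast
    then show ?thesis unfolding p_def by (rule someI_ex)
  qed
  show "N \<subseteq> {v \<in> V - {c}. deg E V v = 1}"
    unfolding N_def using one[OF _ _ c] sym irrefl by blast
  have M: "v \<in> M \<longleftrightarrow> v \<in> V \<and> v \<noteq> c \<and> deg E V v = 1 \<and> \<not> E c v" for v unfolding M_def by blast
  have inv: "p x \<in> M \<and> p (p x) = x \<and> p x \<noteq> x" if x: "x \<in> M" for x
  proof -
    have x': "x \<in> V" "x \<noteq> c" "deg E V x = 1" "\<not> E c x" using x M by blast+
    have px: "p x \<in> V" "E x (p x)" using p[OF x'(1,3)] by blast+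
    have "p x \<noteq> c" using px x'(4) sym by blast
    then have "deg E V (p x) = 1 \<and> p (p x) = x" using one[OF px(1) _ x'(1)] px(2) sym by blast
    moreover have "\<not> E c (p x)"
      using one[OF px(1) \<open>p x \<noteq> c\<close> c] calculation x'(2) sym by auto
    moreover have "p x \<noteq> x" using px irrefl by metis
    ultimately show ?thesis using M px \<open>p x \<noteq> c\<close> by blast
  qed
  have "E u v \<longleftrightarrow> u = c \<and> v \<in> N \<or> v = c \<and> u \<in> N \<or> u \<in> M \<and> v = p u" if "u \<in> V" "v \<in> V" for u v
  proof
    assume e: "E u v"
    show "u = c \<and> v \<in> N \<or> v = c \<and> u \<in> N \<or> u \<in> M \<and> v = p u"
    proof (cases "u = c \<or> v = c")
      case True
      then show ?thesis using e that sym unfolding N_def by blast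
    next
      case False
      then have "deg E V u = 1" "p u = v" using one[OF that(1) _ that(2) e] by blast+
      moreover have "\<not> E c u" using one[OF that(1) _ c] False sym calculation(2) by blast
      ultimately show ?thesis using M that False by blast
    qed
  next
    assume "u = c \<and> v \<in> N \<or> v = c \<and> u \<in> N \<or> u \<in> M \<and> v = p u"
    then show "E u v" using p sym M unfolding N_def by blast
  qed
  then show "\<exists>p. (\<forall>x\<in>M. p x \<in> M \<and> p (p x) = x \<and> p x \<noteq> x) \<and>
      (\<forall>u\<in>V. \<forall>v\<in>V. E u v \<longleftrightarrow> u = c \<and> v \<in> N \<or> v = c \<and> u \<in> N \<or> u \<in> M \<and> v = p u)"
    using inv by blast
qed

lemma sparse_degree_determined:
  assumes fin: "finite V" and sparse: "\<And>v. v \<in> V \<Longrightarrow> v \<noteq> c0 \<Longrightarrow> deg E V v \<le> 1"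
  shows "degree_determined E V"
  unfolding degree_determined_def
proof (intro allI impI)
  fix F assume "simple_adjacency F" and s: "same_degrees V E F"
  then interpret F: simple_adjacency F by simp
  show "iso_on V E F"
  proof (cases "V = {}")
    case True
    then show ?thesis unfolding iso_on_def by auto
  next
    case False
    obtain c where c: "c \<in> V" and sp: "\<forall>v\<in>V - {c}. deg E V v \<le> 1"
    proof (cases "c0 \<in> V")
      case False
      then show thesis using that \<open>V \<noteq> {}\<close> sparse by blast
    qed (use that sparse in blast)
    have dF: "deg F V v = deg E V v" if "v \<in> V" for v using s that unfolding same_degrees_def by simp
    have sp': "\<forall>v\<in>V - {c}. deg F V v \<le> 1" using sp dF by simp
    define U where "U = {v \<in> V - {c}. deg E V v = 1}"
    have U: "{v \<in> V - {c}. deg F V v = 1} = U" unfolding U_def using dF by auto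
    define N N' where "N = {u \<in> V. E c u}" and "N' = {u \<in> V. F c u}"
    define M M' where "M = U - N" and "M' = U - N'"
    have finU: "finite U" using fin unfolding U_def by simp
    have NU: "N \<subseteq> U" using sparse_structure(1)[OF fin c sp] unfolding N_def U_def by blast
    have NU': "N' \<subseteq> U" using F.sparse_structure(1)[OF fin c sp'] unfolding N'_def U by blast
    from sparse_structure(2)[OF fin c sp, folded U_def N_def, folded M_def]
    obtain p where p0: "\<forall>x\<in>M. p x \<in> M \<and> p (p x) = x \<and> p x \<noteq> x"
      "\<forall>u\<in>V. \<forall>v\<in>V. E u v \<longleftrightarrow> u = c \<and> v \<in> N \<or> v = c \<and> u \<in> N \<or> u \<in> M \<and> v = p u"
      by (elim exE conjE)
    from F.sparse_structure(2)[OF fin c sp', unfolded U, folded N'_def, folded M'_def]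
    obtain p' where p0': "\<forall>x\<in>M'. p' x \<in> M' \<and> p' (p' x) = x \<and> p' x \<noteq> x"
      "\<forall>u\<in>V. \<forall>v\<in>V. F u v \<longleftrightarrow> u = c \<and> v \<in> N' \<or> v = c \<and> u \<in> N' \<or> u \<in> M' \<and> v = p' u"
      by (elim exE conjE)
    note p = p0[rule_format] and p' = p0'[rule_format]
    have finN: "finite N" "finite N'" "finite M" "finite M'"
      using NU NU' finU finite_subset unfolding M_def M'_def by blast+
    have cN: "card N = card N'" using dF[OF c] unfolding deg_def N_def N'_def by simp
    then have cM: "card M = card M'" unfolding M_def M'_def using NU NU' finN by (simp add: card_Diff_subset)
    obtain h where h: "bij_betw h M M'" "\<And>x. x \<in> M \<Longrightarrow> h (p x) = p' (h x)"
      using involutions_equivariant_bij[of M M' p p', OF finN(3,4) cM p(1) p'(1)] by blast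
    obtain k where k: "bij_betw k N N'" using finite_same_card_bij[OF finN(1,2) cN] by blast
    define f where "f v = (if v \<in> M then h v else if v \<in> N then k v else v)" for v
    have b1: "bij_betw f M M'" using h(1) by (rule bij_betw_cong[THEN iffD1, rotated]) (simp add: f_def)
    have b2: "bij_betw f N N'" using k by (rule bij_betw_cong[THEN iffD1, rotated]) (simp add: f_def M_def)
    have b3: "bij_betw f (V - U) (V - U)"
      using NU by (intro bij_betw_cong[THEN iffD1, OF _ bij_betw_id]) (auto simp: f_def M_def)
    have UM: "M \<union> N = U" "M' \<union> N' = U" using NU NU' unfolding M_def M'_def by auto
    have b12: "bij_betw f U U"
      using bij_betw_combine[OF b1 b2] UM unfolding M'_def by auto
    have UV: "U \<union> (V - U) = V" "U \<inter> (V - U) = {}" unfolding U_def by auto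
    have bij: "bij_betw f V V" using bij_betw_combine[OF b12 b3 UV(2)] UV(1) by simp
    have cU: "c \<in> V - U" using c unfolding U_def by simp
    have fc: "f c = c" using cU UM unfolding f_def by auto
    have fV: "f v \<in> V" if "v \<in> V" for v using bij that unfolding bij_betw_def by blast
    have feq: "f u = f v \<longleftrightarrow> u = v" if "u \<in> V" "v \<in> V" for u v
      using bij that unfolding bij_betw_def inj_on_def by blast
    have fU: "f v \<in> U \<longleftrightarrow> v \<in> U" if "v \<in> V" for v
    proof
      show "f v \<in> U" if "v \<in> U" using b12 that unfolding bij_betw_def by blast
      show "v \<in> U" if "f v \<in> U"
        using b3 that \<open>v \<in> V\<close> unfolding bij_betw_def by blast
    qed
    have fM: "f v \<in> M' \<longleftrightarrow> v \<in> M" and fN: "f v \<in> N' \<longleftrightarrow> v \<in> N" if v: "v \<in> V" for v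
    proof -
      have 1: "f v \<in> M'" if "v \<in> M" using b1 that unfolding bij_betw_def by blast
      have 2: "f v \<in> N'" if "v \<in> N" using b2 that unfolding bij_betw_def by blast
      show "f v \<in> M' \<longleftrightarrow> v \<in> M" "f v \<in> N' \<longleftrightarrow> v \<in> N"
        using 1 2 fU[OF v] UM unfolding M_def M'_def by blast+
    qed
    have MV: "M \<subseteq> V" unfolding M_def U_def by blast
    have "E u v \<longleftrightarrow> F (f u) (f v)" if uv: "u \<in> V" "v \<in> V" for u v
    proof -
      have "v = p u \<longleftrightarrow> f v = p' (f u)" if u: "u \<in> M"
      proof -
        have pu: "p u \<in> M" using p(1)[OF u] by blast
        have "p' (f u) = f (p u)" using h(2)[OF u] u pu unfolding f_def by simp
        then show ?thesis using feq[OF uv(2)] pu MV by auto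
      qed
      moreover have "f u = c \<longleftrightarrow> u = c" "f v = c \<longleftrightarrow> v = c" using feq[OF _ c] uv fc by auto
      ultimately show ?thesis
        unfolding p(2)[OF uv] p'(2)[OF fV[OF uv(1)] fV[OF uv(2)]] fM[OF uv(1)] fN[OF uv(1)] fN[OF uv(2)] by blast
    qed
    then show ?thesis using bij unfolding iso_on_def by blast
  qed
qed

lemma two_regular_five_cycle:
  assumes V: "card V = 5" and two: "\<And>v. v \<in> V \<Longrightarrow> deg E V v = 2"
  shows "\<exists>a b c d e. five_cycle E a b c d e \<and> V = {a, b, c, d, e}"
proof -
  have fin: "finite V" using V card.infinite by force
  have nb: "\<exists>x y. x \<noteq> y \<and> x \<in> V \<and> y \<in> V \<and> x \<noteq> v \<and> y \<noteq> v \<and> (\<forall>w\<in>V. E v w \<longleftrightarrow> w = x \<or> w = y)" if "v \<in> V" for v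
  proof -
    have "card {w \<in> V. E v w} = 2" using two[OF that] unfolding deg_def .
    then obtain x y where "{w \<in> V. E v w} = {x, y}" "x \<noteq> y" unfolding card_2_iff by blast
    then have "x \<in> V" "y \<in> V" "E v x" "E v y" and w: "\<And>w. w \<in> V \<Longrightarrow> E v w \<longleftrightarrow> w = x \<or> w = y" by blast+
    then have "x \<noteq> v" "y \<noteq> v" using irrefl by metis+
    then show ?thesis using \<open>x \<in> V\<close> \<open>y \<in> V\<close> \<open>x \<noteq> y\<close> w by (intro exI[of _ x] exI[of _ y]) simp
  qed
  obtain a where a: "a \<in> V" using V by fastforce
  obtain b e where be: "b \<noteq> e" "b \<in> V" "e \<in> V" "b \<noteq> a" "e \<noteq> a" "\<And>w. w \<in> V \<Longrightarrow> E a w \<longleftrightarrow> w = b \<or> w = e"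
    using nb[OF a] by blast
  have "card (V - {a, b, e}) = 2" using V fin a be by (simp add: card_Diff_subset)
  then obtain c d where cd: "V - {a, b, e} = {c, d}" "c \<noteq> d" unfolding card_2_iff by blast
  then have VV: "V = {a, b, c, d, e}" and dist: "distinct [a, b, c, d, e]" using a be by auto
  have ab: "E a b" "E a e" "\<not> E a c" "\<not> E a d" using be VV dist by auto
  have "deg E {a, b, c, d, e} b = 2" "deg E {a, b, c, d, e} c = 2" "deg E {a, b, c, d, e} d = 2" "deg E {a, b, c, d, e} e = 2"
    using two unfolding VV by auto
  then have eqs: "of_bool (E b c) + of_bool (E b d) + of_bool (E b e) = (1::nat)"
    "of_bool (E b c) + of_bool (E c d) + of_bool (E c e) = (2::nat)"
    "of_bool (E b d) + of_bool (E c d) + of_bool (E d e) = (2::nat)"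
    "of_bool (E b e) + of_bool (E c e) + of_bool (E d e) = (1::nat)"
    using dist ab irrefl comm[of b a] comm[of e a] comm[of c a] comm[of d a] comm[of c b] comm[of d b]
      comm[of e b] comm[of d c] comm[of e c] comm[of e d] by auto
  have "E b c \<and> E c d \<and> E d e \<and> \<not> E b d \<and> \<not> E b e \<and> \<not> E c e \<or> E b d \<and> E c d \<and> E c e \<and> \<not> E b c \<and> \<not> E b e \<and> \<not> E d e"
    using eqs by (cases "E b c"; cases "E b d"; cases "E b e"; cases "E c d"; cases "E c e"; cases "E d e"; simp)
  then have "five_cycle E a b c d e \<or> five_cycle E a b d c e"
    using ab dist comm[of e a] comm[of d a] comm[of e b] comm[of d c] comm[of c a] comm[of e c] comm[of e d] unfolding five_cycle_def by auto
  then show ?thesis using VV by (metis insert_commute)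
qed

lemma five_cycle_iso:
  assumes E: "five_cycle E a b c d e" "V = {a, b, c, d, e}"
    and F: "simple_adjacency F" "five_cycle F a' b' c' d' e'" "V = {a', b', c', d', e'}"
  shows "iso_on V E F"
proof -
  interpret F: simple_adjacency F by (rule F)
  define f where "f x = (if x = a then a' else if x = b then b' else if x = c then c' else if x = d then d' else e')" for x
  note e = five_cycle_facts[OF E(1)] and e' = F.five_cycle_facts[OF F(2)]
  note dist = e(1) e'(1)
  have f: "f a = a'" "f b = b'" "f c = c'" "f d = d'" "f e = e'" using dist(1) unfolding f_def by auto
  have "f ` V = V" unfolding E(2) by (simp add: f) (use E(2) F(3) in simp)
  moreover have "inj_on f V" unfolding E(2) inj_on_def using f dist by auto
  ultimately have bij: "bij_betw f V V" unfolding bij_betw_def by blast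
  have "E u v \<longleftrightarrow> F (f u) (f v)" if "u \<in> V" "v \<in> V" for u v
    using that unfolding E(2) by (auto simp: f e(2-) e'(2-))
  then show ?thesis using bij unfolding iso_on_def by blast
qed

lemma five_cycle_regular:
  assumes "five_cycle E a b c d e" "v \<in> {a, b, c, d, e}"
  shows "deg E {a, b, c, d, e} v = 2"
  using assms(2) five_cycle_facts[OF assms(1)] by auto

lemma five_cycle_degree_determined:
  assumes "five_cycle E a b c d e"
  shows "degree_determined E {a, b, c, d, e}"
  unfolding degree_determined_def
proof (intro allI impI)
  let ?V = "{a, b, c, d, e}"
  fix F assume F: "simple_adjacency F" and s: "same_degrees ?V E F"
  then interpret F: simple_adjacency F by simp
  have "card ?V = 5" using assms unfolding five_cycle_def by simp
  moreover have "deg F ?V v = 2" if "v \<in> ?V" for v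
  proof -
    have "deg E ?V v = deg F ?V v" using s that unfolding same_degrees_def by blast
    then show ?thesis using five_cycle_regular[OF assms that] by linarith
  qed
  ultimately obtain a' b' c' d' e' where "five_cycle F a' b' c' d' e'" "?V = {a', b', c', d', e'}"
    using F.two_regular_five_cycle[of ?V] by blast
  then show "iso_on ?V E F" using five_cycle_iso[OF assms refl F] by blast
qed

end

lemma deg_union:
  assumes "finite X" "finite Y" "X \<inter> Y = {}" shows "deg E (X \<union> Y) v = deg E X v + deg E Y v"
proof -
  have "{u \<in> X \<union> Y. E v u} = {u \<in> X. E v u} \<union> {u \<in> Y. E v u}" by blast
  then show ?thesis using assms unfolding deg_def by (simp add: card_Un_disjoint disjoint_iff)
qed

lemma deg_le_card: "finite X \<Longrightarrow> deg E X v \<le> card X"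
  unfolding deg_def by (auto intro: card_mono)

lemma deg_eq_card_iff: "finite X \<Longrightarrow> deg E X v = card X \<longleftrightarrow> (\<forall>x\<in>X. E v x)"
proof -
  assume X: "finite X"
  have "deg E X v = card X \<longleftrightarrow> {u \<in> X. E v u} = X"
    unfolding deg_def using X card_subset_eq[of X "{u \<in> X. E v u}"] by auto
  also have "\<dots> \<longleftrightarrow> (\<forall>x\<in>X. E v x)" by blast
  finally show ?thesis .
qed

lemma deg_eq_0_iff: "finite X \<Longrightarrow> deg E X v = 0 \<longleftrightarrow> (\<forall>x\<in>X. \<not> E v x)"
  unfolding deg_def by auto

context simple_adjacency
begin

lemma deg_own_side: "deg E X v = deg E (X - {v}) v"
  unfolding deg_def using irrefl by (metis (no_types, lifting) DiffD1 DiffI singletonD)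

lemma sum_deg_swap:
  assumes "finite X" "finite Y" shows "(\<Sum>x\<in>X. deg E Y x) = (\<Sum>y\<in>Y. deg E X y)"
proof -
  have d: "deg E Z v = (\<Sum>u\<in>Z. of_bool (E v u))" if "finite Z" for Z v
    unfolding deg_def using that by (simp add: sum.If_cases of_bool_def Int_def)
  have "(\<Sum>x\<in>X. deg E Y x) = (\<Sum>x\<in>X. \<Sum>y\<in>Y. of_bool (E x y))" using assms d by simp
  also have "\<dots> = (\<Sum>y\<in>Y. \<Sum>x\<in>X. of_bool (E y x))" by (subst sum.swap) (simp add: comm)
  also have "\<dots> = (\<Sum>y\<in>Y. deg E X y)" using assms d by simp
  finally show ?thesis .
qed

end

text \<open>
  With $C = V - A - B$, the difference of the degree sums over \<open>B\<close> and over \<open>A\<close> does not depend on the edges between \<open>A\<close> and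
  \<open>B\<close>. It is at most $|B|(|B| - 1) + |B||C|$, with equality exactly if \<open>B\<close> is a clique that is complete to $C$ and \<open>A\<close>
  is an independent set that is anticomplete to $C$. So the degrees alone tell that \<open>A\<close>, \<open>B\<close> split off.
\<close>
lemma splits_off_same_degrees:
  assumes E: "simple_adjacency E" and F: "simple_adjacency F" and fin: "finite V"
    and s: "same_degrees V E F" and so: "splits_off E V A B"
  shows "splits_off F V A B"
proof -
  interpret E: simple_adjacency E by (rule E)
  interpret F: simple_adjacency F by (rule F)
  define C where "C = V - A - B"
  have sub: "A \<subseteq> V" "B \<subseteq> V" "A \<inter> B = {}" using so unfolding splits_off_def by blast+
  have finA: "finite A" and finB: "finite B" and finC: "finite C"
    using sub fin finite_subset unfolding C_def by blast+
  have V: "V = A \<union> (B \<union> C)" "A \<inter> (B \<union> C) = {}" "B \<inter> C = {}" using sub unfolding C_def by blast+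
  have split: "deg R V v = deg R A v + deg R B v + deg R C v" for R :: "'a \<Rightarrow> 'a \<Rightarrow> bool" and v
    unfolding V(1) using deg_union[of A "B \<union> C"] deg_union[of B C] V finA finB finC by simp
  \<comment> \<open>Only the edges between \<open>A\<close> and \<open>B\<close> contribute to both degree sums, and they cancel in the difference.\<close>
  let ?top = "\<lambda>R. \<Sum>b\<in>B. deg R B b + deg R C b" and ?bot = "\<lambda>R. \<Sum>a\<in>A. deg R A a + deg R C a"
  have diff: "(\<Sum>b\<in>B. deg R V b) + ?bot R = (\<Sum>a\<in>A. deg R V a) + ?top R" if "simple_adjacency R" for R
    using simple_adjacency.sum_deg_swap[OF that finA finB] by (simp add: split sum.distrib)
  have deg_eq: "(\<Sum>b\<in>B. deg F V b) = (\<Sum>b\<in>B. deg E V b)" "(\<Sum>a\<in>A. deg F V a) = (\<Sum>a\<in>A. deg E V a)"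
    using s sub unfolding same_degrees_def by (auto intro!: sum.cong)
  have top_E: "deg E B b + deg E C b = card (B - {b}) + card C" if "b \<in> B" for b
  proof -
    have "deg E (B - {b}) b = card (B - {b})" using deg_eq_card_iff[of "B - {b}" E b] so that finB unfolding splits_off_def by auto
    moreover have "deg E C b = card C" using deg_eq_card_iff[OF finC, of E b] so that unfolding splits_off_def C_def by blast
    ultimately show ?thesis using E.deg_own_side[of B b] by simp
  qed
  have "deg E A a + deg E C a = 0" if "a \<in> A" for a
    using deg_eq_0_iff[OF finA, of E a] deg_eq_0_iff[OF finC, of E a] so that unfolding splits_off_def C_def by auto
  then have bot_E: "?bot E = 0" by simp
  have top_F: "deg F B b + deg F C b \<le> card (B - {b}) + card C" if "b \<in> B" for b
    using deg_le_card[of "B - {b}" F b] deg_le_card[OF finC, of F b] F.deg_own_side[of B b] finB by simp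
  have le: "?top F \<le> ?top E" using top_E top_F by (intro sum_mono) simp
  then have bot_F: "?bot F = 0" and top_eq: "?top F = ?top E"
    using diff[OF E] diff[OF F] deg_eq bot_E by linarith+
  have A: "\<not> F a a'" if "a \<in> A" "a' \<in> A \<union> C" for a a'
  proof -
    have "deg F A a = 0" "deg F C a = 0" using bot_F that(1) finA by auto
    then show ?thesis using that(2) deg_eq_0_iff[OF finA, of F a] deg_eq_0_iff[OF finC, of F a] by blast
  qed
  have B: "F b x" if b: "b \<in> B" and x: "x \<in> (B - {b}) \<union> C" for b x
  proof -
    have "deg F B b + deg F C b = deg E B b + deg E C b"
      by (rule sum_mono_inv[OF top_eq _ b finB]) (use top_E top_F in simp)
    then have "deg F (B - {b}) b = card (B - {b})" "deg F C b = card C"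
      using top_E[OF b] deg_le_card[of "B - {b}" F b] deg_le_card[OF finC, of F b] F.deg_own_side[of B b] finB by auto
    then show ?thesis using x deg_eq_card_iff[of "B - {b}" F b] deg_eq_card_iff[OF finC, of F b] finB by auto
  qed
  show ?thesis unfolding splits_off_def using sub A B unfolding C_def by auto
qed

text \<open>
  The class of graphs obtained from sparse graphs, their complements and the 5-cycle by composition with
  splitted graphs that are thin between their sides. In contrast to the canonical decomposition the factors may be
  decomposable or empty, which makes the class closed under induced subgraphs.
\<close>
inductive assembled :: "('a \<Rightarrow> 'a \<Rightarrow> bool) \<Rightarrow> 'a set \<Rightarrow> bool" for E where
  sparse: "finite V \<Longrightarrow> (\<And>v. v \<in> V \<Longrightarrow> v \<noteq> c \<Longrightarrow> deg E V v \<le> 1) \<Longrightarrow> assembled E V"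
| dense: "finite V \<Longrightarrow> (\<And>v. v \<in> V \<Longrightarrow> v \<noteq> c \<Longrightarrow> deg (co E) V v \<le> 1) \<Longrightarrow> assembled E V"
| pentagon: "five_cycle E a b c d e \<Longrightarrow> assembled E {a, b, c, d, e}"
| compose: "finite V \<Longrightarrow> splits_off E V A B \<Longrightarrow> thin_between E A B \<Longrightarrow> assembled E (V - A - B) \<Longrightarrow> assembled E V"

lemma deg_mono: "finite V \<Longrightarrow> W \<subseteq> V \<Longrightarrow> deg E W v \<le> deg E V v"
  unfolding deg_def by (intro card_mono) auto

lemma splits_off_subset:
  assumes "splits_off E V A B" "W \<subseteq> V" shows "splits_off E W (A \<inter> W) (B \<inter> W)"
  using assms unfolding splits_off_def by auto

lemma splits_off_low:
  "splits_off E V A B \<Longrightarrow> a \<in> A \<Longrightarrow> x \<in> A \<union> (V - A - B) \<Longrightarrow> \<not> E a x"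
  unfolding splits_off_def by auto

lemma splits_off_high:
  "splits_off E V A B \<Longrightarrow> b \<in> B \<Longrightarrow> x \<in> B \<union> (V - A - B) \<Longrightarrow> x \<noteq> b \<Longrightarrow> E b x"
  unfolding splits_off_def by auto

context simple_adjacency
begin

lemma assembled_empty: "assembled E {}"
  by (rule assembled.sparse) auto

text \<open>
  A 5-cycle without the vertex \<open>a\<close> is a path, hence a split graph with the clique \<open>{c, d}\<close>, and each vertex of this clique
  has one neighbour in the independent set. Deleting further vertices only thins this out.
\<close>
lemma path_assembled:
  assumes C: "five_cycle E a b c d e" and W: "W \<subseteq> {b, c, d, e}"
  shows "assembled E W"
proof (rule assembled.compose[of _ _ "{b, e} \<inter> W" "{c, d} \<inter> W"])
  show fin: "finite W" using W finite_subset by blast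
  show "splits_off E W ({b, e} \<inter> W) ({c, d} \<inter> W)"
    using C W irrefl comm unfolding splits_off_def five_cycle_def by auto
  have "{x \<in> {b, e} \<inter> W. E x c} \<subseteq> {b}" "{x \<in> {b, e} \<inter> W. E x d} \<subseteq> {e}"
    using C comm unfolding five_cycle_def by auto
  then have "card {x \<in> {b, e} \<inter> W. E x c} \<le> 1" "card {x \<in> {b, e} \<inter> W. E x d} \<le> 1"
    using card_mono[of "{b}"] card_mono[of "{e}"] by fastforce+
  then show "thin_between E ({b, e} \<inter> W) ({c, d} \<inter> W)" unfolding thin_between_def by auto
  have e: "W - {b, e} \<inter> W - {c, d} \<inter> W = {}" using W by blast
  show "assembled E (W - {b, e} \<inter> W - {c, d} \<inter> W)" unfolding e by (rule assembled_empty)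
qed

lemma assembled_subset:
  assumes "assembled E V" "W \<subseteq> V" shows "assembled E W"
  using assms
proof (induction arbitrary: W)
  case (sparse V c)
  have "finite W" using sparse finite_subset by blast
  then show ?case
  proof (rule assembled.sparse[of _ c])
    fix v assume "v \<in> W" "v \<noteq> c"
    then show "deg E W v \<le> 1" using sparse(2)[of v] deg_mono[OF sparse(1) sparse(3), of E v] sparse(3) by auto
  qed
next
  case (dense V c)
  have "finite W" using dense finite_subset by blast
  then show ?case
  proof (rule assembled.dense[of _ c])
    fix v assume "v \<in> W" "v \<noteq> c"
    then show "deg (co E) W v \<le> 1" using dense(2)[of v] deg_mono[OF dense(1) dense(3), of "co E" v] dense(3) by auto
  qed
next
  case (pentagon a b c d e)
  note r0 = pentagon(1)
  note r1 = five_cycle_rotate[OF r0]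
  note r2 = five_cycle_rotate[OF r1]
  note r3 = five_cycle_rotate[OF r2]
  note r4 = five_cycle_rotate[OF r3]
  consider "W = {a, b, c, d, e}" | "W \<subseteq> {b, c, d, e}" | "W \<subseteq> {c, d, e, a}" | "W \<subseteq> {d, e, a, b}"
    | "W \<subseteq> {e, a, b, c}" | "W \<subseteq> {a, b, c, d}"
    using pentagon(2) by blast
  then show ?case
  proof cases
    case 1
    then show ?thesis using assembled.pentagon[OF r0] by simp
  qed (use path_assembled[OF r0] path_assembled[OF r1] path_assembled[OF r2] path_assembled[OF r3] path_assembled[OF r4] in blast)+
next
  case (compose V A B)
  have fin: "finite W" "finite A" "finite B"
    using compose(1,2,6) finite_subset unfolding splits_off_def by blast+
  have "W - A \<inter> W - B \<inter> W \<subseteq> V - A - B" using compose by blast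
  then have "assembled E (W - A \<inter> W - B \<inter> W)" by (rule compose.IH)
  then show ?case
    using assembled.compose[OF fin(1) splits_off_subset[OF compose(2,6)]]
      thin_between_subset[OF compose(3) _ _ fin(2,3)] by blast
qed

text \<open>
  In the step for compositions, \<open>splits_off_same_degrees\<close> shows that a graph \<open>F\<close> with the same degrees decomposes along the
  same sets, so isomorphisms of the factors can be glued. The isomorphism of the outer factors respects the
  sides \<open>A\<close> and \<open>B\<close>, which makes it compatible with the edges to the inner factor.
\<close>
lemma assembled_degree_determined:
  assumes "assembled E V" shows "degree_determined E V"
  using assms
proof induction
  case (sparse V c)
  then show ?case by (rule sparse_degree_determined)
next
  case (dense V c)
  interpret C: simple_adjacency "co E" by (rule simple_adjacency_co)
  show ?case by (rule degree_determined_co[OF dense(1) C.sparse_degree_determined[OF dense]])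
next
  case (pentagon a b c d e)
  then show ?case by (rule five_cycle_degree_determined)
next
  case (compose V A B)
  note so = compose(2)
  define C where "C = V - A - B"
  have sub: "A \<subseteq> V" "B \<subseteq> V" "A \<inter> B = {}" using so unfolding splits_off_def by blast+
  have fin: "finite A" "finite B" "finite C"
    using sub compose(1) finite_subset unfolding C_def by blast+
  have V: "V = A \<union> (B \<union> C)" "A \<inter> (B \<union> C) = {}" "B \<inter> C = {}" using sub unfolding C_def by blast+
  have split: "deg R V v = deg R A v + deg R B v + deg R C v" for R :: "'a \<Rightarrow> 'a \<Rightarrow> bool" and v
    unfolding V(1) using deg_union[of A "B \<union> C"] deg_union[of B C] V fin by simp
  show ?case
    unfolding degree_determined_def
  proof (intro allI impI)
    fix F assume F: "simple_adjacency F" and s: "same_degrees V E F"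
    interpret F: simple_adjacency F by (rule F)
    have soF: "splits_off F V A B"
      by (rule splits_off_same_degrees[OF simple_adjacency_axioms F compose(1) s so])
    have eqF: "deg E V v = deg F V v" if "v \<in> V" for v using s that unfolding same_degrees_def by blast
    have low: "\<not> E a x" "\<not> F a x" if "a \<in> A" "x \<in> A \<union> C" for a x
      using splits_off_low[OF so] splits_off_low[OF soF] that unfolding C_def by auto
    have high: "E b x" "F b x" if "b \<in> B" "x \<in> B \<union> C" "x \<noteq> b" for b x
      using splits_off_high[OF so] splits_off_high[OF soF] that unfolding C_def by auto
    have cross: "E u v = F u v" if "(u \<in> A \<and> v \<in> A \<union> C) \<or> (u \<in> B \<and> v \<in> B \<union> C)" for u v
    proof (cases "u = v")
      case False
      then show ?thesis using that low[of u v] high[of u v] by blast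
    qed (simp add: irrefl F.irrefl)
    have cross_deg: "deg E X v = deg F X v" if "(v \<in> A \<and> X \<subseteq> A \<union> C) \<or> (v \<in> B \<and> X \<subseteq> B \<union> C) \<or> (v \<in> C \<and> X \<subseteq> A \<union> B)" for X v
    proof -
      have "E v x = F v x" if "x \<in> X" for x
        using cross[of v x] cross[of x v] comm[of v x] F.comm[of v x] that \<open>(v \<in> A \<and> X \<subseteq> A \<union> C) \<or> (v \<in> B \<and> X \<subseteq> B \<union> C) \<or> (v \<in> C \<and> X \<subseteq> A \<union> B)\<close> by blast
      then have "{x \<in> X. E v x} = {x \<in> X. F v x}" by blast
      then show ?thesis unfolding deg_def by simp
    qed
    have degC: "deg E C v = deg F C v" if "v \<in> C" for v
      using eqF[of v] split[of E v] split[of F v] cross_deg[of v A] cross_deg[of v B] that V(1) by auto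
    then obtain k where k: "bij_betw k C C" "\<And>u v. u \<in> C \<Longrightarrow> v \<in> C \<Longrightarrow> E u v \<longleftrightarrow> F (k u) (k v)"
      using compose.IH F unfolding degree_determined_def same_degrees_def iso_on_def C_def by blast
    have degA: "deg E B a = deg F B a" if "a \<in> A" for a
      using eqF[of a] split[of E a] split[of F a] cross_deg[of a A] cross_deg[of a C] that V(1) by auto
    have degB: "deg E A b = deg F A b" if "b \<in> B" for b
      using eqF[of b] split[of E b] split[of F b] cross_deg[of b B] cross_deg[of b C] that V(1) by auto
    have cols: "card {a \<in> A. E a b} = card {a \<in> A. F a b}" if "b \<in> B" for b
      using degB[OF that] unfolding deg_def by (simp add: comm[of b] F.comm[of b])
    have rows: "card {b \<in> B. E a b} = card {b \<in> B. F a b}" if "a \<in> A" for a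
      using degA[OF that] unfolding deg_def .
    obtain g h where g: "bij_betw g A A" and h: "bij_betw h B B" and gh: "\<And>a b. a \<in> A \<Longrightarrow> b \<in> B \<Longrightarrow> E a b \<longleftrightarrow> F (g a) (h b)"
      using thin_between_iso[OF fin(1,2) cols rows compose(3)] by blast
    define f where "f v = (if v \<in> A then g v else if v \<in> B then h v else k v)" for v
    have fA: "bij_betw f A A" using g by (rule bij_betw_cong[THEN iffD1, rotated]) (simp add: f_def)
    have fB: "bij_betw f B B" using h by (rule bij_betw_cong[THEN iffD1, rotated]) (use sub(3) in \<open>auto simp: f_def\<close>)
    have fC: "bij_betw f C C" using k(1) by (rule bij_betw_cong[THEN iffD1, rotated]) (auto simp: f_def C_def)
    have bij: "bij_betw f V V"
      using bij_betw_combine[OF fA bij_betw_combine[OF fB fC V(3)] V(2)] V(1) by simp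
    have inA: "f v \<in> A" if "v \<in> A" for v using fA that unfolding bij_betw_def by blast
    have inB: "f v \<in> B" if "v \<in> B" for v using fB that unfolding bij_betw_def by blast
    have inC: "f v \<in> C" if "v \<in> C" for v using fC that unfolding bij_betw_def by blast
    have inj: "f u = f v \<longleftrightarrow> u = v" if "u \<in> V" "v \<in> V" for u v
      using bij that unfolding bij_betw_def inj_on_def by blast
    have AB: "E a b \<longleftrightarrow> F (f a) (f b)" if "a \<in> A" "b \<in> B" for a b
      using gh[OF that] that sub(3) unfolding f_def by auto
    have "E u v \<longleftrightarrow> F (f u) (f v)" if uv: "u \<in> V" "v \<in> V" for u v
    proof (cases "u = v")
      case True
      then show ?thesis by (simp add: irrefl F.irrefl)
    next
      case False
      then have ne: "f u \<noteq> f v" using inj[OF uv] by blast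
      consider "u \<in> A" "v \<in> A \<union> C" | "u \<in> A" "v \<in> B" | "u \<in> B" "v \<in> A" | "u \<in> B" "v \<in> B \<union> C"
        | "u \<in> C" "v \<in> A" | "u \<in> C" "v \<in> B" | "u \<in> C" "v \<in> C" using uv V(1) by blast
      then show ?thesis
      proof cases
        case 1
        then show ?thesis using low(1)[OF 1] low(2)[OF inA, of u "f v"] inA[of v] inC[of v] by blast
      next
        case 2
        then show ?thesis by (rule AB)
      next
        case 3
        then show ?thesis using AB[OF 3(2,1)] comm[of u v] F.comm[of "f u" "f v"] by blast
      next
        case 4
        then show ?thesis using high(1)[OF 4] high(2)[OF inB, of u "f v"] inB[of v] inC[of v] False ne by auto
      next
        case 5
        then show ?thesis using low(1)[OF 5(2), of u] low(2)[OF inA, of v "f u"] inC[of u] comm[of u v] F.comm[of "f u" "f v"] by blast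
      next
        case 6
        then show ?thesis using high(1)[OF 6(2), of u] high(2)[OF inB, of v "f u"] inC[of u] False ne comm[of u v] F.comm[of "f u" "f v"] by auto
      next
        case 7
        then show ?thesis using k(2)[OF 7] unfolding f_def C_def by simp
      qed
    qed
    then show "iso_on V E F" using bij unfolding iso_on_def by blast
  qed
qed

end

section \<open>Graphs, isomorphisms and unigraphs\<close>

lemma deg_cong: "(\<And>u. u \<in> V \<Longrightarrow> E v u \<longleftrightarrow> F v u) \<Longrightarrow> deg E V v = deg F V v"
  unfolding deg_def by (rule arg_cong[of _ _ card]) auto

lemma balanced_cong:
  assumes "balanced E V" "\<And>u v. u \<in> V \<Longrightarrow> v \<in> V \<Longrightarrow> E u v \<longleftrightarrow> F u v"
  shows "balanced F V"
  unfolding balanced_def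
proof (intro allI impI ballI, elim conjE)
  fix W x y z w
  assume W: "W \<subseteq> V" and v: "x \<in> W" "y \<in> W" "z \<in> W" "w \<in> W" and e: "F x y" "co F y z" "F z w" "co F w x"
  have "deg E W u = deg F W u" if "u \<in> W" for u using assms(2) W that by (intro deg_cong) auto
  moreover have "E x y" "co E y z" "E z w" "co E w x" using e assms(2) v W unfolding co_def by auto
  then have "deg E W x = deg E W z \<or> deg E W y = deg E W w"
    using assms(1)[unfolded balanced_def, rule_format, OF W v] by blast
  ultimately show "deg F W x = deg F W z \<or> deg F W y = deg F W w" using v by simp
qed

lemma splits_off_cong:
  assumes "\<And>u v. u \<in> V \<Longrightarrow> v \<in> V \<Longrightarrow> E u v \<longleftrightarrow> F u v" "splits_off E V A B"
  shows "splits_off F V A B"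
  using assms unfolding splits_off_def by (auto simp: subset_iff)

lemma thin_between_cong:
  assumes "\<And>a b. a \<in> A \<Longrightarrow> b \<in> B \<Longrightarrow> R a b \<longleftrightarrow> S a b" "thin_between R A B"
  shows "thin_between S A B"
proof -
  have "{a \<in> A. R a b} = {a \<in> A. S a b}" "{a \<in> A. \<not> R a b} = {a \<in> A. \<not> S a b}" if "b \<in> B" for b
    using assms(1) that by blast+
  moreover have "{b \<in> B. R a b} = {b \<in> B. S a b}" "{b \<in> B. \<not> R a b} = {b \<in> B. \<not> S a b}" if "a \<in> A" for a
    using assms(1) that by blast+
  ultimately show ?thesis using assms(2) unfolding thin_between_def by simp
qed

lemma assembled_cong:
  assumes "assembled E V" "\<And>u v. u \<in> V \<Longrightarrow> v \<in> V \<Longrightarrow> E u v \<longleftrightarrow> F u v"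
  shows "assembled F V"
  using assms
proof induction
  case (sparse V c)
  show ?case
  proof (rule assembled.sparse[OF sparse(1), of c])
    fix v assume v: "v \<in> V" "v \<noteq> c"
    have "deg E V v = deg F V v" using sparse(3) v by (intro deg_cong) auto
    then show "deg F V v \<le> 1" using sparse(2)[OF v] by simp
  qed
next
  case (dense V c)
  show ?case
  proof (rule assembled.dense[OF dense(1), of c])
    fix v assume v: "v \<in> V" "v \<noteq> c"
    have "deg (co E) V v = deg (co F) V v" using dense(3) v by (intro deg_cong) (auto simp: co_def)
    then show "deg (co F) V v \<le> 1" using dense(2)[OF v] by simp
  qed
next
  case (pentagon a b c d e)
  then have "five_cycle F a b c d e" unfolding five_cycle_def by simp
  then show ?case by (rule assembled.pentagon)
next
  case (compose V A B)
  have sub: "A \<subseteq> V" "B \<subseteq> V" using compose(2) unfolding splits_off_def by blast+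
  have "splits_off F V A B" by (rule splits_off_cong[OF compose.prems compose(2)])
  moreover have "thin_between F A B"
    by (rule thin_between_cong[OF compose.prems compose(3)]) (use sub in auto)
  moreover have "assembled F (V - A - B)" using compose.prems by (intro compose.IH) auto
  ultimately show ?case by (rule assembled.compose[OF compose(1)])
qed

lemma degree_determined_cong:
  assumes "degree_determined E V" "\<And>u v. u \<in> V \<Longrightarrow> v \<in> V \<Longrightarrow> E u v \<longleftrightarrow> F u v"
  shows "degree_determined F V"
proof -
  have "deg E V v = deg F V v" if "v \<in> V" for v
  proof -
    have "{u \<in> V. E v u} = {u \<in> V. F v u}" using assms(2) that by blast
    then show ?thesis unfolding deg_def by simp
  qed
  then show ?thesis using assms unfolding degree_determined_def same_degrees_def iso_on_def by simp
qed

definition adj :: "'a pair_pre_digraph \<Rightarrow> 'a \<Rightarrow> 'a \<Rightarrow> bool" where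
  "adj G u v \<longleftrightarrow> (u, v) \<in> parcs G"

lemma pair_graph_iff:
  "pair_graph G \<longleftrightarrow> finite (pverts G) \<and> simple_adjacency (adj G) \<and> parcs G \<subseteq> pverts G \<times> pverts G"
proof
  assume "pair_graph G"
  then interpret pair_graph G .
  have "simple_adjacency (adj G)"
  proof
    show "adj G u v \<Longrightarrow> adj G v u" for u v
      unfolding adj_def by (rule arcs_symmetric)
    show "\<not> adj G u u" for u
      unfolding adj_def using pair_no_loops by fastforce
  qed
  then show "finite (pverts G) \<and> simple_adjacency (adj G) \<and> parcs G \<subseteq> pverts G \<times> pverts G"
    using pair_finite_verts in_arcsD1 in_arcsD2 by auto
next
  assume a: "finite (pverts G) \<and> simple_adjacency (adj G) \<and> parcs G \<subseteq> pverts G \<times> pverts G"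
  then interpret S: simple_adjacency "adj G" by blast
  have f: "finite (parcs G)" using a finite_subset[of "parcs G" "pverts G \<times> pverts G"] by blast
  have "symmetric (with_proj G)"
    unfolding symmetric_def using S.sym unfolding adj_def by (auto intro: symI)
  then show "pair_graph G"
    using a f S.irrefl unfolding adj_def by unfold_locales auto
qed

lemma out_degree_eq_deg:
  assumes "pair_graph G"
  shows "out_degree (with_proj G) v = deg (adj G) (pverts G) v"
proof -
  have "out_arcs (with_proj G) v = Pair v ` {u \<in> pverts G. adj G v u}"
    using assms unfolding pair_graph_iff adj_def out_arcs_def by auto
  then show ?thesis unfolding out_degree_def deg_def by (simp add: card_image inj_on_def)
qed

lemma mset_degree_sequence:
  assumes "pair_graph G"
  shows "mset (degree_sequence G) = image_mset (deg (adj G) (pverts G)) (mset_set (pverts G))"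
proof -
  have "out_degree (with_proj G) = deg (adj G) (pverts G)" using out_degree_eq_deg[OF assms] by blast
  then show ?thesis unfolding degree_sequence_def by simp
qed

lemma degree_sequence_eqI:
  assumes "pair_graph G" "mset L = image_mset (deg (adj G) (pverts G)) (mset_set (pverts G))" "sorted (rev L)"
  shows "degree_sequence G = L"
proof -
  have "sorted_list_of_multiset (mset (degree_sequence G)) = rev L"
    unfolding mset_degree_sequence[OF assms(1)] assms(2)[symmetric]
    by (metis assms(3) mset_rev sorted_list_of_multiset_mset sorted_sort_id)
  then have "rev (degree_sequence G) = rev L"
    unfolding degree_sequence_def by (simp add: sorted_sort_id)
  then show ?thesis by simp
qed

lemma length_degree_sequence:
  assumes "pair_graph G" shows "length (degree_sequence G) = card (pverts G)"
  using arg_cong[OF mset_degree_sequence[OF assms], of size] by simp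

lemma digraph_iso_iff:
  assumes "pair_graph H" "pair_graph G"
  shows "digraph_iso (with_proj H) (with_proj G) \<longleftrightarrow>
    (\<exists>g. bij_betw g (pverts H) (pverts G) \<and>
      (\<forall>u\<in>pverts H. \<forall>v\<in>pverts H. adj H u v \<longleftrightarrow> adj G (g u) (g v)))"
    (is "_ \<longleftrightarrow> ?R")
proof
  have arcsH: "u \<in> pverts H \<and> v \<in> pverts H" if "(u, v) \<in> parcs H" for u v
    using assms(1) that unfolding pair_graph_iff by auto
  have arcsG: "u \<in> pverts G \<and> v \<in> pverts G" if "(u, v) \<in> parcs G" for u v
    using assms(2) that unfolding pair_graph_iff by auto
  interpret H: pair_graph H by (rule assms(1))
  {
    assume "digraph_iso (with_proj H) (with_proj G)"
    then obtain f where f: "H.digraph_isomorphism f" "with_proj G = app_iso f (with_proj H)"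
      unfolding digraph_iso_def by blast
    let ?g = "iso_verts f"
    have V: "pverts G = ?g ` pverts H" using arg_cong[OF f(2), of verts] by simp
    have P: "parcs G = iso_arcs f ` parcs H" using arg_cong[OF f(2), of arcs] by simp
    have t: "iso_tail f = fst" "iso_head f = snd"
      using arg_cong[OF f(2), of tail] arg_cong[OF f(2), of head] by simp_all
    have inj: "inj_on ?g (pverts H)" using H.digraph_isomorphism_inj_on_verts[OF f(1)] by simp
    have e: "iso_arcs f (u, v) = (?g u, ?g v)" if "(u, v) \<in> parcs H" for u v
      using H.iso_verts_tail[OF f(1)] H.iso_verts_head[OF f(1)] that t by (metis fst_conv prod.collapse snd_conv)
    have "adj H u v \<longleftrightarrow> adj G (?g u) (?g v)" if uv: "u \<in> pverts H" "v \<in> pverts H" for u v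
    proof
      show "adj H u v \<Longrightarrow> adj G (?g u) (?g v)" using e unfolding adj_def P by (metis imageI)
    next
      assume "adj G (?g u) (?g v)"
      then obtain u' v' where a: "(u', v') \<in> parcs H" "(?g u, ?g v) = (?g u', ?g v')"
        unfolding adj_def P using e by auto
      then have "u' = u" "v' = v" using inj arcsH[OF a(1)] uv unfolding inj_on_def by auto
      then show "adj H u v" using a(1) unfolding adj_def by simp
    qed
    then show ?R using inj V unfolding bij_betw_def by blast
  }
  {
    assume ?R
    then obtain g where g: "bij_betw g (pverts H) (pverts G)"
      "\<And>u v. u \<in> pverts H \<Longrightarrow> v \<in> pverts H \<Longrightarrow> adj H u v \<longleftrightarrow> adj G (g u) (g v)" by blast
    define f where "f = \<lparr> iso_verts = g, iso_arcs = map_prod g g, iso_head = snd, iso_tail = fst \<rparr>"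
    have inj: "inj_on g (pverts H)" and img: "g ` pverts H = pverts G" using g(1) unfolding bij_betw_def by blast+
    have "inj_on (map_prod g g) (parcs H)"
      by (rule inj_on_subset[OF map_prod_inj_on[OF inj inj]]) (use arcsH in auto)
    then have "H.digraph_isomorphism f"
      unfolding H.digraph_isomorphism_def f_def using inj H.wf_digraph by auto
    moreover have "map_prod g g ` parcs H = parcs G"
    proof (intro equalityI subsetI)
      fix e assume "e \<in> map_prod g g ` parcs H"
      then show "e \<in> parcs G" using g(2) arcsH unfolding adj_def by auto
    next
      fix e assume e: "e \<in> parcs G"
      obtain x y where xy: "e = (x, y)" by (cases e)
      then have "x \<in> g ` pverts H" "y \<in> g ` pverts H" using arcsG e img by auto
      then obtain u v where "u \<in> pverts H" "v \<in> pverts H" "x = g u" "y = g v" by blast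
      then show "e \<in> map_prod g g ` parcs H" using g(2)[of u v] e xy unfolding adj_def by force
    qed
    then have "with_proj G = app_iso f (with_proj H)"
      using img unfolding f_def app_iso_def with_proj_def by simp
    ultimately show "digraph_iso (with_proj H) (with_proj G)" unfolding digraph_iso_def by blast
  }
qed

lemma unigraph_if_degree_determined:
  fixes G :: "'a pair_pre_digraph"
  assumes G: "pair_graph G" and det: "degree_determined (adj G) (pverts G)"
  shows "unigraph G"
  unfolding unigraph_def
proof (intro conjI allI impI)
  fix H :: "'a pair_pre_digraph"
  assume H: "pair_graph H" and ds: "degree_sequence H = degree_sequence G"
  let ?V = "pverts G" and ?W = "pverts H"
  have fin: "finite ?V" "finite ?W" using G H unfolding pair_graph_iff by auto
  have "card ?V = card ?W" using length_degree_sequence[OF G] length_degree_sequence[OF H] ds by simp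
  then obtain t where t: "bij_betw t ?V ?W" using finite_same_card_bij[OF fin] by blast
  have "image_mset (\<lambda>v. deg (adj H) ?W (t v)) (mset_set ?V) = image_mset (deg (adj H) ?W) (image_mset t (mset_set ?V))"
    by (simp add: image_mset.compositionality comp_def)
  also have "image_mset t (mset_set ?V) = mset_set ?W"
    using t image_mset_mset_set[of t ?V] unfolding bij_betw_def by simp
  finally have "image_mset (\<lambda>v. deg (adj H) ?W (t v)) (mset_set ?V) = image_mset (deg (adj G) ?V) (mset_set ?V)"
    using mset_degree_sequence[OF G] mset_degree_sequence[OF H] ds by simp
  then obtain p where p: "p permutes ?V" "\<forall>v\<in>?V. deg (adj G) ?V v = deg (adj H) ?W (t (p v))"
    using image_mset_eq_implies_permutes[OF fin(1), of "deg (adj G) ?V" "\<lambda>v. deg (adj H) ?W (t v)"] by metis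
  \<comment> \<open>The map \<open>s\<close> preserves degrees, so pulling \<open>H\<close> back along it gives a graph with the same degree as \<open>G\<close> at each vertex.\<close>
  define s where "s = t \<circ> p"
  have s: "bij_betw s ?V ?W" using bij_betw_trans[OF permutes_imp_bij[OF p(1)] t] unfolding s_def .
  define F where "F u v \<longleftrightarrow> u \<in> ?V \<and> v \<in> ?V \<and> adj H (s u) (s v)" for u v
  interpret H: simple_adjacency "adj H" using H unfolding pair_graph_iff by blast
  have F: "simple_adjacency F" by standard (auto simp: F_def H.comm H.irrefl)
  have "deg F ?V v = deg (adj H) ?W (s v)" if v: "v \<in> ?V" for v
  proof -
    have "{u \<in> ?W. adj H (s v) u} = s ` {u \<in> ?V. F v u}"
      using s v unfolding F_def bij_betw_def by auto
    moreover have "inj_on s {u \<in> ?V. F v u}" using s unfolding bij_betw_def by (auto intro: inj_on_subset)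
    ultimately show ?thesis unfolding deg_def by (simp add: card_image)
  qed
  then have "same_degrees ?V (adj G) F" using p(2) unfolding same_degrees_def s_def by simp
  then obtain f where f: "bij_betw f ?V ?V" "\<And>u v. u \<in> ?V \<Longrightarrow> v \<in> ?V \<Longrightarrow> adj G u v \<longleftrightarrow> F (f u) (f v)"
    using det F unfolding degree_determined_def iso_on_def by blast
  have fV: "f v \<in> ?V" if "v \<in> ?V" for v using f(1) that unfolding bij_betw_def by blast
  define k where "k = s \<circ> f"
  have k: "bij_betw k ?V ?W" using bij_betw_trans[OF f(1) s] unfolding k_def .
  have kadj: "adj G u v \<longleftrightarrow> adj H (k u) (k v)" if "u \<in> ?V" "v \<in> ?V" for u v
    using f(2)[OF that] fV that unfolding F_def k_def by simp
  define g where "g = inv_into ?V k"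
  have g: "bij_betw g ?W ?V" unfolding g_def by (rule bij_betw_inv_into[OF k])
  have "adj H u v \<longleftrightarrow> adj G (g u) (g v)" if "u \<in> ?W" "v \<in> ?W" for u v
  proof -
    have "g u \<in> ?V" "g v \<in> ?V" using g that unfolding bij_betw_def by blast+
    moreover have "k (g u) = u" "k (g v) = v"
      using bij_betw_inv_into_right[OF k] that unfolding g_def by auto
    ultimately show ?thesis using kadj[of "g u" "g v"] by simp
  qed
  then show "digraph_iso (with_proj H) (with_proj G)" using g digraph_iso_iff[OF H G] by blast
qed (rule G)

text \<open>
  Let \<open>H\<close> arise by exchanging the edges \<open>xy\<close>, \<open>zw\<close> for \<open>yz\<close>, \<open>wx\<close>. It has the same degrees $d$, so it is isomorphic to
  \<open>G\<close>, and the sum of $d(u)d(v)$ over all arcs, an isomorphism invariant, is the same for both graphs. But the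
  exchange lowers it by $2(d(x) - d(z))(d(y) - d(w))$.
\<close>
lemma unigraph_no_unbalanced_switch:
  fixes G :: "'a pair_pre_digraph"
  assumes uni: "unigraph G" and V: "x \<in> pverts G" "y \<in> pverts G" "z \<in> pverts G" "w \<in> pverts G"
    and e: "adj G x y" "co (adj G) y z" "adj G z w" "co (adj G) w x"
  shows "deg (adj G) (pverts G) x = deg (adj G) (pverts G) z \<or> deg (adj G) (pverts G) y = deg (adj G) (pverts G) w"
proof -
  have G: "pair_graph G" using uni unfolding unigraph_def by blast
  interpret E: simple_adjacency "adj G" using G unfolding pair_graph_iff by blast
  let ?V = "pverts G" and ?d = "deg (adj G) (pverts G)"
  have fin: "finite ?V" and finP: "finite (parcs G)" using G finite_subset[of "parcs G" "?V \<times> ?V"] unfolding pair_graph_iff by auto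
  have ne: "x \<noteq> y" "z \<noteq> w" "y \<noteq> z" "w \<noteq> x" "x \<noteq> z" "y \<noteq> w"
    using e E.irrefl E.comm unfolding co_def by blast+
  have arcs: "(x, y) \<in> parcs G" "(y, x) \<in> parcs G" "(z, w) \<in> parcs G" "(w, z) \<in> parcs G"
    "(y, z) \<notin> parcs G" "(z, y) \<notin> parcs G" "(w, x) \<notin> parcs G" "(x, w) \<notin> parcs G"
    using e E.comm unfolding co_def adj_def by blast+
  define Old New where "Old = {(x, y), (y, x), (z, w), (w, z)}" and "New = {(y, z), (z, y), (w, x), (x, w)}"
  define H where "H = \<lparr> pverts = ?V, parcs = (parcs G - Old) \<union> New \<rparr>"
  have adjH: "adj H u v \<longleftrightarrow> (adj G u v \<and> (u, v) \<notin> Old) \<or> (u, v) \<in> New" for u v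
    unfolding adj_def H_def by simp
  have VH: "pverts H = ?V" unfolding H_def by simp
  have "simple_adjacency (adj H)"
  proof
    fix u v
    show "adj H u v \<Longrightarrow> adj H v u" unfolding adjH Old_def New_def using E.sym by auto
    show "\<not> adj H u u" unfolding adjH New_def using E.irrefl ne by auto
  qed
  then have H: "pair_graph H"
    using G V unfolding pair_graph_iff VH unfolding H_def New_def by auto
  have same: "deg (adj H) ?V v = ?d v" for v
  proof -
    have swap: "card (S - {a} \<union> {b}) = card S" if "a \<in> S" "b \<notin> S" "finite S" for S :: "'a set" and a b
      using that card_Suc_Diff1[of S a] by simp
    have f: "finite {u \<in> ?V. adj G v u}" for v using fin by simp
    consider "v = x" | "v = y" | "v = z" | "v = w" | "v \<notin> {x, y, z, w}" by blast
    then show ?thesis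
    proof cases
      case 1
      have "{u \<in> ?V. adj H v u} = {u \<in> ?V. adj G v u} - {y} \<union> {w}"
        unfolding adjH Old_def New_def using 1 ne V by auto
      then show ?thesis unfolding deg_def using swap[OF _ _ f, of y v w] 1 V arcs unfolding adj_def by simp
    next
      case 2
      have "{u \<in> ?V. adj H v u} = {u \<in> ?V. adj G v u} - {x} \<union> {z}"
        unfolding adjH Old_def New_def using 2 ne V by auto
      then show ?thesis unfolding deg_def using swap[OF _ _ f, of x v z] 2 V arcs unfolding adj_def by simp
    next
      case 3
      have "{u \<in> ?V. adj H v u} = {u \<in> ?V. adj G v u} - {w} \<union> {y}"
        unfolding adjH Old_def New_def using 3 ne V by auto
      then show ?thesis unfolding deg_def using swap[OF _ _ f, of w v y] 3 V arcs unfolding adj_def by simp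
    next
      case 4
      have "{u \<in> ?V. adj H v u} = {u \<in> ?V. adj G v u} - {z} \<union> {x}"
        unfolding adjH Old_def New_def using 4 ne V by auto
      then show ?thesis unfolding deg_def using swap[OF _ _ f, of z v x] 4 V arcs unfolding adj_def by simp
    next
      case 5
      have "{u \<in> ?V. adj H v u} = {u \<in> ?V. adj G v u}"
        unfolding adjH Old_def New_def using 5 by auto
      then show ?thesis unfolding deg_def by simp
    qed
  qed
  have "degree_sequence H = degree_sequence G"
    unfolding degree_sequence_def VH
    by (intro arg_cong[of _ _ "\<lambda>M. rev (sorted_list_of_multiset M)"] image_mset_cong)
      (simp add: out_degree_eq_deg[OF G] out_degree_eq_deg[OF H] VH same)
  then have "digraph_iso (with_proj H) (with_proj G)" using uni H unfolding unigraph_def by blast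
  then obtain g where g: "bij_betw g ?V ?V" "\<And>u v. u \<in> ?V \<Longrightarrow> v \<in> ?V \<Longrightarrow> adj H u v \<longleftrightarrow> adj G (g u) (g v)"
    unfolding digraph_iso_iff[OF H G] VH by blast
  have inj: "inj_on g ?V" and img: "g ` ?V = ?V" using g(1) unfolding bij_betw_def by blast+
  have dg: "?d (g v) = ?d v" if v: "v \<in> ?V" for v
  proof -
    have "{u \<in> ?V. adj G (g v) u} = g ` {u \<in> ?V. adj H v u}"
    proof (intro equalityI subsetI)
      fix u assume u: "u \<in> {u \<in> ?V. adj G (g v) u}"
      then obtain u' where "u' \<in> ?V" "u = g u'" using img by blast
      then show "u \<in> g ` {u \<in> ?V. adj H v u}" using g(2)[OF v] u by blast
    next
      fix u assume "u \<in> g ` {u \<in> ?V. adj H v u}"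
      then show "u \<in> {u \<in> ?V. adj G (g v) u}" using g(2)[OF v] img by blast
    qed
    moreover have "inj_on g {u \<in> ?V. adj H v u}" using inj by (rule inj_on_subset) blast
    ultimately have "?d (g v) = deg (adj H) ?V v" unfolding deg_def by (simp add: card_image)
    then show ?thesis using same by simp
  qed
  \<comment> \<open>Integers, because the difference of the two sums is factorized below.\<close>
  let ?m = "\<lambda>(u, v). int (?d u) * int (?d v)"
  have subH: "parcs H \<subseteq> ?V \<times> ?V" using H VH unfolding pair_graph_iff by simp
  have subG: "parcs G \<subseteq> ?V \<times> ?V" using G unfolding pair_graph_iff by simp
  have "map_prod g g ` parcs H = parcs G"
  proof (intro equalityI subsetI)
    fix a assume "a \<in> map_prod g g ` parcs H"
    then show "a \<in> parcs G" using g(2) subH unfolding adj_def by auto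
  next
    fix a assume a: "a \<in> parcs G"
    then have "fst a \<in> g ` ?V" "snd a \<in> g ` ?V" using subG img by auto
    then obtain u v where "u \<in> ?V" "v \<in> ?V" "a = (g u, g v)" by (cases a) auto
    then show "a \<in> map_prod g g ` parcs H" using g(2)[of u v] a unfolding adj_def by force
  qed
  moreover have "inj_on (map_prod g g) (parcs H)"
    by (rule inj_on_subset[OF map_prod_inj_on[OF inj inj] subH])
  ultimately have "sum ?m (parcs G) = (\<Sum>a\<in>parcs H. ?m (map_prod g g a))"
    using sum.reindex[of "map_prod g g" "parcs H" ?m] by (simp add: comp_def)
  also have "\<dots> = sum ?m (parcs H)" by (rule sum.cong[OF refl]) (use subH dg in auto)
  also have "\<dots> = sum ?m (parcs G - Old) + sum ?m New"
  proof -
    have "(parcs G - Old) \<inter> New = {}" using arcs unfolding New_def by auto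
    moreover have "parcs H = (parcs G - Old) \<union> New" unfolding H_def by simp
    moreover have "finite New" unfolding New_def by simp
    ultimately show ?thesis using finP sum.union_disjoint[of "parcs G - Old" New ?m] by simp
  qed
  also have "sum ?m (parcs G - Old) = sum ?m (parcs G) - sum ?m Old"
    by (rule sum_diff[OF finP]) (use arcs in \<open>auto simp: Old_def\<close>)
  finally have "sum ?m Old = sum ?m New" by simp
  moreover have "sum ?m Old = 2 * int (?d x) * int (?d y) + 2 * int (?d z) * int (?d w)"
    unfolding Old_def using ne by simp
  moreover have "sum ?m New = 2 * int (?d y) * int (?d z) + 2 * int (?d w) * int (?d x)"
    unfolding New_def using ne by simp
  ultimately have "(int (?d x) - int (?d z)) * (int (?d y) - int (?d w)) = 0" by (simp add: algebra_simps)
  then show ?thesis by simp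
qed

definition induce :: "'a pair_pre_digraph \<Rightarrow> 'a set \<Rightarrow> 'a pair_pre_digraph" where
  "induce G W = \<lparr> pverts = W, parcs = parcs G \<inter> W \<times> W \<rparr>"

lemma adj_induce: "adj (induce G W) u v \<longleftrightarrow> u \<in> W \<and> v \<in> W \<and> adj G u v"
  unfolding adj_def induce_def by auto

lemma pverts_induce [simp]: "pverts (induce G W) = W"
  unfolding induce_def by simp

lemma pair_graph_induce:
  assumes "pair_graph G" "W \<subseteq> pverts G" shows "pair_graph (induce G W)"
proof -
  interpret E: simple_adjacency "adj G" using assms unfolding pair_graph_iff by blast
  have "simple_adjacency (adj (induce G W))" by standard (auto simp: adj_induce E.comm E.irrefl)
  then show ?thesis using assms finite_subset unfolding pair_graph_iff by (auto simp: induce_def)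
qed

lemma induced_subgraph_iff:
  assumes "pair_graph G"
  shows "induced_subgraph (with_proj H) (with_proj G) \<longleftrightarrow> (\<exists>W\<subseteq>pverts G. H = induce G W)"
proof
  assume h: "induced_subgraph (with_proj H) (with_proj G)"
  then have "pverts H \<subseteq> pverts G" unfolding induced_subgraph_def subgraph_def by simp
  moreover have p: "parcs H = {e \<in> parcs G. fst e \<in> pverts H \<and> snd e \<in> pverts H}"
    using h unfolding induced_subgraph_def by simp
  have "parcs H = parcs G \<inter> pverts H \<times> pverts H" by (subst p) auto
  then have "H = induce G (pverts H)" unfolding induce_def by (intro pair_pre_digraph.equality) auto
  ultimately show "\<exists>W\<subseteq>pverts G. H = induce G W" by blast
next
  assume "\<exists>W\<subseteq>pverts G. H = induce G W"
  then obtain W where W: "W \<subseteq> pverts G" "H = induce G W" by blast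
  interpret G: pair_graph G by (rule assms)
  interpret I: pair_graph "induce G W" by (rule pair_graph_induce[OF assms W(1)])
  show "induced_subgraph (with_proj H) (with_proj G)"
    unfolding induced_subgraph_def subgraph_def compatible_def
    using W G.wf_digraph I.wf_digraph by (auto simp: induce_def)
qed

lemma hereditary_unigraph_balanced:
  assumes "hereditary_unigraph G" shows "balanced (adj G) (pverts G)"
  unfolding balanced_def
proof (intro allI impI ballI, elim conjE)
  fix W x y z w
  assume W: "W \<subseteq> pverts G" and v: "x \<in> W" "y \<in> W" "z \<in> W" "w \<in> W"
    and e: "adj G x y" "co (adj G) y z" "adj G z w" "co (adj G) w x"
  have G: "pair_graph G" using assms unfolding hereditary_unigraph_def by blast
  have "unigraph (induce G W)"
    using assms W induced_subgraph_iff[OF G] unfolding hereditary_unigraph_def by blast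
  from unigraph_no_unbalanced_switch[OF this, of x y z w]
  have "deg (adj (induce G W)) W x = deg (adj (induce G W)) W z \<or> deg (adj (induce G W)) W y = deg (adj (induce G W)) W w"
    using v e by (simp add: adj_induce co_def)
  moreover have "deg (adj (induce G W)) W u = deg (adj G) W u" if "u \<in> W" for u
    unfolding deg_def using that by (auto simp: adj_induce intro: arg_cong[of _ _ card])
  ultimately show "deg (adj G) W x = deg (adj G) W z \<or> deg (adj G) W y = deg (adj G) W w"
    using v by simp
qed

lemma assembled_hereditary_unigraph:
  assumes G: "pair_graph G" and "assembled (adj G) (pverts G)"
  shows "hereditary_unigraph G"
  unfolding hereditary_unigraph_def
proof (intro conjI allI impI)
  fix H assume "induced_subgraph (with_proj H) (with_proj G)"
  then obtain W where W: "W \<subseteq> pverts G" "H = induce G W" using induced_subgraph_iff[OF G] by blast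
  interpret E: simple_adjacency "adj G" using G unfolding pair_graph_iff by blast
  have "degree_determined (adj G) W"
    by (rule E.assembled_degree_determined[OF E.assembled_subset[OF assms(2) W(1)]])
  then have "degree_determined (adj (induce G W)) W"
    by (rule degree_determined_cong) (simp add: adj_induce)
  then show "unigraph H"
    using unigraph_if_degree_determined[OF pair_graph_induce[OF G W(1)]] W(2) by simp
qed (rule G)

section \<open>Compositions and canonical decompositions\<close>

lemma adj_composition:
  "adj (composition (G, A, B) H) u v \<longleftrightarrow>
     adj G u v \<or> adj H u v \<or> u \<in> B \<and> v \<in> pverts H \<or> u \<in> pverts H \<and> v \<in> B"
  unfolding adj_def by auto

lemma adj_in_pverts: "pair_graph G \<Longrightarrow> adj G u v \<Longrightarrow> u \<in> pverts G \<and> v \<in> pverts G"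
  unfolding pair_graph_iff adj_def by auto

lemma splitted_graph_iff:
  "splitted_graph (G, A, B) \<longleftrightarrow> pair_graph G \<and> A \<union> B = pverts G \<and> splits_off (adj G) (pverts G) A B"
proof
  assume s: "splitted_graph (G, A, B)"
  then have "pverts G - A - B = {}" by auto
  then show "pair_graph G \<and> A \<union> B = pverts G \<and> splits_off (adj G) (pverts G) A B"
    using s unfolding splitted_graph.simps splits_off_def independent_set_def clique_def adj_def by auto
next
  assume "pair_graph G \<and> A \<union> B = pverts G \<and> splits_off (adj G) (pverts G) A B"
  then show "splitted_graph (G, A, B)"
    unfolding splitted_graph.simps splits_off_def independent_set_def clique_def adj_def by auto
qed

lemma splitted_graphD:
  assumes "splitted_graph (G, A, B)"
  shows "pair_graph G" "A \<union> B = pverts G" "splits_off (adj G) (pverts G) A B" "A \<inter> B = {}" "finite A" "finite B"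
    "simple_adjacency (adj G)"
proof -
  show s: "pair_graph G" "A \<union> B = pverts G" "splits_off (adj G) (pverts G) A B"
    using assms unfolding splitted_graph_iff by auto
  then show "A \<inter> B = {}" "simple_adjacency (adj G)" unfolding splits_off_def pair_graph_iff by blast+
  show "finite A" "finite B" using s(1,2) unfolding pair_graph_iff by (metis finite_Un)+
qed

lemma composition_properties:
  assumes S: "splitted_graph (G, A, B)" and H: "pair_graph H" and disj: "pverts G \<inter> pverts H = {}"
  defines "F \<equiv> composition (G, A, B) H"
  shows "pair_graph F" "pverts F = pverts G \<union> pverts H" "splits_off (adj F) (pverts F) A B"
    "pverts F - A - B = pverts H" "A \<union> B = pverts G"
    "\<And>u v. u \<in> pverts G \<Longrightarrow> v \<in> pverts G \<Longrightarrow> adj F u v \<longleftrightarrow> adj G u v"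
    "\<And>u v. u \<in> pverts H \<Longrightarrow> v \<in> pverts H \<Longrightarrow> adj F u v \<longleftrightarrow> adj H u v"
proof -
  have G: "pair_graph G" and AB: "A \<union> B = pverts G" and so: "splits_off (adj G) (pverts G) A B"
    using S unfolding splitted_graph_iff by auto
  interpret G: simple_adjacency "adj G" using G unfolding pair_graph_iff by blast
  interpret H: simple_adjacency "adj H" using H unfolding pair_graph_iff by blast
  have inG: "u \<in> pverts G \<and> v \<in> pverts G" if "adj G u v" for u v using adj_in_pverts[OF G that] .
  have inH: "u \<in> pverts H \<and> v \<in> pverts H" if "adj H u v" for u v using adj_in_pverts[OF H that] .
  have F: "adj F u v \<longleftrightarrow> adj G u v \<or> adj H u v \<or> u \<in> B \<and> v \<in> pverts H \<or> u \<in> pverts H \<and> v \<in> B" for u v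
    unfolding F_def by (rule adj_composition)
  show VF: "pverts F = pverts G \<union> pverts H" unfolding F_def by simp
  show "A \<union> B = pverts G" by (rule AB)
  have BG: "B \<subseteq> pverts G" "A \<subseteq> pverts G" using AB by auto
  have AB_disj: "A \<inter> B = {}" using so unfolding splits_off_def by blast
  have "simple_adjacency (adj F)"
  proof
    show "adj F u v \<Longrightarrow> adj F v u" for u v unfolding F using G.sym H.sym by blast
    show "\<not> adj F u u" for u unfolding F using G.irrefl H.irrefl BG disj by blast
  qed
  moreover have "finite (pverts F)" using G H unfolding VF pair_graph_iff by simp
  moreover have "parcs F \<subseteq> pverts F \<times> pverts F"
    using F inG inH BG unfolding VF adj_def by auto
  ultimately show "pair_graph F" unfolding pair_graph_iff by blast
  show rest: "pverts F - A - B = pverts H" using AB disj unfolding VF by blast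
  show onG: "adj F u v \<longleftrightarrow> adj G u v" if "u \<in> pverts G" "v \<in> pverts G" for u v
    using F inH disj that by blast
  show "adj F u v \<longleftrightarrow> adj H u v" if "u \<in> pverts H" "v \<in> pverts H" for u v
    using F inG BG disj that by blast
  have nA: "\<not> adj F a x" if "a \<in> A" "x \<in> A \<union> pverts H" for a x
  proof
    assume "adj F a x"
    moreover have "a \<notin> pverts H" "a \<notin> B" using that(1) BG disj AB_disj by blast+
    ultimately have "adj G a x" using F inH by blast
    then have "x \<in> A" using inG that(2) disj by blast
    then show False using so that(1) \<open>adj G a x\<close> unfolding splits_off_def by blast
  qed
  have "adj F b b'" if "b \<in> B" "b' \<in> B" "b \<noteq> b'" for b b'
    using so that F unfolding splits_off_def by blast
  moreover have "adj F b x" if "b \<in> B" "x \<in> pverts H" for b x using F that by blast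
  ultimately show "splits_off (adj F) (pverts F) A B"
    unfolding splits_off_def rest using BG AB_disj nA unfolding VF by auto
qed

lemma composition_of_splits_off:
  assumes G: "pair_graph G" and so: "splits_off (adj G) (pverts G) A B"
  shows "splitted_graph (induce G (A \<union> B), A, B)" "pair_graph (induce G (pverts G - A - B))"
    "composition (induce G (A \<union> B), A, B) (induce G (pverts G - A - B)) = G"
proof -
  interpret G: simple_adjacency "adj G" using G unfolding pair_graph_iff by blast
  have sub: "A \<subseteq> pverts G" "B \<subseteq> pverts G" "A \<inter> B = {}" using so unfolding splits_off_def by blast+
  have "pair_graph (induce G (A \<union> B))" using sub by (intro pair_graph_induce[OF G]) auto
  then show S: "splitted_graph (induce G (A \<union> B), A, B)"
    using so unfolding splitted_graph_iff splits_off_def by (auto simp: adj_induce)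
  show R: "pair_graph (induce G (pverts G - A - B))" by (intro pair_graph_induce[OF G]) auto
  let ?F = "composition (induce G (A \<union> B), A, B) (induce G (pverts G - A - B))"
  have "adj ?F u v \<longleftrightarrow> adj G u v" for u v
  proof
    assume "adj ?F u v"
    then consider "adj G u v" | "u \<in> B" "v \<in> pverts G - A - B" | "u \<in> pverts G - A - B" "v \<in> B"
      unfolding adj_composition adj_induce by auto
    then show "adj G u v" using so G.comm[of u v] unfolding splits_off_def by cases blast+
  next
    assume e: "adj G u v"
    then have uv: "u \<in> pverts G" "v \<in> pverts G" using adj_in_pverts[OF G] by blast+
    have "u \<notin> A" if "v \<in> pverts G - A - B" using so e that unfolding splits_off_def by blast
    moreover have "v \<notin> A" if "u \<in> pverts G - A - B" using so e that G.comm[of u v] unfolding splits_off_def by blast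
    ultimately show "adj ?F u v" using uv e unfolding adj_composition adj_induce by auto
  qed
  then have "parcs ?F = parcs G" unfolding adj_def by (auto simp del: composition.simps)
  moreover have "pverts ?F = pverts G" using sub by auto
  ultimately show "?F = G" by (intro pair_pre_digraph.equality) auto
qed

lemma decomposable_iff:
  assumes G: "pair_graph G"
  shows "decomposable G \<longleftrightarrow> \<not> indecomposable_on (adj G) (pverts G)"
proof
  assume "decomposable G"
  then obtain G1 A B H where S: "splitted_graph (G1, A, B)" and H: "pair_graph H" and disj: "pverts G1 \<inter> pverts H = {}"
    and ne: "pverts G1 \<noteq> {}" "pverts H \<noteq> {}" and F: "G = composition (G1, A, B) H"
    unfolding decomposable_def by blast
  note p = composition_properties[OF S H disj, folded F]
  have "A \<union> B \<noteq> {}" "A \<union> B \<noteq> pverts G" using p(2,4,5) ne by auto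
  then show "\<not> indecomposable_on (adj G) (pverts G)" using p(3) unfolding indecomposable_on_def by blast
next
  assume "\<not> indecomposable_on (adj G) (pverts G)"
  then obtain A B where so: "splits_off (adj G) (pverts G) A B" and ne: "A \<union> B \<noteq> {}" "A \<union> B \<noteq> pverts G"
    unfolding indecomposable_on_def by blast
  note c = composition_of_splits_off[OF G so]
  have "pverts G - A - B \<noteq> {}" using so ne unfolding splits_off_def by blast
  then show "decomposable G"
    unfolding decomposable_def using c ne
    by (intro exI[of _ "induce G (A \<union> B)"] exI[of _ A] exI[of _ B] exI[of _ "induce G (pverts G - A - B)"])
      (auto simp del: composition.simps splitted_graph.simps)
qed

text \<open>
  The vertices left over by \<open>C\<close>, \<open>D\<close> are adjacent to \<open>d\<close>, so they all lie in \<open>B\<close>; it follows that \<open>C \<subseteq> A\<close> and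
  \<open>D - {d} \<subseteq> B\<close>. Hence \<open>C\<close>, \<open>D - {d}\<close> split off from \<open>V\<close>. If these sets are empty, then \<open>d\<close> is the only element of \<open>A\<close>, and each
  vertex of \<open>B\<close> is adjacent to all other vertices, so that it splits off.
\<close>
lemma splits_off_refine_aux:
  assumes E: "simple_adjacency E" and so: "splits_off E V A B" and so2: "splits_off E (A \<union> B) C D"
    and ne: "C \<union> D \<noteq> A \<union> B" and d: "d \<in> D" "d \<in> A"
  shows "\<exists>A1 B1. splits_off E V A1 B1 \<and> A1 \<union> B1 \<noteq> {} \<and> A1 \<union> B1 \<subset> A \<union> B"
proof -
  interpret simple_adjacency E by (rule E)
  have AB: "A \<subseteq> V" "B \<subseteq> V" "A \<inter> B = {}" using so unfolding splits_off_def by blast+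
  have CD: "C \<subseteq> A \<union> B" "D \<subseteq> A \<union> B" "C \<inter> D = {}" using so2 unfolding splits_off_def by blast+
  obtain l where l: "l \<in> A \<union> B" "l \<notin> C" "l \<notin> D" using ne CD by blast
  have loA: "\<not> E a x" if "a \<in> A" "x \<in> A \<union> (V - A - B)" for a x using splits_off_low[OF so that] .
  have hiB: "E b x" if "b \<in> B" "x \<in> B \<union> (V - A - B)" "x \<noteq> b" for b x using splits_off_high[OF so that] .
  have loC: "\<not> E c x" if "c \<in> C" "x \<in> C \<union> (A \<union> B - C - D)" for c x using splits_off_low[OF so2 that] .
  have hiD: "E e x" if "e \<in> D" "x \<in> D \<union> (A \<union> B - C - D)" "x \<noteq> e" for e x using splits_off_high[OF so2 that] .
  have L: "x \<in> B" if "x \<in> A \<union> B" "x \<notin> C" "x \<notin> D" for x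
    using hiD[OF d(1), of x] loA[OF d(2), of x] that d(1) by blast
  have CA: "c \<in> A" if "c \<in> C" for c
    using loC[OF that, of l] hiB[of c l] L[OF l] l that CD by blast
  have DB: "e \<in> B" if "e \<in> D" "e \<noteq> d" for e
    using hiD[OF d(1), of e] loA[OF d(2), of e] that CD by blast
  show ?thesis
  proof (cases "C \<union> D = {d}")
    case True
    have "E l x" if x: "x \<in> V - {l}" for x
    proof (cases "x \<in> A")
      case True
      then have "x = d" using L[of x] \<open>C \<union> D = {d}\<close> AB by blast
      then show ?thesis using hiD[OF d(1), of l] l d(1) sym by blast
    next
      case False
      then show ?thesis using hiB[OF L[OF l], of x] x by blast
    qed
    then have "splits_off E V {} {l}" using l AB unfolding splits_off_def by auto
    moreover have "{l} \<subset> A \<union> B"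
    proof
      show "{l} \<subseteq> A \<union> B" using l by blast
      show "{l} \<noteq> A \<union> B" using l(3) d by auto
    qed
    ultimately show ?thesis by blast
  next
    case False
    have "splits_off E V C (D - {d})"
      unfolding splits_off_def
    proof (intro conjI ballI impI)
      show "C \<subseteq> V" "D - {d} \<subseteq> V" "C \<inter> (D - {d}) = {}" using CD AB by blast+
      show "\<not> E a a'" if "a \<in> C" "a' \<in> C" for a a' using loC that by blast
      show "E b b'" if "b \<in> D - {d}" "b' \<in> D - {d}" "b \<noteq> b'" for b b' using hiD that by blast
    next
      fix x b assume x: "x \<in> V - C - (D - {d})" and b: "b \<in> D - {d}"
      then consider "x = d" | "x \<in> A \<union> B - C - D" | "x \<in> V - A - B" by blast
      then show "E b x" using hiD[of b x] hiB[of b x] DB b d(1) by cases blast+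
    next
      fix x a assume x: "x \<in> V - C - (D - {d})" and a: "a \<in> C"
      then consider "x = d" | "x \<in> A \<union> B - C - D" | "x \<in> V - A - B" by blast
      then show "\<not> E a x" using loC[of a x] loA[OF CA[OF a], of x] a d(2) by cases blast+
    qed
    moreover have "C \<union> (D - {d}) \<noteq> {}" using False d(1) by blast
    moreover have "C \<union> (D - {d}) \<subset> A \<union> B" using CD d l by blast
    ultimately show ?thesis by blast
  qed
qed

lemma splits_off_co:
  assumes "simple_adjacency E" "splits_off E V A B" shows "splits_off (co E) V B A"
proof -
  interpret simple_adjacency E by (rule assms)
  show ?thesis using assms(2) irrefl unfolding splits_off_def co_def by (auto; metis)
qed

text \<open>
  The sets \<open>C\<close>, \<open>D\<close> need not be compatible with the partition of the split graph into \<open>A\<close> and \<open>B\<close>. The lemma shows that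
  nevertheless an outer factor with the least possible number of vertices is indecomposable.
\<close>
lemma splits_off_refine:
  assumes E: "simple_adjacency E" and so: "splits_off E V A B" and so2: "splits_off E (A \<union> B) C D"
    and ne: "C \<union> D \<noteq> {}" "C \<union> D \<noteq> A \<union> B"
  shows "\<exists>A1 B1. splits_off E V A1 B1 \<and> A1 \<union> B1 \<noteq> {} \<and> A1 \<union> B1 \<subset> A \<union> B"
proof -
  interpret simple_adjacency E by (rule E)
  have CD: "C \<subseteq> A \<union> B" "D \<subseteq> A \<union> B" "C \<inter> D = {}" using so2 unfolding splits_off_def by blast+
  consider d where "d \<in> D" "d \<in> A" | c where "c \<in> C" "c \<in> B" | "C \<subseteq> A" "D \<subseteq> B" using CD by blast
  then show ?thesis
  proof cases
    case 1
    then show ?thesis using splits_off_refine_aux[OF E so so2 ne(2)] by blast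
  next
    case 2
    have so2': "splits_off (co E) (B \<union> A) D C" using splits_off_co[OF E so2] by (simp add: Un_commute)
    have "D \<union> C \<noteq> B \<union> A" using ne(2) by blast
    from splits_off_refine_aux[OF simple_adjacency_co splits_off_co[OF E so] so2' this 2]
    obtain A1 B1 where 1: "splits_off (co E) V A1 B1" "A1 \<union> B1 \<noteq> {}" "A1 \<union> B1 \<subset> B \<union> A" by blast
    have "splits_off E V B1 A1" using splits_off_co[OF simple_adjacency_co 1(1)] unfolding co_co .
    then show ?thesis using 1 by (intro exI[of _ B1] exI[of _ A1]) auto
  next
    case 3
    have "splits_off E V C D"
      unfolding splits_off_def
    proof (intro conjI ballI impI)
      show "C \<subseteq> V" "D \<subseteq> V" "C \<inter> D = {}" using CD so unfolding splits_off_def by blast+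
      show "\<not> E a a'" if "a \<in> C" "a' \<in> C" for a a' using so2 that unfolding splits_off_def by blast
      show "E b b'" if "b \<in> D" "b' \<in> D" "b \<noteq> b'" for b b' using so2 that unfolding splits_off_def by blast
    next
      fix x b assume x: "x \<in> V - C - D" and b: "b \<in> D"
      then show "E b x" using splits_off_high[OF so, of b x] splits_off_high[OF so2 b, of x] 3 by blast
    next
      fix x a assume x: "x \<in> V - C - D" and a: "a \<in> C"
      then show "\<not> E a x" using splits_off_low[OF so, of a x] splits_off_low[OF so2 a, of x] 3 by blast
    qed
    then show ?thesis using ne CD by blast
  qed
qed

text \<open>
  By \<open>splits_off_refine\<close>, a factor with the least possible number of vertices can be split off first.
\<close>
lemma canonical_decomposition_exists:
  assumes "pair_graph G" "pverts G \<noteq> {}"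
  shows "\<exists>Ts G0. canonical_decomposition G Ts G0"
  using assms
proof (induction "card (pverts G)" arbitrary: G rule: less_induct)
  case less
  note G = less.prems(1)
  have E: "simple_adjacency (adj G)" and fin: "finite (pverts G)" using G unfolding pair_graph_iff by auto
  show ?case
  proof (cases "decomposable G")
    case False
    then show ?thesis using canonical_decomposition.base[OF less.prems] by blast
  next
    case True
    define P where "P AB \<longleftrightarrow> (case AB of (A, B) \<Rightarrow> splits_off (adj G) (pverts G) A B \<and> A \<union> B \<noteq> {} \<and> A \<union> B \<noteq> pverts G)" for AB
    obtain A0 B0 where "P (A0, B0)"
      using True unfolding decomposable_iff[OF G] indecomposable_on_def P_def by auto
    from ex_has_least_nat[of P, OF this, of "\<lambda>(A, B). card (A \<union> B)"]
    obtain AB where m: "P AB" "\<forall>CD. P CD \<longrightarrow> (case AB of (A, B) \<Rightarrow> card (A \<union> B)) \<le> (case CD of (A, B) \<Rightarrow> card (A \<union> B))"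
      by blast
    obtain A B where AB: "AB = (A, B)" by (cases AB)
    have so: "splits_off (adj G) (pverts G) A B" and ne: "A \<union> B \<noteq> {}" "A \<union> B \<noteq> pverts G"
      using m(1) unfolding AB P_def by auto
    have sub: "A \<union> B \<subseteq> pverts G" using so unfolding splits_off_def by blast
    note c = composition_of_splits_off[OF G so]
    let ?G1 = "induce G (A \<union> B)" and ?H = "induce G (pverts G - A - B)"
    have G1: "pair_graph ?G1" by (rule pair_graph_induce[OF G sub])
    have "indecomposable ?G1"
    proof
      assume "decomposable ?G1"
      then obtain C D where so2: "splits_off (adj ?G1) (A \<union> B) C D" and ne2: "C \<union> D \<noteq> {}" "C \<union> D \<noteq> A \<union> B"
        unfolding decomposable_iff[OF G1] indecomposable_on_def by auto
      have "splits_off (adj G) (A \<union> B) C D"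
        by (rule splits_off_cong[OF _ so2]) (simp add: adj_induce)
      from splits_off_refine[OF E so this ne2] obtain A1 B1
        where 1: "splits_off (adj G) (pverts G) A1 B1" "A1 \<union> B1 \<noteq> {}" "A1 \<union> B1 \<subset> A \<union> B" by blast
      then have "P (A1, B1)" using sub unfolding P_def by auto
      then have "card (A \<union> B) \<le> card (A1 \<union> B1)" using m(2) unfolding AB by auto
      moreover have "card (A1 \<union> B1) < card (A \<union> B)"
        by (rule psubset_card_mono[OF finite_subset[OF sub fin] 1(3)])
      ultimately show False by simp
    qed
    moreover have "card (pverts ?H) < card (pverts G)"
      using ne sub by (simp, intro psubset_card_mono[OF fin]) blast
    then obtain Ts G0 where "canonical_decomposition ?H Ts G0"
      using less.hyps[OF _ c(2)] ne sub by auto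
    ultimately have "canonical_decomposition (composition (?G1, A, B) ?H) ((?G1, A, B) # Ts) G0"
      using c(1) ne by (intro canonical_decomposition.step) auto
    then show ?thesis unfolding c(3) by blast
  qed
qed

lemma canonical_decomposition_components:
  assumes "canonical_decomposition G Ts G0"
  shows "pair_graph G \<and> (\<forall>G'\<in>insert G0 (fst ` set Ts).
    pair_graph G' \<and> pverts G' \<noteq> {} \<and> indecomposable G' \<and> pverts G' \<subseteq> pverts G \<and>
    (\<forall>u\<in>pverts G'. \<forall>v\<in>pverts G'. adj G' u v \<longleftrightarrow> adj G u v))"
  using assms
proof induction
  case (base G0)
  then show ?case by simp
next
  case (step G A B H Ts G0)
  have H: "pair_graph H" using step.IH by blast
  note p = composition_properties[OF step(1) H step(5)]
  have G: "pair_graph G" using step(1) unfolding splitted_graph_iff by blast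
  let ?F = "composition (G, A, B) H"
  have "pverts G' \<subseteq> pverts ?F \<and> (\<forall>u\<in>pverts G'. \<forall>v\<in>pverts G'. adj G' u v \<longleftrightarrow> adj ?F u v)"
    if "G' \<in> insert G0 (fst ` set Ts)" for G'
    using step.IH that p(2,7) by (auto simp del: composition.simps simp: subset_iff)
  moreover have "pverts G \<subseteq> pverts ?F" "\<forall>u\<in>pverts G. \<forall>v\<in>pverts G. adj G u v \<longleftrightarrow> adj ?F u v"
    using p(2,6) by auto
  ultimately show ?case using p(1) step.IH G step(2,3) by (simp del: composition.simps)
qed

section \<open>Degree sequences of canonical components\<close>

text \<open>
  A set that absorbs the arcs of the bipartite tournament splits off from the split graph.
\<close>
lemma indecomposable_split_strong:
  assumes S: "splitted_graph (G, A, B)" and ind: "indecomposable G"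
  shows "bipartite_strong (adj G) A B"
  unfolding bipartite_strong_def
proof (intro allI impI notI, elim conjE)
  fix A1 B1
  assume sub: "A1 \<subseteq> A" "B1 \<subseteq> B" and ne: "(A1, B1) \<noteq> ({}, {})" "(A1, B1) \<noteq> (A, B)"
    and h: "\<forall>a\<in>A - A1. \<forall>b\<in>B1. adj G a b" "\<forall>a\<in>A1. \<forall>b\<in>B - B1. \<not> adj G a b"
  note G = splitted_graphD(1)[OF S] and AB = splitted_graphD(2)[OF S] and so = splitted_graphD(3)[OF S]
    and disj = splitted_graphD(4)[OF S] and fin = splitted_graphD(5,6)[OF S]
  interpret simple_adjacency "adj G" using G unfolding pair_graph_iff by blast
  have "splits_off (adj G) (pverts G) A1 B1"
    unfolding splits_off_def
  proof (intro conjI ballI impI)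
    show "A1 \<subseteq> pverts G" using sub(1) AB by auto
    show "B1 \<subseteq> pverts G" using sub(2) AB by auto
    show "A1 \<inter> B1 = {}" using sub disj by auto
    show "\<not> adj G a a'" if "a \<in> A1" "a' \<in> A1" for a a' using splits_off_low[OF so, of a a'] sub that by auto
    show "adj G b b'" if "b \<in> B1" "b' \<in> B1" "b \<noteq> b'" for b b' using splits_off_high[OF so, of b b'] sub that by auto
  next
    fix x b assume x: "x \<in> pverts G - A1 - B1" and b: "b \<in> B1"
    then consider "x \<in> A - A1" | "x \<in> B" "x \<noteq> b" using AB by blast
    then show "adj G b x" using h(1) b sub sym[of x b] splits_off_high[OF so, of b x] by cases blast+
  next
    fix x a assume x: "x \<in> pverts G - A1 - B1" and a: "a \<in> A1"
    then consider "x \<in> A" | "x \<in> B - B1" using AB by blast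
    then show "\<not> adj G a x" using h(2) a sub splits_off_low[OF so, of a x] by cases blast+
  qed
  moreover have "A1 \<union> B1 \<noteq> {}" using ne(1) by auto
  moreover have "A1 \<union> B1 \<noteq> pverts G"
  proof
    assume "A1 \<union> B1 = pverts G"
    then have "A1 = A" "B1 = B" using sub disj AB by blast+
    then show False using ne(2) by blast
  qed
  ultimately show False using ind unfolding decomposable_iff[OF G] indecomposable_on_def by blast
qed

text \<open>
  The clique raises all degrees on the side \<open>B\<close> by the same amount, so that a switch in the bipartite graph is as
  unbalanced in the split graph as in the bipartite graph.
\<close>
lemma balanced_split_stable:
  assumes E: "simple_adjacency E" and bal: "balanced E V" and so: "splits_off E V A B"
  shows "stable_between E A B"
  unfolding stable_between_def
proof (intro ballI impI)
  interpret simple_adjacency E by (rule E)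
  fix a1 a2 a3 b1 b2 b3
  assume v: "a1 \<in> A" "a2 \<in> A" "a3 \<in> A" "b1 \<in> B" "b2 \<in> B" "b3 \<in> B"
    and d: "distinct [a1, a2, a3]" "distinct [b1, b2, b3]"
  have AB: "A \<subseteq> V" "B \<subseteq> V" "A \<inter> B = {}" using so unfolding splits_off_def by blast+
  have V: "{a1, a2, a3, b1, b2, b3} \<subseteq> V" using v AB by blast
  have D: "distinct [a1, a2, a3, b1, b2, b3]" using v d AB by auto
  have low: "\<not> E a a'" if "a \<in> {a1, a2, a3}" "a' \<in> {a1, a2, a3}" for a a' using so v that unfolding splits_off_def by blast
  have high: "E b b'" if "b \<in> {b1, b2, b3}" "b' \<in> {b1, b2, b3}" "b \<noteq> b'" for b b' using so v that unfolding splits_off_def by blast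
  note [simp] = low high co_def irrefl comm[of b1 a1] comm[of b1 a2] comm[of b1 a3] comm[of b2 a1] comm[of b2 a2] comm[of b2 a3]
    comm[of b3 a1] comm[of b3 a2] comm[of b3 a3]
  show "\<not> unstable E a1 a2 a3 b1 b2 b3 \<and> \<not> unstable (\<lambda>a b. \<not> E a b) a1 a2 a3 b1 b2 b3"
  proof (intro conjI notI)
    assume u: "unstable E a1 a2 a3 b1 b2 b3"
    show False
    proof (cases "E a1 b1")
      case True
      show ?thesis
        by (rule balancedD[OF bal V, of a1 b1 a3 b3]) (use True u D in \<open>auto simp: unstable_def\<close>)
    next
      case False
      show ?thesis
        by (rule balancedD[OF bal V, of a1 b3 a3 b1]) (use False u D in \<open>auto simp: unstable_def\<close>)
    qed
  next
    assume u: "unstable (\<lambda>a b. \<not> E a b) a1 a2 a3 b1 b2 b3"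
    show False
    proof (cases "E a1 b1")
      case True
      show ?thesis
        by (rule balancedD[OF bal V, of a1 b1 a3 b3]) (use True u D in \<open>auto simp: unstable_def\<close>)
    next
      case False
      show ?thesis
        by (rule balancedD[OF bal V, of a1 b3 a3 b1]) (use False u D in \<open>auto simp: unstable_def\<close>)
    qed
  qed
qed

lemma split_degrees:
  assumes S: "splitted_graph (G, A, B)"
  shows "\<And>b. b \<in> B \<Longrightarrow> deg (adj G) (pverts G) b = card {a \<in> A. adj G a b} + (card B - 1)"
    "\<And>a. a \<in> A \<Longrightarrow> deg (adj G) (pverts G) a = card {b \<in> B. adj G a b}"
proof -
  note G = splitted_graphD(1)[OF S] and AB = splitted_graphD(2)[OF S] and so = splitted_graphD(3)[OF S]
    and disj = splitted_graphD(4)[OF S] and fin = splitted_graphD(5,6)[OF S]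
  interpret simple_adjacency "adj G" using G unfolding pair_graph_iff by blast
  have split: "deg (adj G) (pverts G) v = deg (adj G) A v + deg (adj G) B v" for v
    unfolding AB[symmetric] using deg_union[OF fin disj] .
  show "deg (adj G) (pverts G) b = card {a \<in> A. adj G a b} + (card B - 1)" if b: "b \<in> B" for b
  proof -
    have "deg (adj G) (B - {b}) b = card (B - {b})"
      using deg_eq_card_iff[of "B - {b}"] fin splits_off_high[OF so b] by auto
    then have "deg (adj G) B b = card B - 1" using deg_own_side[of B b] b fin by simp
    moreover have "deg (adj G) A b = card {a \<in> A. adj G a b}" unfolding deg_def by (simp add: comm[of b])
    ultimately show ?thesis using split by simp
  qed
  show "deg (adj G) (pverts G) a = card {b \<in> B. adj G a b}" if a: "a \<in> A" for a
  proof -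
    have "deg (adj G) A a = 0" using deg_eq_0_iff[OF fin(1)] splits_off_low[OF so a] by blast
    then show ?thesis using split unfolding deg_def by simp
  qed
qed

lemma bipartite_strong_degrees:
  assumes strong: "bipartite_strong R A B" and fin: "finite A" "finite B" and two: "card A + card B \<ge> 2"
  shows "A \<noteq> {}" "B \<noteq> {}"
    "\<And>b. b \<in> B \<Longrightarrow> 0 < card {a \<in> A. R a b}" "\<And>b. b \<in> B \<Longrightarrow> card {a \<in> A. R a b} < card A"
    "\<And>a. a \<in> A \<Longrightarrow> 0 < card {b \<in> B. R a b}" "\<And>a. a \<in> A \<Longrightarrow> card {b \<in> B. R a b} < card B"
proof -
  show A: "A \<noteq> {}" and B: "B \<noteq> {}" using bipartite_strong_imp_four_cycle[OF assms] by blast+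
  show "0 < card {a \<in> A. R a b}" if "b \<in> B" for b
  proof -
    have "\<exists>a\<in>A. R a b"
    proof (rule ccontr)
      assume "\<not> ?thesis"
      then show False using bipartite_strongD[OF strong, of A "B - {b}"] A that by auto
    qed
    then show ?thesis using fin by (auto simp: card_gt_0_iff)
  qed
  show "card {a \<in> A. R a b} < card A" if "b \<in> B" for b
  proof -
    have "\<exists>a\<in>A. \<not> R a b"
    proof (rule ccontr)
      assume "\<not> ?thesis"
      then show False using bipartite_strongD[OF strong, of "{}" "{b}"] A that by auto
    qed
    then show ?thesis using fin by (intro psubset_card_mono) auto
  qed
  show "0 < card {b \<in> B. R a b}" if "a \<in> A" for a
  proof -
    have "\<exists>b\<in>B. R a b"
    proof (rule ccontr)
      assume "\<not> ?thesis"
      then show False using bipartite_strongD[OF strong, of "{a}" "{}"] B that by auto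
    qed
    then show ?thesis using fin by (auto simp: card_gt_0_iff)
  qed
  show "card {b \<in> B. R a b} < card B" if "a \<in> A" for a
  proof -
    have "\<exists>b\<in>B. \<not> R a b"
    proof (rule ccontr)
      assume "\<not> ?thesis"
      then show False using bipartite_strongD[OF strong, of "A - {a}" B] B that by auto
    qed
    then show ?thesis using fin by (intro psubset_card_mono) auto
  qed
qed

lemma all_terms_iff: "(\<forall>i\<in>{Suc 0..length L}. term_at L i = c) \<longleftrightarrow> (\<forall>x\<in>set L. x = c)"
proof -
  have "(\<forall>i\<in>{Suc 0..length L}. term_at L i = c) \<longleftrightarrow> (\<forall>j<length L. L ! j = c)"
    unfolding term_at_def by (force simp: less_eq_Suc_le[symmetric] gr0_conv_Suc dest: spec[of _ "_ - 1"] bspec[of _ _ "Suc _"])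
  then show ?thesis by (simp add: all_set_conv_all_nth)
qed

text \<open>
  The vertices of \<open>B\<close> precede those of \<open>A\<close> in the degree sequence, and the degrees fall below $i - 1$ exactly where
  the sequence passes from \<open>B\<close> to \<open>A\<close>.
\<close>
lemma split_degree_sequence:
  assumes G: "pair_graph G" and AB: "A \<union> B = pverts G" "A \<inter> B = {}" "B \<noteq> {}"
    and hi: "\<forall>b\<in>B. card B \<le> deg (adj G) (pverts G) b"
    and lo: "\<forall>a\<in>A. deg (adj G) (pverts G) a < card B"
  defines "d \<equiv> degree_sequence G"
  shows "durfee_index d = card B"
    "(\<forall>i\<in>{1..card B}. term_at d i = c) \<longleftrightarrow> (\<forall>b\<in>B. deg (adj G) (pverts G) b = c)"
    "(\<forall>i\<in>{card B + 1..length d}. term_at d i = c) \<longleftrightarrow> (\<forall>a\<in>A. deg (adj G) (pverts G) a = c)"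
proof -
  let ?f = "deg (adj G) (pverts G)"
  have fin: "finite A" "finite B" using G AB unfolding pair_graph_iff by (metis finite_Un)+
  define LA LB where "LA = rev (sorted_list_of_multiset (image_mset ?f (mset_set A)))"
    and "LB = rev (sorted_list_of_multiset (image_mset ?f (mset_set B)))"
  have set: "set LA = ?f ` A" "set LB = ?f ` B" unfolding LA_def LB_def using fin by auto
  have len: "length LB = card B" unfolding LB_def by (metis length_rev mset_sorted_list_of_multiset size_image_mset size_mset size_mset_set)
  have cB: "card B > 0" using AB(3) fin by (simp add: card_gt_0_iff)
  have "mset (LB @ LA) = image_mset ?f (mset_set (pverts G))"
    unfolding LA_def LB_def AB(1)[symmetric] using mset_set_Union[OF fin AB(2)] by simp
  moreover have "sorted (rev (LB @ LA))"
  proof -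
    have "sorted (rev LA)" "sorted (rev LB)" unfolding LA_def LB_def by simp_all
    moreover have "x \<le> y" if "x \<in> set LA" "y \<in> set LB" for x y using that hi lo unfolding set by fastforce
    ultimately show ?thesis by (simp add: sorted_append)
  qed
  ultimately have d: "d = LB @ LA" unfolding d_def by (rule degree_sequence_eqI[OF G])
  have left: "term_at d i = term_at LB i" if "1 \<le> i" "i \<le> card B" for i
  proof -
    have "i - 1 < length LB" using that len by linarith
    then show ?thesis unfolding d term_at_def by (simp add: nth_append)
  qed
  have right: "term_at d (card B + i) = term_at LA i" if "1 \<le> i" for i
  proof -
    have "\<not> card B + i - 1 < length LB" "card B + i - 1 - length LB = i - 1" using that len by linarith+
    then show ?thesis unfolding d term_at_def by (simp add: nth_append)
  qed
  have memB: "term_at LB i \<in> ?f ` B" if "1 \<le> i" "i \<le> card B" for i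
    unfolding set(2)[symmetric] term_at_def using that len by (intro nth_mem) auto
  have memA: "term_at LA i \<in> ?f ` A" if "1 \<le> i" "i \<le> length LA" for i
    unfolding set(1)[symmetric] term_at_def using that by (intro nth_mem) auto
  have "{i \<in> {1..length d}. term_at d i \<ge> i - 1} = {1..card B}"
  proof (intro equalityI subsetI)
    fix i assume i: "i \<in> {i \<in> {1..length d}. term_at d i \<ge> i - 1}"
    show "i \<in> {1..card B}"
    proof (rule ccontr)
      assume "i \<notin> {1..card B}"
      then have "i > card B" using i by auto
      then obtain j where j: "i = card B + j" "1 \<le> j" using less_imp_add_positive by (metis Suc_leI One_nat_def)
      then have "j \<le> length LA" using i unfolding d by (simp add: len)
      then have "term_at d i < card B" using memA[OF j(2)] lo right[OF j(2)] j(1) by auto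
      then show False using i j by auto
    qed
  next
    fix i assume i: "i \<in> {1..card B}"
    then have "term_at d i \<ge> card B" using memB[of i] left[of i] hi by auto
    then show "i \<in> {i \<in> {1..length d}. term_at d i \<ge> i - 1}" using i unfolding d by (auto simp: len)
  qed
  moreover have "Max {1..card B} = card B" using cB by (intro Max_eqI) auto
  ultimately show "durfee_index d = card B" unfolding durfee_index_def by metis
  show "(\<forall>i\<in>{1..card B}. term_at d i = c) \<longleftrightarrow> (\<forall>b\<in>B. ?f b = c)"
    using all_terms_iff[of LB c] left unfolding len set by simp
  have "(\<forall>i\<in>{card B + 1..length d}. term_at d i = c) \<longleftrightarrow> (\<forall>i\<in>{Suc 0..length LA}. term_at LA i = c)"
  proof
    assume l: "\<forall>i\<in>{card B + 1..length d}. term_at d i = c"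
    show "\<forall>i\<in>{Suc 0..length LA}. term_at LA i = c"
    proof
      fix i assume i: "i \<in> {Suc 0..length LA}"
      then have "card B + i \<in> {card B + 1..length d}" unfolding d by (simp add: len)
      then show "term_at LA i = c" using l right[of i] i by auto
    qed
  next
    assume r: "\<forall>i\<in>{Suc 0..length LA}. term_at LA i = c"
    show "\<forall>i\<in>{card B + 1..length d}. term_at d i = c"
    proof
      fix i assume i: "i \<in> {card B + 1..length d}"
      then have "i - card B \<in> {Suc 0..length LA}" unfolding d by (auto simp: len)
      moreover have "card B + (i - card B) = i" using i by simp
      ultimately show "term_at d i = c" using r right[of "i - card B"] by auto
    qed
  qed
  then show "(\<forall>i\<in>{card B + 1..length d}. term_at d i = c) \<longleftrightarrow> (\<forall>a\<in>A. ?f a = c)"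
    using all_terms_iff[of LA c] set by simp
qed

text \<open>
  The number of vertices outside the star is even because the matching pairs them.
\<close>
lemma star_matching_degrees:
  assumes E: "simple_adjacency E" and fin: "finite V" and sm: "star_matching E c V"
  shows "\<exists>r s. r \<ge> 1 \<and> s \<ge> 1 \<and> c \<in> V \<and> deg E V c = r \<and> card V = 2 * s + r + 1 \<and> (\<forall>v\<in>V - {c}. deg E V v = 1)"
proof -
  interpret simple_adjacency E by (rule E)
  have c: "c \<in> V" using sm unfolding star_matching_def by blast
  have one: "\<forall>v\<in>V - {c}. deg E V v = 1"
  proof
    fix v assume v: "v \<in> V - {c}"
    then obtain u where "\<forall>w\<in>V. E v w \<longleftrightarrow> w = u" "u \<in> V" using star_matching_partner[OF sm] by blast
    then have "{w \<in> V. E v w} = {u}" by blast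
    then show "deg E V v = 1" unfolding deg_def by simp
  qed
  define N where "N = {u \<in> V. E c u}"
  define M where "M = V - {c} - N"
  have O: "{v \<in> V - {c}. deg E V v = 1} = V - {c}" using one by blast
  have sparse: "\<forall>v\<in>V - {c}. deg E V v \<le> 1" using one by simp
  from sparse_structure(2)[OF fin c sparse, unfolded O, folded N_def, folded M_def]
  obtain p where "\<forall>x\<in>M. p x \<in> M \<and> p (p x) = x \<and> p x \<noteq> x" by blast
  then have "even (card M)" using even_card_involution[of M p] fin unfolding M_def by blast
  then obtain s where s: "card M = 2 * s" by blast
  have N: "N \<subseteq> V - {c}" "finite N" unfolding N_def using irrefl fin by auto
  have cN: "card N = deg E V c" unfolding N_def deg_def ..
  have "card V = Suc (card (V - {c}))" using card_Suc_Diff1[OF fin c] by simp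
  moreover have "card M = card (V - {c}) - card N" unfolding M_def using N by (simp add: card_Diff_subset)
  moreover have "card N \<le> card (V - {c})" using N fin by (intro card_mono) auto
  ultimately have "card V = 2 * s + deg E V c + 1" using s cN by linarith
  moreover have "deg E V c \<ge> 1"
  proof -
    have "N \<noteq> {}" using sm unfolding star_matching_def N_def by blast
    then show ?thesis using N(2) cN by (metis One_nat_def Suc_leI card_gt_0_iff)
  qed
  moreover have "s \<ge> 1"
  proof -
    have "M \<noteq> {}" using sm unfolding star_matching_def M_def N_def by blast
    then show ?thesis using s fin unfolding M_def by (cases s) auto
  qed
  ultimately show ?thesis using c one by blast
qed

lemma image_mset_const_on:
  "finite S \<Longrightarrow> (\<And>v. v \<in> S \<Longrightarrow> f v = k) \<Longrightarrow> image_mset f (mset_set S) = replicate_mset (card S) k"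
  by (induction S rule: finite_induct) auto

definition nonsplit_sequence :: "nat list \<Rightarrow> bool" where
  "nonsplit_sequence d \<longleftrightarrow> (\<exists>r s. r \<ge> 2 \<and> s \<ge> 1 \<and>
     d \<in> {replicate 5 2, replicate (2 * r) 1, r # replicate (2 * s + r) 1,
       replicate (2 * r) (2 * r - 2), replicate (2 * s + r) (2 * s + r - 1) @ [2 * s]})"

lemma core_degree_sequence:
  assumes G: "pair_graph G" and core: "core (adj G) (pverts G)"
  shows "nonsplit_sequence (degree_sequence G)"
proof -
  have E: "simple_adjacency (adj G)" and fin: "finite (pverts G)" using G unfolding pair_graph_iff by auto
  interpret simple_adjacency "adj G" by (rule E)
  let ?V = "pverts G" and ?f = "deg (adj G) (pverts G)"
  have center: "image_mset ?f (mset_set ?V) = add_mset (?f c) (replicate_mset n k)"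
    if "c \<in> ?V" "card ?V = n + 1" "\<forall>v\<in>?V - {c}. ?f v = k" for c n k
  proof -
    have "mset_set ?V = add_mset c (mset_set (?V - {c}))" using fin that(1) by (simp add: mset_set.remove)
    moreover have "image_mset ?f (mset_set (?V - {c})) = replicate_mset (card (?V - {c})) k"
      using fin that(3) by (intro image_mset_const_on) auto
    ultimately show ?thesis using that(1,2) fin by simp
  qed
  consider c where "star_matching (adj G) c ?V" | c where "star_matching (co (adj G)) c ?V"
    | a b c d e where "five_cycle (adj G) a b c d e" "?V = {a, b, c, d, e}"
    using core unfolding core_def by blast
  then show ?thesis
  proof cases
    case 1
    obtain r s where rs: "r \<ge> 1" "s \<ge> 1" "c \<in> ?V" "?f c = r" "card ?V = 2 * s + r + 1" "\<forall>v\<in>?V - {c}. ?f v = 1"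
      using star_matching_degrees[OF E fin 1] by blast
    have ds: "degree_sequence G = r # replicate (2 * s + r) 1"
      using center[OF rs(3,5,6)] rs(1,4) by (intro degree_sequence_eqI[OF G]) (auto simp: sorted_append)
    show ?thesis
    proof (cases "r = 1")
      case True
      \<comment> \<open>A star with a single edge is one more edge of the matching; the second parameter is then arbitrary.\<close>
      then have "degree_sequence G = replicate (2 * (s + 1)) 1" using ds by simp
      then show ?thesis unfolding nonsplit_sequence_def using rs(2)
        by (intro exI[of _ "s + 1"] exI[of _ 1]) simp
    next
      case False
      then show ?thesis unfolding nonsplit_sequence_def using ds rs(1,2)
        by (intro exI[of _ r] exI[of _ s]) simp
    qed
  next
    case 2
    obtain r s where rs: "r \<ge> 1" "s \<ge> 1" "c \<in> ?V" "deg (co (adj G)) ?V c = r" "card ?V = 2 * s + r + 1"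
      "\<forall>v\<in>?V - {c}. deg (co (adj G)) ?V v = 1"
      using star_matching_degrees[OF simple_adjacency_co fin 2] by blast
    have c: "?f c = 2 * s" using deg_co[OF fin rs(3)] rs by linarith
    have o: "\<forall>v\<in>?V - {c}. ?f v = 2 * s + r - 1"
    proof
      fix v assume "v \<in> ?V - {c}"
      then show "?f v = 2 * s + r - 1" using deg_co[OF fin, of v] bspec[OF rs(6), of v] rs(5) by simp
    qed
    have ds: "degree_sequence G = replicate (2 * s + r) (2 * s + r - 1) @ [2 * s]"
      using center[OF rs(3,5) o] rs(1) c by (intro degree_sequence_eqI[OF G]) (auto simp: sorted_append)
    show ?thesis
    proof (cases "r = 1")
      case True
      then have "degree_sequence G = replicate (2 * (s + 1)) (2 * (s + 1) - 2)"
        using ds by (simp add: replicate_append_same)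
      then show ?thesis unfolding nonsplit_sequence_def using rs(2)
        by (intro exI[of _ "s + 1"] exI[of _ 1]) simp
    next
      case False
      then show ?thesis unfolding nonsplit_sequence_def using ds rs(1,2)
        by (intro exI[of _ r] exI[of _ s]) simp
    qed
  next
    case 3
    have "card ?V = 5" using 3 unfolding five_cycle_def by simp
    moreover have "?f v = 2" if "v \<in> ?V" for v using five_cycle_regular[OF 3(1)] that unfolding 3(2) by simp
    ultimately have "mset (replicate 5 2) = image_mset ?f (mset_set ?V)" using image_mset_const_on[OF fin, of ?f 2] by simp
    then have "degree_sequence G = replicate 5 2" by (rule degree_sequence_eqI[OF G]) simp
    then show ?thesis unfolding nonsplit_sequence_def by (intro exI[of _ 2] exI[of _ 1]) simp
  qed
qed

lemma nonsplit_sequence_assembled: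
  assumes G: "pair_graph G" and seq: "nonsplit_sequence (degree_sequence G)"
  shows "assembled (adj G) (pverts G)"
proof -
  have E: "simple_adjacency (adj G)" and fin: "finite (pverts G)" using G unfolding pair_graph_iff by auto
  interpret simple_adjacency "adj G" by (rule E)
  let ?V = "pverts G" and ?f = "deg (adj G) (pverts G)"
  note m = mset_degree_sequence[OF G]
  have regular: "card ?V = n \<and> (\<forall>v\<in>?V. ?f v = k)" if "degree_sequence G = replicate n k" for n k
  proof
    show "card ?V = n" using length_degree_sequence[OF G] that by simp
    have "set_mset (image_mset ?f (mset_set ?V)) \<subseteq> {k}" unfolding m[symmetric] that by auto
    then show "\<forall>v\<in>?V. ?f v = k" using fin by auto
  qed
  have center: "\<exists>c. card ?V = n + 1 \<and> (\<forall>v\<in>?V - {c}. ?f v = k)"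
    if "mset (degree_sequence G) = add_mset x (replicate_mset n k)" for x n k
  proof -
    have e: "image_mset ?f (mset_set ?V) = add_mset x (replicate_mset n k)" using m that by simp
    then have "x \<in># image_mset ?f (mset_set ?V)" by simp
    then obtain c where c: "c \<in> ?V" "?f c = x" using fin by auto
    have "mset_set ?V = add_mset c (mset_set (?V - {c}))" using fin c(1) by (simp add: mset_set.remove)
    then have "image_mset ?f (mset_set (?V - {c})) = replicate_mset n k" using e c(2) by simp
    then have "set_mset (image_mset ?f (mset_set (?V - {c}))) \<subseteq> {k}" by auto
    then have "\<forall>v\<in>?V - {c}. ?f v = k" using fin by auto
    moreover have "card ?V = n + 1" using arg_cong[OF e, of size] by simp
    ultimately show ?thesis by blast
  qed
  have codeg: "deg (co (adj G)) ?V v = card ?V - 1 - ?f v" if "v \<in> ?V" for v using deg_co[OF fin that] by simp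
  obtain r s where rs: "r \<ge> 2" "s \<ge> 1" and "degree_sequence G \<in> {replicate 5 2, replicate (2 * r) 1, r # replicate (2 * s + r) 1,
       replicate (2 * r) (2 * r - 2), replicate (2 * s + r) (2 * s + r - 1) @ [2 * s]}"
    using seq unfolding nonsplit_sequence_def by blast
  then consider "degree_sequence G = replicate 5 2" | "degree_sequence G = replicate (2 * r) 1"
    | "degree_sequence G = r # replicate (2 * s + r) 1" | "degree_sequence G = replicate (2 * r) (2 * r - 2)"
    | "degree_sequence G = replicate (2 * s + r) (2 * s + r - 1) @ [2 * s]" by blast
  then show ?thesis
  proof cases
    case 1
    obtain a b c d e where "five_cycle (adj G) a b c d e" "?V = {a, b, c, d, e}"
      using two_regular_five_cycle[of ?V] regular[OF 1] by blast
    then show ?thesis using assembled.pentagon[of "adj G" a b c d e] by simp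
  next
    case 2
    show ?thesis by (rule assembled.sparse[OF fin]) (use regular[OF 2] in simp)
  next
    case 3
    then obtain c where "\<forall>v\<in>?V - {c}. ?f v = 1" using center[of r "2 * s + r" 1] by auto
    then show ?thesis using assembled.sparse[OF fin, of c "adj G"] by simp
  next
    case 4
    have "deg (co (adj G)) ?V v \<le> 1" if "v \<in> ?V" for v using codeg[OF that] regular[OF 4] that by simp
    then show ?thesis using assembled.dense[OF fin, of _ "adj G"] by blast
  next
    case 5
    then obtain c where c: "card ?V = 2 * s + r + 1" "\<forall>v\<in>?V - {c}. ?f v = 2 * s + r - 1"
      using center[of "2 * s" "2 * s + r" "2 * s + r - 1"] by auto
    have "deg (co (adj G)) ?V v \<le> 1" if "v \<in> ?V" "v \<noteq> c" for v
      using codeg[OF that(1)] bspec[OF c(2), of v] c(1) that by simp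
    then show ?thesis using assembled.dense[OF fin, of c "adj G"] by blast
  qed
qed

definition split_sequence :: "nat list \<Rightarrow> bool" where
  "split_sequence d \<longleftrightarrow> (let p = length d; m = durfee_index d in
     p = 1 \<or> (\<exists>c\<in>{m, p - 2}. \<forall>i\<in>{1..m}. term_at d i = c) \<or>
     (\<exists>c\<in>{1, m - 1}. \<forall>i\<in>{m + 1..p}. term_at d i = c))"

lemma indecomposable_split_sequence_iff:
  assumes S: "splitted_graph (G, A, B)" and ind: "indecomposable G" and two: "card (pverts G) \<ge> 2"
  shows "split_sequence (degree_sequence G) \<longleftrightarrow>
    (\<forall>b\<in>B. card {a \<in> A. adj G a b} = 1) \<or> (\<forall>b\<in>B. card {a \<in> A. \<not> adj G a b} = 1) \<or>
    (\<forall>a\<in>A. card {b \<in> B. adj G a b} = 1) \<or> (\<forall>a\<in>A. card {b \<in> B. \<not> adj G a b} = 1)"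
proof -
  note G = splitted_graphD(1)[OF S] and AB = splitted_graphD(2)[OF S] and so = splitted_graphD(3)[OF S]
    and disj = splitted_graphD(4)[OF S] and fin = splitted_graphD(5,6)[OF S]
  have cV: "card (pverts G) = card A + card B" unfolding AB[symmetric] using fin disj by (rule card_Un_disjoint)
  note st = bipartite_strong_degrees[OF indecomposable_split_strong[OF S ind] fin two[unfolded cV]]
  note dB = split_degrees(1)[OF S] and dA = split_degrees(2)[OF S]
  have pos: "card A > 0" "card B > 0" using st(1,2) fin by (simp_all add: card_gt_0_iff)
  have hi: "\<forall>b\<in>B. card B \<le> deg (adj G) (pverts G) b"
  proof
    fix b assume "b \<in> B"
    then show "card B \<le> deg (adj G) (pverts G) b" using dB[of b] st(3)[of b] pos by linarith
  qed
  have lo: "\<forall>a\<in>A. deg (adj G) (pverts G) a < card B"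
  proof
    fix a assume "a \<in> A"
    then show "deg (adj G) (pverts G) a < card B" using dA[of a] st(6)[of a] by linarith
  qed
  note sq = split_degree_sequence[OF G AB disj st(2) hi lo]
  have len: "length (degree_sequence G) = card A + card B" using length_degree_sequence[OF G] cV by simp
  have 1: "deg (adj G) (pverts G) b = card B \<longleftrightarrow> card {a \<in> A. adj G a b} = 1" if "b \<in> B" for b
    using dB[OF that] pos by auto
  have 2: "deg (adj G) (pverts G) b = card A + card B - 2 \<longleftrightarrow> card {a \<in> A. \<not> adj G a b} = 1" if "b \<in> B" for b
    using dB[OF that] pos st(4)[OF that] card_complement_in[OF fin(1), of "\<lambda>a. adj G a b"] by auto
  have 3: "deg (adj G) (pverts G) a = card B - 1 \<longleftrightarrow> card {b \<in> B. \<not> adj G a b} = 1" if "a \<in> A" for a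
    using dA[OF that] st(6)[OF that] card_complement_in[OF fin(2), of "adj G a"] by auto
  have "card A + card B \<noteq> 1" using pos by simp
  then show ?thesis
    unfolding split_sequence_def Let_def sq(1) sq(2) sq(3) len
    using sq(3)[unfolded len] 1 2 3 dA by simp
qed

lemma hereditary_unigraph_component:
  assumes G: "pair_graph G" and ne: "pverts G \<noteq> {}" and ind: "indecomposable G" and bal: "balanced (adj G) (pverts G)"
  shows "split_graph G \<Longrightarrow> split_sequence (degree_sequence G)"
    "\<not> split_graph G \<Longrightarrow> nonsplit_sequence (degree_sequence G)"
proof -
  have E: "simple_adjacency (adj G)" and fin: "finite (pverts G)" using G unfolding pair_graph_iff by auto
  interpret simple_adjacency "adj G" by (rule E)
  {
    assume "split_graph G"
    then obtain A B where S: "splitted_graph (G, A, B)" unfolding split_graph_def by blast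
    note AB = splitted_graphD(2)[OF S] and so = splitted_graphD(3)[OF S] and finAB = splitted_graphD(5,6)[OF S]
    show "split_sequence (degree_sequence G)"
    proof (cases "card (pverts G) = 1")
      case True
      then show ?thesis unfolding split_sequence_def Let_def length_degree_sequence[OF G] by simp
    next
      case False
      then have two: "card (pverts G) \<ge> 2" using ne fin by (metis Suc_1 Suc_leI card_gt_0_iff le_neq_implies_less One_nat_def)
      then have two': "card A + card B \<ge> 2" unfolding AB[symmetric] using card_Un_le le_trans by blast
      have one: "card {x \<in> X. P x} = 1" if unique: "\<exists>!x. x \<in> X \<and> P x" for X :: "'a set" and P
      proof -
        obtain x where "x \<in> X" "P x" "\<And>y. y \<in> X \<Longrightarrow> P y \<Longrightarrow> y = x" using unique by blast
        then have "{x \<in> X. P x} = {x}" by blast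
        then show ?thesis by simp
      qed
      have "star_like (adj G) A B"
        by (rule strong_stable_imp_star_like[OF indecomposable_split_strong[OF S ind] balanced_split_stable[OF E bal so] finAB two'])
      then consider "star_forest (adj G) A B" | "star_forest (\<lambda>a b. \<not> adj G a b) A B"
        | "star_forest (\<lambda>b a. adj G a b) B A" | "star_forest (\<lambda>b a. \<not> adj G a b) B A"
        unfolding star_like_def by blast
      then have "(\<forall>b\<in>B. card {a \<in> A. adj G a b} = 1) \<or> (\<forall>b\<in>B. card {a \<in> A. \<not> adj G a b} = 1) \<or>
        (\<forall>a\<in>A. card {b \<in> B. adj G a b} = 1) \<or> (\<forall>a\<in>A. card {b \<in> B. \<not> adj G a b} = 1)"
      proof cases
        case 1
        then have "\<forall>b\<in>B. card {a \<in> A. adj G a b} = 1" unfolding star_forest_def by (simp add: one)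
        then show ?thesis by argo
      next
        case 2
        then have "\<forall>b\<in>B. card {a \<in> A. \<not> adj G a b} = 1" unfolding star_forest_def by (simp add: one)
        then show ?thesis by argo
      next
        case 3
        then have "\<forall>a\<in>A. card {b \<in> B. adj G a b} = 1" unfolding star_forest_def by (simp add: one)
        then show ?thesis by argo
      next
        case 4
        then have "\<forall>a\<in>A. card {b \<in> B. \<not> adj G a b} = 1" unfolding star_forest_def by (simp add: one)
        then show ?thesis by argo
      qed
      then show ?thesis unfolding indecomposable_split_sequence_iff[OF S ind two] .
    qed
  }
  {
    assume ns: "\<not> split_graph G"
    have "\<exists>u\<in>pverts G - B. \<exists>v\<in>pverts G - B. adj G u v"
      if "B \<subseteq> pverts G" "\<forall>b\<in>B. \<forall>b'\<in>B. b \<noteq> b' \<longrightarrow> adj G b b'" for B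
    proof (rule ccontr)
      assume n: "\<not> ?thesis"
      have "splitted_graph (G, pverts G - B, B)"
        using n that G unfolding splitted_graph_iff splits_off_def by auto
      then show False using ns unfolding split_graph_def by blast
    qed
    then obtain S where S: "S \<subseteq> pverts G" "core (adj G) S" using nonsplit_contains_core[OF fin] by blast
    have "indecomposable_on (adj G) (pverts G)" using ind decomposable_iff[OF G] by blast
    then have "core (adj G) (pverts G)" by (rule core_extends_to_all[OF bal fin _ S(2,1)])
    then show "nonsplit_sequence (degree_sequence G)" by (rule core_degree_sequence[OF G])
  }
qed

lemma split_component_thin:
  assumes S: "splitted_graph (G, A, B)" and ne: "pverts G \<noteq> {}" and ind: "indecomposable G"
    and seq: "split_sequence (degree_sequence G)"
  shows "thin_between (adj G) A B"
proof (cases "card (pverts G) \<ge> 2")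
  case True
  show ?thesis
    using seq unfolding indecomposable_split_sequence_iff[OF S ind True] thin_between_def by auto
next
  case False
  note AB = splitted_graphD(2,4)[OF S] and fin = splitted_graphD(5,6)[OF S]
  have "card A + card B \<le> 1" using False AB fin by (simp add: card_Un_disjoint[symmetric])
  then have "card {a \<in> A. adj G a b} \<le> 1" for b
    using card_mono[OF fin(1), of "{a \<in> A. adj G a b}"] by auto
  then show ?thesis unfolding thin_between_def by blast
qed

lemma canonical_decomposition_assembled:
  assumes "canonical_decomposition G Ts G0"
    and "\<forall>G'\<in>insert G0 (fst ` set Ts). (split_graph G' \<longrightarrow> split_sequence (degree_sequence G')) \<and>
      (\<not> split_graph G' \<longrightarrow> nonsplit_sequence (degree_sequence G'))"
  shows "assembled (adj G) (pverts G)"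
  using assms
proof induction
  case (base G0)
  show ?case
  proof (cases "split_graph G0")
    case True
    then obtain A B where S: "splitted_graph (G0, A, B)" unfolding split_graph_def by blast
    have fin: "finite (pverts G0)" and so: "splits_off (adj G0) (pverts G0) A B" and AB: "A \<union> B = pverts G0"
      using S unfolding splitted_graph_iff pair_graph_iff by auto
    have "thin_between (adj G0) A B" using split_component_thin[OF S base(2,3)] base(4) True by simp
    moreover have e: "pverts G0 - A - B = {}" using AB by blast
    have "assembled (adj G0) (pverts G0 - A - B)" unfolding e by (rule assembled.sparse) auto
    ultimately show ?thesis by (intro assembled.compose[OF fin so])
  next
    case False
    then show ?thesis using nonsplit_sequence_assembled[OF base(1)] base(4) by simp
  qed
next
  case (step G A B H Ts G0)
  have H: "pair_graph H" using canonical_decomposition_components[OF step(4)] by blast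
  note p = composition_properties[OF step(1) H step(5)]
  let ?F = "composition (G, A, B) H"
  have "split_graph G" using step(1) unfolding split_graph_def by blast
  then have "thin_between (adj G) A B" using split_component_thin[OF step(1,2,3)] step.prems by simp
  then have thin: "thin_between (adj ?F) A B"
    by (rule thin_between_cong[rotated]) (use p(5,6) in blast)
  have "assembled (adj H) (pverts H)" using step.prems by (intro step.IH) simp
  then have "assembled (adj ?F) (pverts H)"
    by (rule assembled_cong) (use p(7) in blast)
  then have "assembled (adj ?F) (pverts ?F - A - B)" unfolding p(4) .
  moreover have "finite (pverts ?F)" using p(1) unfolding pair_graph_iff by blast
  ultimately show ?case using assembled.compose[OF _ p(3) thin] by blast
qed

section \<open>The characterization\<close>

theorem theorem6p2:
  fixes G :: "'a pair_pre_digraph"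
  assumes "pair_graph G"
  shows "hereditary_unigraph G \<longleftrightarrow>
    (\<forall>G'. canonical_component G G' \<longrightarrow>
      (let d' = degree_sequence G'; p = length d'; m' = durfee_index d' in
        (split_graph G' \<longrightarrow>
           p = 1 \<or>
           (\<exists>c \<in> {m', p - 2}. \<forall>i \<in> {1..m'}. term_at d' i = c) \<or>
           (\<exists>c \<in> {1, m' - 1}. \<forall>i \<in> {m' + 1..p}. term_at d' i = c)) \<and>
        (\<not> split_graph G' \<longrightarrow>
           (\<exists>r s. r \<ge> 2 \<and> s \<ge> 1 \<and>
              d' \<in> {replicate 5 2,
                    replicate (2 * r) 1,
                    r # replicate (2 * s + r) 1,
                    replicate (2 * r) (2 * r - 2),
                    replicate (2 * s + r) (2 * s + r - 1) @ [2 * s]}))))"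
proof -
  have "hereditary_unigraph G \<longleftrightarrow> (\<forall>G'. canonical_component G G' \<longrightarrow>
    (split_graph G' \<longrightarrow> split_sequence (degree_sequence G')) \<and>
    (\<not> split_graph G' \<longrightarrow> nonsplit_sequence (degree_sequence G')))"
  proof
    assume h: "hereditary_unigraph G"
    show "\<forall>G'. canonical_component G G' \<longrightarrow>
      (split_graph G' \<longrightarrow> split_sequence (degree_sequence G')) \<and>
      (\<not> split_graph G' \<longrightarrow> nonsplit_sequence (degree_sequence G'))"
    proof (intro allI impI)
      fix G' assume "canonical_component G G'"
      then obtain Ts G0 where "canonical_decomposition G Ts G0" "G' \<in> insert G0 (fst ` set Ts)"
        unfolding canonical_component_def by blast
      then have c: "pair_graph G'" "pverts G' \<noteq> {}" "indecomposable G'" "pverts G' \<subseteq> pverts G"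
        "\<forall>u\<in>pverts G'. \<forall>v\<in>pverts G'. adj G' u v \<longleftrightarrow> adj G u v"
        using canonical_decomposition_components by blast+
      have "balanced (adj G') (pverts G')"
        using balanced_cong[OF balanced_subset[OF hereditary_unigraph_balanced[OF h] c(4)]] c(5) by blast
      then show "(split_graph G' \<longrightarrow> split_sequence (degree_sequence G')) \<and>
        (\<not> split_graph G' \<longrightarrow> nonsplit_sequence (degree_sequence G'))"
        using hereditary_unigraph_component[OF c(1-3)] by blast
    qed
  next
    assume r: "\<forall>G'. canonical_component G G' \<longrightarrow>
      (split_graph G' \<longrightarrow> split_sequence (degree_sequence G')) \<and>
      (\<not> split_graph G' \<longrightarrow> nonsplit_sequence (degree_sequence G'))"
    have "assembled (adj G) (pverts G)"
    proof (cases "pverts G = {}")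
      case True
      then show ?thesis using assembled.sparse[of "{}" _ "adj G"] by simp
    next
      case False
      then obtain Ts G0 where cd: "canonical_decomposition G Ts G0"
        using canonical_decomposition_exists[OF assms] by blast
      then have "canonical_component G G'" if "G' \<in> insert G0 (fst ` set Ts)" for G'
        using that unfolding canonical_component_def by blast
      then show ?thesis using canonical_decomposition_assembled[OF cd] r by blast
    qed
    then show "hereditary_unigraph G" by (rule assembled_hereditary_unigraph[OF assms])
  qed
  then show ?thesis unfolding split_sequence_def nonsplit_sequence_def Let_def .
qed

end
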